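(* Let $n\ge1$ and let $A\subseteq\mathbb R^n$ be compact. Then $A$ possesses a weighting in $H^{-(n+1)/2}(\mathbb R^n)$, and $$|A| = \frac{1}{n!\,\omega_n}\inf\left\{\|h\|_{H^{(n+1)/2}}^2 \;:\; h\in H^{(n+1)/2}(\mathbb R^n)\text{ and } h\equiv 1\text{ on }A\right\}.$$
   Context: $\omega_n=\pi^{n/2}/\Gamma(\frac n2+1)$ is the volume of the unit ball of $\mathbb R^n$, and $\mathbb R^n$ carries the Euclidean norm $\|\cdot\|$ and metric. Scalars are complex. Bessel potential spaces: for $\alpha\in\mathbb R$, $H^\alpha=H^\alpha(\mathbb R^n)$ is the Hilbert space of tempered distributions $\varphi$ with $(1+\|\cdot\|^2)^{\alpha/2}\widehat\varphi\in L^2(\mathbb R^n)$, with norm $\|\varphi\|_{H^\alpha}=\left(\int_{\mathbb R^n}(1+\|x\|^2)^\alpha|\widehat\varphi(x)|^2\,dx\right)^{1/2}$, where the Fourier transform is normalized by $\widehat f(x)=(2\pi)^{-n/2}\int f(y)e^{-i\langle x,y\rangle}\,dy$. Elements of $H^{(n+1)/2}$ are identified with their continuous representatives. Magnitude: let $FM$ be the space of finitely supported complex measures on $\mathbb R^n$ and $\langle\mu,\nu\rangle_{\mathcal W}:=\int\int e^{-\|a-b\|}\,d\mu(a)\,d\overline\nu(b)$, which is a positive definite inner product on $FM$. Let $\mathcal W$ be the Hilbert space completion of $FM$, and for compact $A$ let $\mathcal W_A$ be the closure in $\mathcal W$ of the measures in $FM$ supported in $A$. For $w\in\mathcal W$ let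 $Zw(x):=\langle w,\delta_x\rangle_{\mathcal W}$, $x\in\mathbb R^n$. A weighting for $A$ is an element $w\in\mathcal W_A$ with $Zw(a)=1$ for all $a\in A$ (unique if it exists). The magnitude is $|A|:=\|w\|_{\mathcal W}^2$ if a weighting exists and $|A|:=\infty$ otherwise. The space $\mathcal W$ is identified with $H^{-(n+1)/2}$ through the continuous linear extension of the inclusion $FM\hookrightarrow H^{-(n+1)/2}$, which is a bijection with $\|\mu\|_{\mathcal W}=\sqrt{n!\,\omega_n}\,\|\mu\|_{H^{-(n+1)/2}}$. *)

theory Defs
  imports "HOL-Analysis.Analysis" "HOL-Library.Poly_Mapping"
begin

section \<open>Tempered distributions and the Fourier transform\<close>

primrec iter_partial :: "'a list \<Rightarrow> ('a::euclidean_space \<Rightarrow> complex) \<Rightarrow> 'a \<Rightarrow> complex" where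
  "iter_partial [] f = f"
| "iter_partial (b # bs) f = (\<lambda>x. frechet_derivative (iter_partial bs f) (at x) b)"

text \<open>Differentiability of all iterated partial derivatives means that the function is smooth.\<close>

definition schwartz :: "('a::euclidean_space \<Rightarrow> complex) set" where
  "schwartz = {f. \<forall>bs. set bs \<subseteq> Basis \<longrightarrow>
      (\<forall>x. iter_partial bs f differentiable (at x)) \<and>
      (\<forall>k::nat. bounded (range (\<lambda>x. norm x ^ k *\<^sub>R iter_partial bs f x)))}"

definition schwartz_null_seq :: "(nat \<Rightarrow> 'a::euclidean_space \<Rightarrow> complex) \<Rightarrow> bool" where
  "schwartz_null_seq \<phi> \<longleftrightarrow> (\<forall>j. \<phi> j \<in> schwartz) \<and>
     (\<forall>bs k. set bs \<subseteq> Basis \<longrightarrow>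
        uniform_limit UNIV (\<lambda>j x. norm x ^ k *\<^sub>R iter_partial bs (\<phi> j) x) (\<lambda>_. 0) sequentially)"

text \<open>A distribution is a functional on the Schwartz space; outside of it, it is given the value 0,
  so that equality of distributions is equality of functions. As the Schwartz space is metrizable,
  continuity of a linear functional is sequential continuity at 0.\<close>

definition tempered :: "(('a::euclidean_space \<Rightarrow> complex) \<Rightarrow> complex) set" where
  "tempered = {T.
     (\<forall>\<phi>. \<phi> \<notin> schwartz \<longrightarrow> T \<phi> = 0) \<and>
     (\<forall>\<phi>\<in>schwartz. \<forall>\<psi>\<in>schwartz. T (\<lambda>x. \<phi> x + \<psi> x) = T \<phi> + T \<psi>) \<and>
     (\<forall>c. \<forall>\<phi>\<in>schwartz. T (\<lambda>x. c * \<phi> x) = c * T \<phi>) \<and>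
     (\<forall>\<phi>. schwartz_null_seq \<phi> \<longrightarrow> (\<lambda>j. T (\<phi> j)) \<longlonglongrightarrow> 0)}"

text \<open>The distribution is (integration against) the function \<open>g\<close>.\<close>

definition represents :: "('a::euclidean_space \<Rightarrow> complex) \<Rightarrow> (('a \<Rightarrow> complex) \<Rightarrow> complex) \<Rightarrow> bool" where
  "represents g T \<longleftrightarrow> g \<in> borel_measurable lborel \<and>
     (\<forall>\<phi>\<in>schwartz. integrable lborel (\<lambda>x. g x * \<phi> x) \<and> T \<phi> = (LINT x|lborel. g x * \<phi> x))"

definition fourier :: "('a::euclidean_space \<Rightarrow> complex) \<Rightarrow> 'a \<Rightarrow> complex" where
  "fourier f x = (2 * pi) powr (- (real DIM('a) / 2)) *\<^sub>R
     (LINT y|lborel. f y * exp (- (\<i> * complex_of_real (x \<bullet> y))))"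

definition fourier_dist :: "(('a::euclidean_space \<Rightarrow> complex) \<Rightarrow> complex) \<Rightarrow> ('a \<Rightarrow> complex) \<Rightarrow> complex" where
  "fourier_dist T \<phi> = (if \<phi> \<in> schwartz then T (fourier \<phi>) else 0)"


section \<open>Bessel potential spaces\<close>

definition bessel_space :: "real \<Rightarrow> (('a::euclidean_space \<Rightarrow> complex) \<Rightarrow> complex) set" where
  "bessel_space \<alpha> = {T \<in> tempered. \<exists>g. represents g (fourier_dist T) \<and>
     integrable lborel (\<lambda>x. (cmod ((1 + (norm x)\<^sup>2) powr (\<alpha> / 2) *\<^sub>R g x))\<^sup>2)}"

text \<open>The representing function is determined almost everywhere.\<close>

definition bessel_norm :: "real \<Rightarrow> (('a::euclidean_space \<Rightarrow> complex) \<Rightarrow> complex) \<Rightarrow> real" where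
  "bessel_norm \<alpha> T = (let g = (SOME g. represents g (fourier_dist T)) in
     sqrt (LINT x|lborel. (1 + (norm x)\<^sup>2) powr \<alpha> * (cmod (g x))\<^sup>2))"

definition continuous_representative ::
    "('a::euclidean_space \<Rightarrow> complex) \<Rightarrow> (('a \<Rightarrow> complex) \<Rightarrow> complex) \<Rightarrow> bool" where
  "continuous_representative h T \<longleftrightarrow> continuous_on UNIV h \<and> represents h T"


section \<open>The space of finitely supported measures and its completion\<close>

text \<open>A finitely supported complex measure is given by its point masses.\<close>

type_synonym 'a fm = "'a \<Rightarrow>\<^sub>0 complex"

definition fm_inner :: "'a::euclidean_space fm \<Rightarrow> 'a fm \<Rightarrow> complex" where
  "fm_inner \<mu> \<nu> = (\<Sum>a\<in>Poly_Mapping.keys \<mu>. \<Sum>b\<in>Poly_Mapping.keys \<nu>.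
     complex_of_real (exp (- norm (a - b))) *
       Poly_Mapping.lookup \<mu> a * cnj (Poly_Mapping.lookup \<nu> b))"

definition fm_norm :: "'a::euclidean_space fm \<Rightarrow> real" where
  "fm_norm \<mu> = sqrt (Re (fm_inner \<mu> \<mu>))"

definition fm_dist :: "'a::euclidean_space fm \<Rightarrow> ('a \<Rightarrow> complex) \<Rightarrow> complex" where
  "fm_dist \<mu> \<phi> = (if \<phi> \<in> schwartz
     then \<Sum>a\<in>Poly_Mapping.keys \<mu>. Poly_Mapping.lookup \<mu> a * \<phi> a else 0)"

text \<open>Points of the completion are equivalence classes of Cauchy sequences.\<close>

definition fm_Cauchy :: "(nat \<Rightarrow> 'a::euclidean_space fm) set" where
  "fm_Cauchy = {s. \<forall>e>0. \<exists>N. \<forall>j\<ge>N. \<forall>k\<ge>N. fm_norm (s j - s k) < e}"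

definition fm_equiv :: "((nat \<Rightarrow> 'a::euclidean_space fm) \<times> (nat \<Rightarrow> 'a fm)) set" where
  "fm_equiv = {(s, t). s \<in> fm_Cauchy \<and> t \<in> fm_Cauchy \<and> (\<lambda>k. fm_norm (s k - t k)) \<longlonglongrightarrow> 0}"

type_synonym 'a W = "(nat \<Rightarrow> 'a fm) set"

definition W_space :: "'a::euclidean_space W set" where
  "W_space = fm_Cauchy // fm_equiv"

definition W_embed :: "'a::euclidean_space fm \<Rightarrow> 'a W" where
  "W_embed \<mu> = fm_equiv `` {\<lambda>_. \<mu>}"

definition W_rep :: "'a W \<Rightarrow> nat \<Rightarrow> 'a fm" where
  "W_rep w = (SOME s. s \<in> w)"

definition W_inner :: "'a::euclidean_space W \<Rightarrow> 'a W \<Rightarrow> complex" where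
  "W_inner u v = lim (\<lambda>k. fm_inner (W_rep u k) (W_rep v k))"

definition W_norm :: "'a::euclidean_space W \<Rightarrow> real" where
  "W_norm w = sqrt (Re (W_inner w w))"

definition W_diff :: "'a::euclidean_space W \<Rightarrow> 'a W \<Rightarrow> 'a W" where
  "W_diff u v = fm_equiv `` {\<lambda>k. W_rep u k - W_rep v k}"

definition W_on :: "'a::euclidean_space set \<Rightarrow> 'a W set" where
  "W_on A = {w \<in> W_space. \<forall>e>0. \<exists>\<mu>. Poly_Mapping.keys \<mu> \<subseteq> A \<and> W_norm (W_diff w (W_embed \<mu>)) < e}"


section \<open>Weightings and magnitude\<close>

definition potential :: "'a::euclidean_space W \<Rightarrow> 'a \<Rightarrow> complex" where
  "potential w x = W_inner w (W_embed (Poly_Mapping.single x 1))"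

definition is_weighting :: "'a::euclidean_space set \<Rightarrow> 'a W \<Rightarrow> bool" where
  "is_weighting A w \<longleftrightarrow> w \<in> W_on A \<and> (\<forall>a\<in>A. potential w a = 1)"

definition magnitude :: "'a::euclidean_space set \<Rightarrow> ereal" where
  "magnitude A = (if \<exists>w. is_weighting A w
     then ereal ((W_norm (THE w. is_weighting A w))\<^sup>2) else \<infinity>)"

text \<open>The identification of the completion with the Bessel potential space of order
  \<open>-(n+1)/2\<close>: the graph of the continuous extension of the inclusion \<open>fm_dist\<close>,
  whose value at the class of a Cauchy sequence is the limit of the images.\<close>

definition W_identified :: "'a::euclidean_space W \<Rightarrow> (('a \<Rightarrow> complex) \<Rightarrow> complex) \<Rightarrow> bool" where
  "W_identified w T \<longleftrightarrow> w \<in> W_space \<and> T \<in> bessel_space (- ((real DIM('a) + 1) / 2)) \<and>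
     (\<forall>s\<in>w. (\<lambda>k. bessel_norm (- ((real DIM('a) + 1) / 2)) (\<lambda>\<phi>. fm_dist (s k) \<phi> - T \<phi>)) \<longlonglongrightarrow> 0)"

definition is_weighting_dist ::
    "'a::euclidean_space set \<Rightarrow> (('a \<Rightarrow> complex) \<Rightarrow> complex) \<Rightarrow> bool" where
  "is_weighting_dist A T \<longleftrightarrow> (\<exists>w. is_weighting A w \<and> W_identified w T)"

end

theory Submission imports Defs "HOL-Probability.Probability" begin

text \<open>
  Let \<open>n\<close> be the dimension, \<open>s = (n + 1) / 2\<close> and \<open>K = n! \<omega>\<^sub>n\<close>. The kernel \<open>exp (- norm x)\<close> is
  \<open>K / (2 \<pi>)\<^sup>n\<close> times the integral of \<open>(1 + (norm \<xi>)\<^sup>2) powr - s\<close> against the character \<open>exp (\<i> (x \<bullet> \<xi>))\<close>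
  (\<open>bessel_weight_fourier\<close>). Multiplying the Fourier transform of a finitely supported measure by the
  square root of this weight therefore maps the measures into L2, and the inner product of measures
  is \<open>K\<close> times the L2 inner product (\<open>fm_inner_eq\<close>). As L2 is complete, every point of the completion
  is represented by an L2 function \<open>u\<close>, unique up to a null set, and all statements about the
  completion become statements about \<open>u\<close>.

  In this picture pairing \<open>v\<close> with the image of the point mass at \<open>x\<close> evaluates at \<open>x\<close> the continuous
  function whose Fourier transform is \<open>(1 + (norm \<xi>)\<^sup>2) powr (- s / 2)\<close> times \<open>v\<close>
  (\<open>l2_inner_point_mass\<close>), and the functions so obtained are exactly the elements of the Bessel potential space of order \<open>s\<close>, with the
  L2 norm of \<open>v\<close> as their norm. So there are two problems about the closed span \<open>S\<close> of the images of the
  point masses in \<open>A\<close>: a weighting is a \<open>u\<close> in \<open>S\<close> for which \<open>K u\<close> pairs to 1 with all these images, and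
  the infimum runs over all \<open>v\<close> in L2, in \<open>S\<close> or not, that pair to 1 with them. Some such \<open>v\<close> exists,
  because \<open>A\<close> is bounded and there is a Schwartz function that is 1 on a given ball
  (\<open>schwartz_cutoff\<close>). Orthogonal projection of \<open>v / K\<close> to \<open>S\<close> then yields a weighting
  (\<open>weighting_exists\<close>). Conversely every such \<open>v\<close> differs from \<open>K u\<close> by a function orthogonal to
  \<open>S\<close>, so that \<open>K u\<close> has the least norm (\<open>weighting_norm_le\<close>); the infimum is \<open>K\<^sup>2\<close> times the squared L2
  norm of \<open>u\<close>, and the magnitude is \<open>K\<close> times that squared norm.

  What remains is to identify distributions with functions. The distribution with Fourier transform
  \<open>g\<close> sends \<open>\<phi>\<close> to the integral of \<open>g\<close> against the reflected Fourier transform of \<open>\<phi>\<close>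
  (\<open>dist_of\<close>). That this is a tempered distribution, that every element of a Bessel space is of
  this form, and that its norm is the weighted L2 norm of \<open>g\<close> rests on three facts: the Fourier transform
  preserves Schwartz functions and turns null sequences into sequences that tend to 0 against all polynomial
  weights (\<open>fourier_schwartz\<close>, \<open>fourier_rapid_null\<close>), it is inverted by the reflected Fourier transform
  (\<open>fourier_inversion\<close>), and a function is determined almost everywhere by its integrals
  against Schwartz functions (\<open>represents_unique\<close>).
\<close>

abbreviation cor :: "real \<Rightarrow> complex" where
  "cor \<equiv> of_real"

section \<open>Smooth functions with controlled derivatives\<close>

text \<open>All iterated partial derivatives exist and lie in a class \<open>D\<close> of functions. With \<open>D\<close> the rapidly
  decreasing functions this is the Schwartz space, with \<open>D\<close> the polynomially bounded ones the space of
  its multipliers, so that closure properties need to be proved only once.\<close>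

definition smooth_in :: "('a::euclidean_space \<Rightarrow> complex) set \<Rightarrow> ('a \<Rightarrow> complex) set" where
  "smooth_in D = {f. \<forall>bs. set bs \<subseteq> Basis \<longrightarrow>
      (\<forall>x. iter_partial bs f differentiable (at x)) \<and> iter_partial bs f \<in> D}"

abbreviation partial :: "'a::euclidean_space \<Rightarrow> ('a \<Rightarrow> complex) \<Rightarrow> 'a \<Rightarrow> complex" where
  "partial b f \<equiv> (\<lambda>x. frechet_derivative f (at x) b)"

definition rapid :: "('a::euclidean_space \<Rightarrow> complex) set" where
  "rapid = {f. \<forall>k::nat. bounded (range (\<lambda>x. norm x ^ k *\<^sub>R f x))}"

definition poly_bounded :: "('a::euclidean_space \<Rightarrow> complex) set" where
  "poly_bounded = {f. \<exists>C k. \<forall>x. cmod (f x) \<le> C * (1 + norm x) ^ k}"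

text \<open>The multipliers of the Schwartz space.\<close>

definition slow :: "('a::euclidean_space \<Rightarrow> complex) set" where
  "slow = smooth_in poly_bounded"

lemma schwartz_eq_smooth_in: "schwartz = smooth_in rapid"
  by (simp add: schwartz_def smooth_in_def rapid_def)

text \<open>The derivative of a product is a sum of products, so a set of products is closed under partial
  derivatives only up to sums. This closure lets the coinduction rule below work with such sets.\<close>

inductive_set plus_closure :: "('a \<Rightarrow> complex) set \<Rightarrow> ('a \<Rightarrow> complex) set"
  for S where
  base: "f \<in> S \<Longrightarrow> f \<in> plus_closure S"
| plus: "f \<in> plus_closure S \<Longrightarrow> g \<in> plus_closure S \<Longrightarrow> (\<lambda>x. f x + g x) \<in> plus_closure S"

definition plus_closed :: "('a \<Rightarrow> complex) set \<Rightarrow> bool" where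
  "plus_closed D \<longleftrightarrow> (\<forall>f\<in>D. \<forall>g\<in>D. (\<lambda>x. f x + g x) \<in> D)"

text \<open>Smoothness is a greatest fixed point: if a set of functions in \<open>D\<close> is closed under partial
  derivatives up to finite sums, then no number of derivatives leaves \<open>D\<close>.\<close>

lemma smooth_in_coinduct:
  assumes D: "plus_closed D"
    and S: "\<And>f. f \<in> S \<Longrightarrow> f \<in> D"
      "\<And>f. f \<in> S \<Longrightarrow> \<exists>F. (\<forall>x. (f has_derivative F x) (at x)) \<and> (\<forall>b\<in>Basis. (\<lambda>x. F x b) \<in> plus_closure S)"
    and f: "f \<in> S"
  shows "f \<in> smooth_in D"
proof -
  have 1: "g \<in> D" if "g \<in> plus_closure S" for g
    using that by induction (use D S(1) in \<open>auto simp: plus_closed_def\<close>)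
  have 2: "\<exists>F. (\<forall>x. (g has_derivative F x) (at x)) \<and> (\<forall>b\<in>Basis. (\<lambda>x. F x b) \<in> plus_closure S)"
    if "g \<in> plus_closure S" for g
    using that
  proof induction
    case (base f)
    then show ?case by (rule S(2))
  next
    case (plus f g)
    then obtain F G where *: "\<forall>x. (f has_derivative F x) (at x)" "\<forall>b\<in>Basis. (\<lambda>x. F x b) \<in> plus_closure S"
      "\<forall>x. (g has_derivative G x) (at x)" "\<forall>b\<in>Basis. (\<lambda>x. G x b) \<in> plus_closure S" by blast
    show ?case
      by (rule exI[of _ "\<lambda>x h. F x h + G x h"])
        (use * in \<open>auto intro!: has_derivative_add plus_closure.plus\<close>)
  qed
  have 3: "partial b g \<in> plus_closure S \<and> (\<forall>x. g differentiable (at x))"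
    if g: "g \<in> plus_closure S" "b \<in> Basis" for b g
  proof -
    obtain F where F: "\<forall>x. (g has_derivative F x) (at x)" "\<forall>b\<in>Basis. (\<lambda>x. F x b) \<in> plus_closure S"
      using 2[OF g(1)] by blast
    then have "frechet_derivative g (at x) = F x" for x
      using frechet_derivative_at[of g "F x" x] by simp
    with F g(2) show ?thesis by (auto simp: differentiable_def)
  qed
  have 4: "iter_partial bs f \<in> plus_closure S" if "set bs \<subseteq> Basis" for bs
    using that by (induction bs) (auto simp: f plus_closure.base 3)
  show ?thesis
    unfolding smooth_in_def using 1 3 4 f nonempty_Basis by blast
qed

lemma smooth_inD:
  assumes "f \<in> smooth_in D"
  shows "f \<in> D" "f differentiable (at x)" "b \<in> Basis \<Longrightarrow> partial b f \<in> smooth_in D"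
    "set bs \<subseteq> Basis \<Longrightarrow> iter_partial bs f \<in> D"
    "(f has_derivative frechet_derivative f (at x)) (at x)"
proof -
  have *: "iter_partial bs f differentiable (at x) \<and> iter_partial bs f \<in> D" if "set bs \<subseteq> Basis" for bs x
    using assms that by (auto simp: smooth_in_def)
  show "f \<in> D" and d: "f differentiable (at x)" using *[of "[]"] by auto
  show "set bs \<subseteq> Basis \<Longrightarrow> iter_partial bs f \<in> D" using * by auto
  have "iter_partial (bs @ [b]) f = iter_partial bs (partial b f)" for bs
    by (induction bs) auto
  then show "b \<in> Basis \<Longrightarrow> partial b f \<in> smooth_in D"
    using *[of "_ @ [b]"] by (simp add: smooth_in_def)
  show "(f has_derivative frechet_derivative f (at x)) (at x)"
    using d frechet_derivative_works by blast
qed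

lemma has_derivative_imp_partial:
  "(\<And>x. (f has_derivative F x) (at x)) \<Longrightarrow> partial b f = (\<lambda>x. F x b)"
  using frechet_derivative_at[of f "F _"] by (intro ext) (metis (no_types))

lemma smooth_in_step:
  assumes "plus_closed D" "f \<in> D" "\<And>x. (f has_derivative F x) (at x)"
    "\<And>b. b \<in> Basis \<Longrightarrow> (\<lambda>x. F x b) \<in> smooth_in D"
  shows "f \<in> smooth_in D"
proof (rule smooth_in_coinduct[where S="insert f (smooth_in D)"])
  fix g assume g: "g \<in> insert f (smooth_in D)"
  show "\<exists>F. (\<forall>x. (g has_derivative F x) (at x)) \<and> (\<forall>b\<in>Basis. (\<lambda>x. F x b) \<in> plus_closure (insert f (smooth_in D)))"
  proof (cases "g = f")
    case True
    with assms show ?thesis by (auto intro!: exI[of _ F] plus_closure.base)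
  next
    case False
    with g have "g \<in> smooth_in D" by auto
    from smooth_inD(3,5)[OF this] show ?thesis
      by (intro exI[of _ "\<lambda>x. frechet_derivative g (at x)"] conjI allI ballI plus_closure.base insertI2)
  qed
qed (use assms in \<open>auto dest: smooth_inD\<close>)

lemma smooth_in_mult:
  assumes D: "plus_closed D" and mult: "\<And>f g. f \<in> D1 \<Longrightarrow> g \<in> D2 \<Longrightarrow> (\<lambda>x. f x * g x) \<in> D"
    and fg: "f \<in> smooth_in D1" "g \<in> smooth_in D2"
  shows "(\<lambda>x. f x * g x) \<in> smooth_in D"
proof (rule smooth_in_coinduct[OF D, where S="{\<lambda>x. f x * g x | f g. f \<in> smooth_in D1 \<and> g \<in> smooth_in D2}"])
  let ?S = "{\<lambda>x. f x * g x | f g. f \<in> smooth_in D1 \<and> g \<in> smooth_in D2}"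
  fix h assume "h \<in> ?S"
  then obtain f g where h: "h = (\<lambda>x. f x * g x)" and fg: "f \<in> smooth_in D1" "g \<in> smooth_in D2"
    by blast
  show "h \<in> D" unfolding h by (rule mult) (use fg in \<open>auto dest: smooth_inD\<close>)
  show "\<exists>F. (\<forall>x. (h has_derivative F x) (at x)) \<and> (\<forall>b\<in>Basis. (\<lambda>x. F x b) \<in> plus_closure ?S)"
  proof (intro exI conjI allI ballI)
    show "(h has_derivative (\<lambda>y. f x * frechet_derivative g (at x) y + frechet_derivative f (at x) y * g x)) (at x)" for x
      unfolding h by (intro has_derivative_mult smooth_inD(5)[OF fg(1)] smooth_inD(5)[OF fg(2)])
    fix b :: 'a assume b: "b \<in> Basis"
    show "(\<lambda>x. f x * frechet_derivative g (at x) b + frechet_derivative f (at x) b * g x) \<in> plus_closure ?S"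
    proof (intro plus_closure.plus plus_closure.base)
      show "(\<lambda>x. f x * partial b g x) \<in> ?S"
        by (intro CollectI exI conjI, rule refl) (use smooth_inD(3)[OF fg(2) b] fg in auto)
      show "(\<lambda>x. partial b f x * g x) \<in> ?S"
        by (intro CollectI exI conjI, rule refl) (use smooth_inD(3)[OF fg(1) b] fg in auto)
    qed
  qed
qed (use fg in blast)

lemma smooth_in_add:
  assumes D: "plus_closed D" and fg: "f \<in> smooth_in D" "g \<in> smooth_in D"
  shows "(\<lambda>x. f x + g x) \<in> smooth_in D"
proof (rule smooth_in_coinduct[OF D, where S="{\<lambda>x. f x + g x | f g. f \<in> smooth_in D \<and> g \<in> smooth_in D}"])
  let ?S = "{\<lambda>x. f x + g x | f g. f \<in> smooth_in D \<and> g \<in> smooth_in D}"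
  fix h assume "h \<in> ?S"
  then obtain f g where h: "h = (\<lambda>x. f x + g x)" and fg: "f \<in> smooth_in D" "g \<in> smooth_in D"
    by blast
  show "h \<in> D" unfolding h using D fg by (auto simp: plus_closed_def dest: smooth_inD)
  show "\<exists>F. (\<forall>x. (h has_derivative F x) (at x)) \<and> (\<forall>b\<in>Basis. (\<lambda>x. F x b) \<in> plus_closure ?S)"
  proof (intro exI conjI allI ballI)
    show "(h has_derivative (\<lambda>y. frechet_derivative f (at x) y + frechet_derivative g (at x) y)) (at x)" for x
      unfolding h by (intro has_derivative_add smooth_inD(5)[OF fg(1)] smooth_inD(5)[OF fg(2)])
    fix b :: 'a assume b: "b \<in> Basis"
    show "(\<lambda>x. frechet_derivative f (at x) b + frechet_derivative g (at x) b) \<in> plus_closure ?S"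
      by (intro plus_closure.base CollectI exI conjI, rule refl)
        (use smooth_inD(3)[OF fg(1) b] smooth_inD(3)[OF fg(2) b] in auto)
  qed
qed (use fg in blast)

lemma plus_closed_rapid: "plus_closed rapid"
  unfolding plus_closed_def rapid_def by (auto simp: scaleR_add_right intro!: bounded_plus_comp)

lemma norm_power_le: "norm x ^ j \<le> (1 + norm (x::'a::euclidean_space)) ^ j"
  by (intro power_mono) auto

lemma poly_bounded_obtain:
  assumes "f \<in> poly_bounded"
  obtains C k where "C \<ge> 0" "\<And>x. cmod (f x) \<le> C * (1 + norm x) ^ k"
proof -
  obtain C k where Ck: "\<And>x. cmod (f x) \<le> C * (1 + norm x) ^ k"
    using assms by (auto simp: poly_bounded_def)
  have "0 \<le> C" using order_trans[OF norm_ge_zero Ck[of 0]] by simp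
  with Ck that show ?thesis by blast
qed

lemma poly_bounded_mult:
  assumes "f \<in> poly_bounded" "g \<in> poly_bounded" shows "(\<lambda>x. f x * g x) \<in> poly_bounded"
proof -
  obtain C k where 1: "C \<ge> 0" "\<And>x. cmod (f x) \<le> C * (1 + norm x) ^ k"
    using poly_bounded_obtain[OF assms(1)] by blast
  obtain D l where 2: "D \<ge> 0" "\<And>x. cmod (g x) \<le> D * (1 + norm x) ^ l"
    using poly_bounded_obtain[OF assms(2)] by blast
  have "cmod (f x * g x) \<le> (C * D) * (1 + norm x) ^ (k + l)" for x
    using mult_mono[OF 1(2)[of x] 2(2)[of x]] 1(1) by (simp add: norm_mult power_add mult_ac)
  then show ?thesis unfolding poly_bounded_def by blast
qed

lemma plus_closed_poly_bounded: "plus_closed poly_bounded"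
  unfolding plus_closed_def
proof (intro ballI)
  fix f g :: "'a \<Rightarrow> complex"
  assume fg: "f \<in> poly_bounded" "g \<in> poly_bounded"
  obtain C k where 1: "C \<ge> 0" "\<And>x. cmod (f x) \<le> C * (1 + norm x) ^ k"
    using poly_bounded_obtain[OF fg(1)] by blast
  obtain D l where 2: "D \<ge> 0" "\<And>x. cmod (g x) \<le> D * (1 + norm x) ^ l"
    using poly_bounded_obtain[OF fg(2)] by blast
  have "cmod (f x + g x) \<le> (C + D) * (1 + norm x) ^ (k + l)" for x
  proof -
    have "C * (1 + norm x) ^ k \<le> C * (1 + norm x) ^ (k + l)"
      by (intro mult_left_mono power_increasing 1) auto
    moreover have "D * (1 + norm x) ^ l \<le> D * (1 + norm x) ^ (k + l)"
      by (intro mult_left_mono power_increasing 2) auto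
    ultimately show ?thesis
      using 1(2)[of x] 2(2)[of x] norm_triangle_ineq[of "f x" "g x"] by (simp add: distrib_right)
  qed
  then show "(\<lambda>x. f x + g x) \<in> poly_bounded" unfolding poly_bounded_def by blast
qed

text \<open>Lets decay against all powers of \<open>norm x\<close> be replaced by decay against all powers of \<open>1 + norm x\<close>,
  which are never smaller than 1.\<close>

lemma one_plus_norm_power_le:
  "(1 + norm (x::'a::real_normed_vector)) ^ k \<le> 2 ^ k * (1 + norm x ^ k)"
proof (cases "norm x \<le> 1")
  case True
  then have "(1 + norm x) ^ k \<le> 2 ^ k" by (intro power_mono) auto
  also have "\<dots> \<le> 2 ^ k * (1 + norm x ^ k)" by simp
  finally show ?thesis .
next
  case False
  then have "(1 + norm x) ^ k \<le> (2 * norm x) ^ k" by (intro power_mono) auto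
  also have "\<dots> \<le> 2 ^ k * (1 + norm x ^ k)" by (simp add: power_mult_distrib)
  finally show ?thesis .
qed

lemma rapid_iff: "f \<in> rapid \<longleftrightarrow> (\<forall>k. \<exists>C\<ge>0. \<forall>x. (1 + norm x) ^ k * cmod (f x) \<le> C)"
proof
  assume f: "f \<in> rapid"
  show "\<forall>k. \<exists>C\<ge>0. \<forall>x. (1 + norm x) ^ k * cmod (f x) \<le> C"
  proof
    fix k :: nat
    have *: "\<exists>C. \<forall>x. norm x ^ k * cmod (f x) \<le> C" for k
      using f unfolding rapid_def bounded_iff by auto
    obtain A B where AB: "\<And>x. norm x ^ 0 * cmod (f x) \<le> A" "\<And>x. norm x ^ k * cmod (f x) \<le> B"
      using * by meson
    have "(1 + norm x) ^ k * cmod (f x) \<le> 2 ^ k * (A + B)" for x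
    proof -
      have "(1 + norm x) ^ k * cmod (f x) \<le> 2 ^ k * (1 + norm x ^ k) * cmod (f x)"
        by (intro mult_right_mono one_plus_norm_power_le) auto
      also have "\<dots> = 2 ^ k * (norm x ^ 0 * cmod (f x) + norm x ^ k * cmod (f x))"
        by (simp add: algebra_simps)
      also have "\<dots> \<le> 2 ^ k * (A + B)" by (intro mult_left_mono add_mono AB) auto
      finally show ?thesis .
    qed
    moreover have "0 \<le> 2 ^ k * (A + B)"
      using calculation[of 0] by (auto intro: order_trans[rotated])
    ultimately show "\<exists>C\<ge>0. \<forall>x. (1 + norm x) ^ k * cmod (f x) \<le> C" by blast
  qed
next
  assume *: "\<forall>k. \<exists>C\<ge>0. \<forall>x. (1 + norm x) ^ k * cmod (f x) \<le> C"
  show "f \<in> rapid"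
    unfolding rapid_def bounded_iff
  proof (intro CollectI allI)
    fix k
    obtain C where C: "\<And>x. (1 + norm x) ^ k * cmod (f x) \<le> C" using * by meson
    have "norm x ^ k * cmod (f x) \<le> C" for x
      by (rule order_trans[OF mult_right_mono[OF norm_power_le] C]) auto
    then show "\<exists>a. \<forall>x\<in>range (\<lambda>x. norm x ^ k *\<^sub>R f x). norm x \<le> a" by auto
  qed
qed

lemma poly_bounded_mult_rapid:
  assumes "f \<in> poly_bounded" "g \<in> rapid" shows "(\<lambda>x. f x * g x) \<in> rapid"
  unfolding rapid_iff
proof
  fix k
  obtain C l where 1: "C \<ge> 0" "\<And>x. cmod (f x) \<le> C * (1 + norm x) ^ l"
    using poly_bounded_obtain[OF assms(1)] by blast
  obtain B where B: "B \<ge> 0" "\<And>x. (1 + norm x) ^ (k + l) * cmod (g x) \<le> B"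
    using assms(2) unfolding rapid_iff by meson
  have "(1 + norm x) ^ k * cmod (f x * g x) \<le> C * B" for x
  proof -
    have "(1 + norm x) ^ k * cmod (f x * g x) \<le> (1 + norm x) ^ k * ((C * (1 + norm x) ^ l) * cmod (g x))"
      unfolding norm_mult by (intro mult_left_mono mult_right_mono 1) auto
    also have "\<dots> = C * ((1 + norm x) ^ (k + l) * cmod (g x))" by (simp add: power_add)
    also have "\<dots> \<le> C * B" by (intro mult_left_mono B 1)
    finally show ?thesis .
  qed
  then show "\<exists>C\<ge>0. \<forall>x. (1 + norm x) ^ k * cmod (f x * g x) \<le> C"
    using 1 B by (meson mult_nonneg_nonneg)
qed

lemma slow_mult: "f \<in> slow \<Longrightarrow> g \<in> slow \<Longrightarrow> (\<lambda>x. f x * g x) \<in> slow"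
  unfolding slow_def by (rule smooth_in_mult[OF plus_closed_poly_bounded poly_bounded_mult])

lemma slow_add: "f \<in> slow \<Longrightarrow> g \<in> slow \<Longrightarrow> (\<lambda>x. f x + g x) \<in> slow"
  unfolding slow_def by (rule smooth_in_add[OF plus_closed_poly_bounded])

lemma slow_mult_schwartz: "f \<in> slow \<Longrightarrow> g \<in> schwartz \<Longrightarrow> (\<lambda>x. f x * g x) \<in> schwartz"
  unfolding slow_def schwartz_eq_smooth_in
  by (rule smooth_in_mult[OF plus_closed_rapid poly_bounded_mult_rapid])

lemma schwartz_add: "f \<in> schwartz \<Longrightarrow> g \<in> schwartz \<Longrightarrow> (\<lambda>x. f x + g x) \<in> schwartz"
  unfolding schwartz_eq_smooth_in by (rule smooth_in_add[OF plus_closed_rapid])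

lemma slow_affine: "(\<lambda>x. cor (x \<bullet> c + d)) \<in> slow"
  unfolding slow_def
proof (rule smooth_in_coinduct[OF plus_closed_poly_bounded, where S="range (\<lambda>(c, d) x. cor (x \<bullet> c + d))"])
  fix f :: "'a \<Rightarrow> complex" assume "f \<in> range (\<lambda>(c, d) x. cor (x \<bullet> c + d))"
  then obtain c d where f: "f = (\<lambda>x. cor (x \<bullet> c + d))" by auto
  have "cmod (f x) \<le> (norm c + \<bar>d\<bar>) * (1 + norm x) ^ 1" for x
  proof -
    have "\<bar>x \<bullet> c\<bar> \<le> norm x * norm c" by (rule Cauchy_Schwarz_ineq2)
    then have "cmod (f x) \<le> norm x * norm c + \<bar>d\<bar>" unfolding f norm_of_real by linarith
    also have "\<dots> \<le> norm x * norm c + \<bar>d\<bar> + (norm c + norm x * \<bar>d\<bar>)" by simp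
    also have "\<dots> = (norm c + \<bar>d\<bar>) * (1 + norm x) ^ 1" by (simp add: algebra_simps)
    finally show ?thesis .
  qed
  then show "f \<in> poly_bounded" unfolding poly_bounded_def by blast
  show "\<exists>F. (\<forall>x. (f has_derivative F x) (at x)) \<and>
      (\<forall>b\<in>Basis. (\<lambda>x. F x b) \<in> plus_closure (range (\<lambda>(c, d) x. cor (x \<bullet> c + d))))"
  proof (intro exI[of _ "\<lambda>x h. cor (h \<bullet> c)"] conjI allI ballI)
    show "(f has_derivative (\<lambda>h. cor (h \<bullet> c))) (at x)" for x
      unfolding f by (auto intro!: derivative_eq_intros)
    show "(\<lambda>x. cor (b \<bullet> c)) \<in> plus_closure (range (\<lambda>(c, d) x. cor (x \<bullet> c + d)))" for b
      by (rule plus_closure.base, rule range_eqI[of _ _ "(0, b \<bullet> c)"]) simp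
  qed
qed auto

lemma slow_inner: "(\<lambda>x. cor (x \<bullet> c)) \<in> slow"
  using slow_affine[of c 0] by simp

lemma slow_const: "(\<lambda>x. c) \<in> slow"
proof -
  have *: "(\<lambda>x::'a. c) \<in> poly_bounded" for c
    unfolding poly_bounded_def by (intro CollectI exI[of _ "cmod c"] exI[of _ 0]) simp
  then show ?thesis unfolding slow_def
    by (intro smooth_in_coinduct[OF plus_closed_poly_bounded, where S="range (\<lambda>c x. c)"])
      (auto intro!: * exI[of _ "\<lambda>_ _. 0"] derivative_eq_intros plus_closure.base)
qed

lemma slow_norm_sq: "(\<lambda>x. cor ((norm x)\<^sup>2)) \<in> slow"
  unfolding slow_def
proof (rule smooth_in_step[OF plus_closed_poly_bounded, where F="\<lambda>x h. of_real (2 * (x \<bullet> h))"])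
  show "(\<lambda>x::'a. cor ((norm x)\<^sup>2)) \<in> poly_bounded"
    unfolding poly_bounded_def
    by (intro CollectI exI[of _ 1] exI[of _ 2]) (auto intro!: power_mono simp: norm_power)
  show "((\<lambda>x::'a. cor ((norm x)\<^sup>2)) has_derivative (\<lambda>h. cor (2 * (x \<bullet> h)))) (at x)" for x
    unfolding power2_norm_eq_inner by (auto intro!: derivative_eq_intros simp: inner_commute)
  show "(\<lambda>x. cor (2 * (x \<bullet> b))) \<in> smooth_in poly_bounded" for b :: 'a
    using slow_inner[of "2 *\<^sub>R b"] by (simp add: slow_def)
qed

lemma schwartz_scale: "f \<in> schwartz \<Longrightarrow> (\<lambda>x. c * f x) \<in> schwartz"
  using slow_mult_schwartz[OF slow_const] .

text \<open>Partial derivatives of \<open>p * exp (- q)\<close> are again a multiplier times \<open>exp (- q)\<close>, so that only the size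
  of such functions has to be checked.\<close>

lemma smooth_in_mult_exp:
  assumes D: "plus_closed D" and exp_D: "\<And>p. p \<in> slow \<Longrightarrow> (\<lambda>x. p x * exp (- q x)) \<in> D"
    and q: "q \<in> slow" and p: "p \<in> slow"
  shows "(\<lambda>x. p x * exp (- q x)) \<in> smooth_in D"
proof (rule smooth_in_coinduct[OF D, where S="{\<lambda>x. p x * exp (- q x) | p. p \<in> slow}"])
  let ?S = "{\<lambda>x. p x * exp (- q x) | p. p \<in> slow}"
  fix f assume "f \<in> ?S"
  then obtain p where f: "f = (\<lambda>x. p x * exp (- q x))" and p: "p \<in> slow" by blast
  show "f \<in> D" unfolding f by (rule exp_D[OF p])
  show "\<exists>F. (\<forall>x. (f has_derivative F x) (at x)) \<and> (\<forall>b\<in>Basis. (\<lambda>x. F x b) \<in> plus_closure ?S)"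
  proof (intro exI[of _ "\<lambda>x h. (frechet_derivative p (at x) h + (-1) * (p x * frechet_derivative q (at x) h)) * exp (- q x)"] conjI allI ballI)
    show "(f has_derivative (\<lambda>h. (frechet_derivative p (at x) h + (-1) * (p x * frechet_derivative q (at x) h)) * exp (- q x))) (at x)" for x
      unfolding f
      by (rule has_derivative_eq_rhs, rule has_derivative_mult,
          rule smooth_inD(5)[OF p[unfolded slow_def]],
          rule has_derivative_compose[OF has_derivative_minus[OF smooth_inD(5)[OF q[unfolded slow_def]]] DERIV_exp[unfolded has_field_derivative_def]])
         (simp add: algebra_simps)
    fix b :: 'a assume b: "b \<in> Basis"
    have "partial b p \<in> slow" "partial b q \<in> slow"
      using smooth_inD(3)[OF p[unfolded slow_def] b] smooth_inD(3)[OF q[unfolded slow_def] b] by (auto simp: slow_def)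
    then have "(\<lambda>x. partial b p x + (-1) * (p x * partial b q x)) \<in> slow"
      using p by (intro slow_add slow_mult slow_const)
    note * = this
    show "(\<lambda>x. (frechet_derivative p (at x) b + (-1) * (p x * frechet_derivative q (at x) b)) * exp (- q x)) \<in> plus_closure ?S"
      by (rule plus_closure.base, rule CollectI, rule exI, rule conjI[OF refl *])
  qed
qed (use p in blast)

lemma power_le_exp: "0 \<le> t \<Longrightarrow> t ^ k \<le> fact k * exp (t::real)"
proof -
  assume t: "0 \<le> t"
  have "t ^ k /\<^sub>R fact k \<le> suminf (\<lambda>n. t ^ n /\<^sub>R fact n)"
    using sum_le_suminf[of "\<lambda>n. t ^ n /\<^sub>R fact n" "{k}"] t summable_exp_generic[of t] by auto
  then show ?thesis by (simp add: exp_def field_simps)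
qed

text \<open>The Gaussian and the cutoff function below both arise in this way.\<close>

lemma exp_neg_in_schwartz:
  assumes q: "q \<in> slow" and c: "c > 0" and bd: "\<And>x. Re (q x) \<ge> c * norm x - C"
  shows "(\<lambda>x. exp (- q x)) \<in> schwartz"
proof -
  have e: "(\<lambda>x. exp (- q x)) \<in> rapid"
    unfolding rapid_iff
  proof
    fix k
    have "(1 + norm x) ^ k * cmod (exp (- q x)) \<le> (fact k * exp c * exp C) / c ^ k" for x
    proof -
      have "(c * (1 + norm x)) ^ k \<le> fact k * exp (c * (1 + norm x))"
        using c by (intro power_le_exp) auto
      then have "c ^ k * (1 + norm x) ^ k * cmod (exp (- q x)) \<le> fact k * exp (c * (1 + norm x)) * exp (- Re (q x))"
        unfolding norm_exp_eq_Re power_mult_distrib by (simp add: mult_right_mono)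
      also have "\<dots> \<le> fact k * exp (c * (1 + norm x)) * exp (C - c * norm x)"
        using bd[of x] by (intro mult_left_mono) auto
      also have "\<dots> = fact k * exp c * exp C"
        by (simp add: algebra_simps flip: exp_add)
      finally show ?thesis using c by (simp add: field_simps)
    qed
    moreover have "0 \<le> (fact k * exp c * exp C) / c ^ k" using c by simp
    ultimately show "\<exists>C\<ge>0. \<forall>x. (1 + norm x) ^ k * cmod (exp (- q x)) \<le> C" by blast
  qed
  have "(\<lambda>x. 1 * exp (- q x)) \<in> smooth_in rapid"
    by (rule smooth_in_mult_exp[OF plus_closed_rapid _ q slow_const])
      (auto intro!: poly_bounded_mult_rapid[OF _ e] dest: smooth_inD(1) simp: slow_def)
  then show ?thesis by (simp add: schwartz_eq_smooth_in)
qed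

lemma exp_neg_in_slow:
  assumes q: "q \<in> slow" and bd: "\<And>x. Re (q x) \<ge> - C"
  shows "(\<lambda>x. exp (- q x)) \<in> slow"
proof -
  have e: "(\<lambda>x. exp (- q x)) \<in> poly_bounded"
    unfolding poly_bounded_def
    by (intro CollectI exI[of _ "exp C"] exI[of _ 0]) (use bd in \<open>auto simp: norm_exp_eq_Re minus_le_iff\<close>)
  have "(\<lambda>x. 1 * exp (- q x)) \<in> smooth_in poly_bounded"
    by (rule smooth_in_mult_exp[OF plus_closed_poly_bounded _ q slow_const])
      (auto intro!: poly_bounded_mult[OF _ e] dest: smooth_inD(1) simp: slow_def)
  then show ?thesis by (simp add: slow_def)
qed

lemma norm_quadratic_lower: "(v::real) > 0 \<Longrightarrow> norm x - 1 / (4 * v) \<le> v * (norm x)\<^sup>2"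
proof -
  assume v: "v > 0"
  have "0 \<le> (2 * v * norm x - 1)\<^sup>2" by simp
  then have "4 * v * norm x - 1 \<le> 4 * v * (v * (norm x)\<^sup>2)" by (simp add: power2_eq_square algebra_simps)
  then show ?thesis using v by (simp add: field_simps)
qed

lemma exp_imag_slow: "(\<lambda>x. exp (\<i> * cor (x \<bullet> a))) \<in> slow"
proof -
  have "(\<lambda>x. exp (- (- \<i> * cor (x \<bullet> a)))) \<in> slow"
    by (rule exp_neg_in_slow[where C=0]) (intro slow_mult slow_inner slow_const, simp)
  then show ?thesis by simp
qed

lemma gaussian_in_schwartz: "v > 0 \<Longrightarrow> (\<lambda>x. exp (- cor (v * (norm x)\<^sup>2))) \<in> schwartz"
  unfolding of_real_mult using norm_quadratic_lower[of v]
  by (intro exp_neg_in_schwartz[where c=1 and C="1 / (4 * v)"] slow_mult slow_norm_sq slow_const)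
    auto


text \<open>For \<open>P = 1\<close> this is the standard smooth function that vanishes exactly for \<open>t \<le> 0\<close>.
  The factor \<open>P (1 / t)\<close> makes the family closed under differentiation; \<open>flatexp_deriv\<close> is the map induced
  on the polynomials.\<close>

definition flatexp :: "real poly \<Rightarrow> real \<Rightarrow> real" where
  "flatexp P t = (if t \<le> 0 then 0 else poly P (1 / t) * exp (- (1 / t)))"

definition flatexp_deriv :: "real poly \<Rightarrow> real poly" where
  "flatexp_deriv P = [:0, 0, 1:] * (P - pderiv P)"

lemma flatexp_bounded: "\<exists>B\<ge>0. \<forall>t. \<bar>flatexp P t\<bar> \<le> B"
proof (intro exI conjI allI)
  let ?B = "\<Sum>i\<le>degree P. \<bar>coeff P i\<bar> * fact i"
  show "0 \<le> ?B" by (intro sum_nonneg) auto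
  fix t
  show "\<bar>flatexp P t\<bar> \<le> ?B"
  proof (cases "t \<le> 0")
    case True
    then show ?thesis using \<open>0 \<le> ?B\<close> by (simp add: flatexp_def)
  next
    case False
    define u where "u = 1 / t"
    have u: "0 \<le> u" using False by (simp add: u_def)
    have "\<bar>flatexp P t\<bar> = \<bar>poly P u\<bar> * exp (- u)" using False by (simp add: flatexp_def u_def abs_mult)
    also have "\<dots> \<le> (\<Sum>i\<le>degree P. \<bar>coeff P i\<bar> * u ^ i) * exp (- u)"
      unfolding poly_altdef using u
      by (intro mult_right_mono order_trans[OF sum_abs]) (auto simp: abs_mult)
    also have "\<dots> = (\<Sum>i\<le>degree P. \<bar>coeff P i\<bar> * (u ^ i * exp (- u)))"
      unfolding sum_distrib_right by (simp add: mult.assoc)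
    also have "\<dots> \<le> ?B"
    proof (intro sum_mono mult_left_mono)
      fix i
      show "u ^ i * exp (- u) \<le> fact i"
        using power_le_exp[OF u, of i] by (simp add: exp_minus field_simps)
    qed auto
    finally show ?thesis .
  qed
qed

text \<open>At 0 the two extra factors \<open>1 / t\<close> allowed by boundedness of the whole family give
  \<open>\<bar>flatexp P t\<bar> \<le> B * t\<^sup>2\<close>, hence derivative 0.\<close>

lemma flatexp_has_derivative: "(flatexp P has_real_derivative flatexp (flatexp_deriv P) t) (at t)"
proof -
  consider "t < 0" | "t = 0" | "t > 0" by linarith
  then show ?thesis
  proof cases
    case 1
    have "((\<lambda>_. 0) has_real_derivative 0) (at t)" by simp
    then have "(flatexp P has_real_derivative 0) (at t)"
      by (rule has_field_derivative_transform_within_open[where S="{..<0}"]) (use 1 in \<open>auto simp: flatexp_def\<close>)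
    then show ?thesis using 1 by (simp add: flatexp_def)
  next
    case 2
    obtain B where B: "\<And>t. \<bar>flatexp (pCons 0 (pCons 0 P)) t\<bar> \<le> B"
      using flatexp_bounded by blast
    have *: "flatexp P h = h * h * flatexp (pCons 0 (pCons 0 P)) h" for h
      by (simp add: flatexp_def)
    have "((\<lambda>h. flatexp P h / h) \<longlongrightarrow> 0) (at 0)"
    proof (rule Lim_null_comparison[where g="\<lambda>h. \<bar>h\<bar> * B"])
      show "((\<lambda>h. \<bar>h\<bar> * B) \<longlongrightarrow> 0) (at 0)" by (auto intro!: tendsto_eq_intros)
      show "\<forall>\<^sub>F h in at 0. norm (flatexp P h / h) \<le> \<bar>h\<bar> * B"
        using B by (intro always_eventually allI) (simp add: * abs_mult mult_left_mono)
    qed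
    then show ?thesis using 2 by (simp add: has_field_derivative_iff flatexp_def)
  next
    case 3
    have "((\<lambda>t. poly P (1 / t) * exp (- (1 / t))) has_real_derivative flatexp (flatexp_deriv P) t) (at t)"
      using 3 by (auto intro!: derivative_eq_intros simp: flatexp_def flatexp_deriv_def field_simps power2_eq_square)
    then show ?thesis
      by (rule has_field_derivative_transform_within_open[where S="{0<..}"]) (use 3 in \<open>auto simp: flatexp_def\<close>)
  qed
qed

lemma flatexp_slow:
  assumes q: "\<And>x. (q has_derivative q' x) (at x)" "\<And>b. b \<in> Basis \<Longrightarrow> (\<lambda>x. cor (q' x b)) \<in> slow"
  shows "(\<lambda>x. cor (flatexp P (q x))) \<in> slow"
  unfolding slow_def
proof (rule smooth_in_coinduct[OF plus_closed_poly_bounded, where S="{\<lambda>x. p x * cor (flatexp P (q x)) | p P. p \<in> slow}"])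
  let ?S = "{\<lambda>x. p x * cor (flatexp P (q x)) | p P. p \<in> slow}"
  have "(\<lambda>x. 1 * cor (flatexp P (q x))) \<in> ?S"
    by (intro CollectI exI conjI, rule refl, rule slow_const)
  then show "(\<lambda>x. cor (flatexp P (q x))) \<in> ?S" by simp
  fix f assume "f \<in> ?S"
  then obtain p P where f: "f = (\<lambda>x. p x * cor (flatexp P (q x)))" and p: "p \<in> slow" by blast
  obtain B where B: "\<And>t. \<bar>flatexp P t\<bar> \<le> B"
    using flatexp_bounded by blast
  have "(\<lambda>x. cor (flatexp P (q x))) \<in> poly_bounded"
    unfolding poly_bounded_def
    by (intro CollectI exI[of _ B] exI[of _ 0]) (simp add: B)
  then show "f \<in> poly_bounded"
    unfolding f using p by (intro poly_bounded_mult) (auto simp: slow_def dest: smooth_inD(1))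
  show "\<exists>F. (\<forall>x. (f has_derivative F x) (at x)) \<and> (\<forall>b\<in>Basis. (\<lambda>x. F x b) \<in> plus_closure ?S)"
  proof (intro exI[of _ "\<lambda>x h. frechet_derivative p (at x) h * cor (flatexp P (q x))
      + (p x * cor (q' x h)) * cor (flatexp (flatexp_deriv P) (q x))"] conjI allI ballI)
    fix x
    have "((\<lambda>x. flatexp P (q x)) has_derivative (\<lambda>h. flatexp (flatexp_deriv P) (q x) * q' x h)) (at x)"
      by (rule has_derivative_compose[OF q(1) flatexp_has_derivative[unfolded has_field_derivative_def]])
    from has_derivative_mult[OF smooth_inD(5)[OF p[unfolded slow_def]] has_derivative_of_real[OF this]]
    show "(f has_derivative (\<lambda>h. frechet_derivative p (at x) h * cor (flatexp P (q x))
      + (p x * cor (q' x h)) * cor (flatexp (flatexp_deriv P) (q x)))) (at x)"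
      unfolding f by (rule has_derivative_eq_rhs) (simp add: algebra_simps)
  next
    fix b :: 'a assume b: "b \<in> Basis"
    have *: "partial b p \<in> slow"
      using smooth_inD(3)[OF p[unfolded slow_def] b] by (simp add: slow_def)
    have S: "(\<lambda>x. p x * cor (flatexp P (q x))) \<in> ?S" if "p \<in> slow" for p P
      using that by blast
    show "(\<lambda>x. frechet_derivative p (at x) b * cor (flatexp P (q x))
      + (p x * cor (q' x b)) * cor (flatexp (flatexp_deriv P) (q x))) \<in> plus_closure ?S"
      by (intro plus_closure.plus plus_closure.base S * slow_mult p q(2)[OF b])
  qed
qed

text \<open>The function is \<open>exp (- (norm x)\<^sup>2 f ((norm x)\<^sup>2 - a))\<close>, where \<open>f\<close> is smooth, 0 on the negative half line
  and at least \<open>exp (- 1)\<close> beyond 1. It is 1 on the ball and decays like a Gaussian.\<close>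

lemma schwartz_cutoff:
  fixes a :: real
  shows "\<exists>h::'a::euclidean_space \<Rightarrow> complex. h \<in> schwartz \<and> (\<forall>x. (norm x)\<^sup>2 \<le> a \<longrightarrow> h x = 1)"
proof -
  let ?q = "\<lambda>x::'a. cor ((norm x)\<^sup>2) * cor (flatexp 1 ((norm x)\<^sup>2 - a))"
  have "(\<lambda>x::'a. cor (flatexp 1 ((norm x)\<^sup>2 - a))) \<in> slow"
  proof (rule flatexp_slow[where q'="\<lambda>x h. x \<bullet> (2 *\<^sub>R h)"])
    show "((\<lambda>x::'a. (norm x)\<^sup>2 - a) has_derivative (\<lambda>h. x \<bullet> (2 *\<^sub>R h))) (at x)" for x
      unfolding power2_norm_eq_inner by (auto intro!: derivative_eq_intros simp: inner_commute)
  qed (rule slow_inner)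
  then have q: "?q \<in> slow" by (intro slow_mult slow_norm_sq)
  have pos: "0 \<le> flatexp 1 t" for t by (simp add: flatexp_def)
  \<comment> \<open>Where \<open>(norm x)\<^sup>2 > a + 1\<close> the exponent is at least \<open>exp (- 1) * (norm x)\<^sup>2\<close>. The first summand of the constant pays for the passage to linear growth, the second for the remaining ball.\<close>
  have low: "Re (?q x) \<ge> 1 * norm x - (1 / (4 * exp (-1)) + exp (-1) * (\<bar>a\<bar> + 1))" for x
  proof -
    have "exp (-1) * (norm x)\<^sup>2 - exp (-1) * (\<bar>a\<bar> + 1) \<le> (norm x)\<^sup>2 * flatexp 1 ((norm x)\<^sup>2 - a)"
    proof (cases "(norm x)\<^sup>2 \<le> a + 1")
      case True
      then have "exp (-1) * (norm x)\<^sup>2 \<le> exp (-1) * (\<bar>a\<bar> + 1)" by (intro mult_left_mono) auto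
      moreover have "0 \<le> (norm x)\<^sup>2 * flatexp 1 ((norm x)\<^sup>2 - a)" by (simp add: pos)
      ultimately show ?thesis by linarith
    next
      case False
      then have "exp (-1) \<le> flatexp 1 ((norm x)\<^sup>2 - a)" by (simp add: flatexp_def)
      then have "(norm x)\<^sup>2 * exp (-1) \<le> (norm x)\<^sup>2 * flatexp 1 ((norm x)\<^sup>2 - a)"
        by (intro mult_left_mono) auto
      moreover have "0 \<le> exp (-1) * (\<bar>a\<bar> + 1)" by simp
      ultimately show ?thesis using mult.commute[of "(norm x)\<^sup>2" "exp (-1)"] by linarith
    qed
    with norm_quadratic_lower[of "exp (-1)" x] show ?thesis by simp
  qed
  have "(\<lambda>x. exp (- ?q x)) \<in> schwartz"
    by (rule exp_neg_in_schwartz[OF q zero_less_one low])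
  moreover have "exp (- ?q x) = 1" if "(norm x)\<^sup>2 \<le> a" for x :: 'a
    using that by (simp add: flatexp_def)
  ultimately show ?thesis by blast
qed

lemma slow_prod: "(\<And>i. i \<in> I \<Longrightarrow> f i \<in> slow) \<Longrightarrow> (\<lambda>x. \<Prod>i\<in>I. f i x) \<in> slow"
  by (induction I rule: infinite_finite_induct) (auto intro: slow_const slow_mult)

lemma flatexp_affine_slow: "(\<lambda>x. cor (flatexp P (x \<bullet> c + d))) \<in> slow"
  by (rule flatexp_slow[where q'="\<lambda>x h. h \<bullet> c"]) (auto intro!: derivative_eq_intros slow_const)

section \<open>Square-integrable functions\<close>

definition L2 :: "'b measure \<Rightarrow> ('b \<Rightarrow> complex) set" where
  "L2 M = {f. f \<in> borel_measurable M \<and> integrable M (\<lambda>x. (cmod (f x))\<^sup>2)}"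

definition l2_inner :: "'b measure \<Rightarrow> ('b \<Rightarrow> complex) \<Rightarrow> ('b \<Rightarrow> complex) \<Rightarrow> complex" where
  "l2_inner M f g = (LINT x|M. f x * cnj (g x))"

definition l2_norm :: "'b measure \<Rightarrow> ('b \<Rightarrow> complex) \<Rightarrow> real" where
  "l2_norm M f = sqrt (LINT x|M. (cmod (f x))\<^sup>2)"

abbreviation l2_dist :: "'b measure \<Rightarrow> ('b \<Rightarrow> complex) \<Rightarrow> ('b \<Rightarrow> complex) \<Rightarrow> real" where
  "l2_dist M f g \<equiv> l2_norm M (\<lambda>x. f x - g x)"

lemma L2_measurable: "f \<in> L2 M \<Longrightarrow> f \<in> borel_measurable M"
  by (simp add: L2_def)

lemma L2_integrable: "f \<in> L2 M \<Longrightarrow> integrable M (\<lambda>x. (cmod (f x))\<^sup>2)"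
  by (simp add: L2_def)

lemma l2_norm_nonneg [simp]: "0 \<le> l2_norm M f"
  by (simp add: l2_norm_def)

lemma l2_norm_sq: "(l2_norm M f)\<^sup>2 = (LINT x|M. (cmod (f x))\<^sup>2)"
  by (simp add: l2_norm_def)

lemma L2_dominated:
  assumes f: "f \<in> borel_measurable M" and g: "g \<in> L2 M" "h \<in> L2 M"
    and le: "\<And>x. (cmod (f x))\<^sup>2 \<le> C * (cmod (g x))\<^sup>2 + D * (cmod (h x))\<^sup>2"
  shows "f \<in> L2 M"
proof -
  have "integrable M (\<lambda>x. C * (cmod (g x))\<^sup>2 + D * (cmod (h x))\<^sup>2)"
    using g by (intro Bochner_Integration.integrable_add integrable_mult_right L2_integrable)
  then have "integrable M (\<lambda>x. (cmod (f x))\<^sup>2)"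
    by (rule Bochner_Integration.integrable_bound) (use f in \<open>auto intro!: order_trans[OF le] AE_I2\<close>)
  then show ?thesis using f by (simp add: L2_def)
qed

lemma cmod_add_sq_le: "(cmod (a + b))\<^sup>2 \<le> 2 * (cmod a)\<^sup>2 + 2 * (cmod b)\<^sup>2"
proof -
  have "(cmod (a + b))\<^sup>2 \<le> (cmod a + cmod b)\<^sup>2" by (intro power_mono norm_triangle_ineq) auto
  also have "\<dots> \<le> 2 * (cmod a)\<^sup>2 + 2 * (cmod b)\<^sup>2"
    using zero_le_power2[of "cmod a - cmod b"] by (simp add: power2_eq_square algebra_simps)
  finally show ?thesis .
qed

lemma L2_add:
  assumes "f \<in> L2 M" "g \<in> L2 M" shows "(\<lambda>x. f x + g x) \<in> L2 M"
  by (rule L2_dominated[OF borel_measurable_add[OF assms[THEN L2_measurable]] assms cmod_add_sq_le])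

lemma L2_mult_bounded:
  assumes "f \<in> borel_measurable M" "\<And>x. cmod (f x) \<le> B" "g \<in> L2 M"
  shows "(\<lambda>x. f x * g x) \<in> L2 M"
proof (rule L2_dominated[OF _ assms(3) assms(3), where C="B\<^sup>2" and D=0])
  show "(\<lambda>x. f x * g x) \<in> borel_measurable M"
    using assms(1) L2_measurable[OF assms(3)] by (rule borel_measurable_times)
  show "(cmod (f x * g x))\<^sup>2 \<le> B\<^sup>2 * (cmod (g x))\<^sup>2 + 0 * (cmod (g x))\<^sup>2" for x
    using power_mono[OF assms(2)[of x], of 2] by (simp add: norm_mult power_mult_distrib mult_right_mono)
qed

lemma L2_scale: "f \<in> L2 M \<Longrightarrow> (\<lambda>x. c * f x) \<in> L2 M"
  by (rule L2_mult_bounded[where B="cmod c"]) auto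

lemma L2_diff:
  assumes "f \<in> L2 M" "g \<in> L2 M" shows "(\<lambda>x. f x - g x) \<in> L2 M"
  using L2_add[OF assms(1) L2_scale[OF assms(2), of "-1"]] by simp

lemma borel_measurable_cnj: "f \<in> borel_measurable M \<Longrightarrow> (\<lambda>x. cnj (f x)) \<in> borel_measurable M"
  by (rule measurable_compose[OF _ borel_measurable_continuous_onI[OF continuous_on_cnj[OF continuous_on_id]]])

lemma L2_cnj: "f \<in> L2 M \<Longrightarrow> (\<lambda>x. cnj (f x)) \<in> L2 M"
  by (simp add: L2_def borel_measurable_cnj)

lemma L2_mult_integrable:
  assumes "f \<in> L2 M" "g \<in> L2 M" shows "integrable M (\<lambda>x. f x * g x)"
proof -
  have "integrable M (\<lambda>x. (cmod (f x))\<^sup>2 + (cmod (g x))\<^sup>2)"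
    using assms by (intro Bochner_Integration.integrable_add L2_integrable)
  then show ?thesis
  proof (rule Bochner_Integration.integrable_bound)
    show "(\<lambda>x. f x * g x) \<in> borel_measurable M"
      using assms by (intro borel_measurable_times L2_measurable)
    have "cmod (f x * g x) \<le> (cmod (f x))\<^sup>2 + (cmod (g x))\<^sup>2" for x
    proof -
      have "0 \<le> (cmod (f x) - cmod (g x))\<^sup>2" "0 \<le> cmod (f x) * cmod (g x)" by simp_all
      then show ?thesis unfolding norm_mult power2_diff by linarith
    qed
    then show "AE x in M. norm (f x * g x) \<le> norm ((cmod (f x))\<^sup>2 + (cmod (g x))\<^sup>2)" by simp
  qed
qed

text \<open>The norms are enlarged by \<open>e > 0\<close> to make the weighted inequality of arithmetic and geometric means
  applicable when one of them is 0; then \<open>e\<close> tends to 0.\<close>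

lemma L2_Cauchy_Schwarz_norm:
  assumes "f \<in> L2 M" "g \<in> L2 M"
  shows "(LINT x|M. cmod (f x * g x)) \<le> l2_norm M f * l2_norm M g"
proof -
  let ?I = "LINT x|M. cmod (f x * g x)" and ?a = "l2_norm M f" and ?b = "l2_norm M g"
  have *: "?I \<le> (?a + e) * (?b + e)" if e: "e > 0" for e
  proof -
    define a' b' where "a' = ?a + e" and "b' = ?b + e"
    have pos: "a' > 0" "b' > 0" using e by (auto intro: add_nonneg_pos simp: a'_def b'_def)
    have "2 * cmod (f x * g x) \<le> b' / a' * (cmod (f x))\<^sup>2 + a' / b' * (cmod (g x))\<^sup>2" for x
    proof -
      have "0 \<le> (b' * cmod (f x) - a' * cmod (g x))\<^sup>2" by simp
      then have "2 * (a' * b' * cmod (f x * g x)) \<le> b'\<^sup>2 * (cmod (f x))\<^sup>2 + a'\<^sup>2 * (cmod (g x))\<^sup>2"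
        unfolding power2_diff norm_mult power_mult_distrib by (simp add: mult_ac)
      then show ?thesis using pos by (simp add: field_simps power2_eq_square)
    qed
    then have "(LINT x|M. 2 * cmod (f x * g x)) \<le> (LINT x|M. b' / a' * (cmod (f x))\<^sup>2 + a' / b' * (cmod (g x))\<^sup>2)"
      using assms by (intro integral_mono Bochner_Integration.integrable_add integrable_mult_right
          L2_integrable integrable_norm L2_mult_integrable)
    also have "\<dots> = b' / a' * ?a\<^sup>2 + a' / b' * ?b\<^sup>2"
      using assms by (simp add: l2_norm_sq L2_integrable)
    also have "\<dots> \<le> b' / a' * a'\<^sup>2 + a' / b' * b'\<^sup>2"
      using pos e by (intro add_mono mult_left_mono power_mono) (auto simp: a'_def b'_def)
    also have "\<dots> = 2 * (a' * b')" using pos by (simp add: power2_eq_square)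
    finally show ?thesis unfolding a'_def b'_def by simp
  qed
  have "((\<lambda>e. (?a + e) * (?b + e)) \<longlongrightarrow> (?a + 0) * (?b + 0)) (at_right 0)"
    by (intro tendsto_intros)
  then have "?I \<le> (?a + 0) * (?b + 0)"
    by (rule tendsto_lowerbound)
      (use * in \<open>auto simp: eventually_at_right_field intro!: exI[of _ 1]\<close>)
  then show ?thesis by simp
qed

lemma L2_Cauchy_Schwarz:
  assumes "f \<in> L2 M" "g \<in> L2 M"
  shows "cmod (LINT x|M. f x * g x) \<le> l2_norm M f * l2_norm M g"
  by (rule order_trans[OF integral_norm_bound L2_Cauchy_Schwarz_norm[OF assms]])

lemma l2_norm_cnj [simp]: "l2_norm M (\<lambda>x. cnj (f x)) = l2_norm M f"
  by (simp add: l2_norm_def)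

lemma l2_inner_bound:
  assumes "f \<in> L2 M" "g \<in> L2 M"
  shows "cmod (l2_inner M f g) \<le> l2_norm M f * l2_norm M g"
  using L2_Cauchy_Schwarz[OF assms(1) L2_cnj[OF assms(2)]] by (simp add: l2_inner_def)

lemma l2_inner_add_left:
  assumes "f \<in> L2 M" "g \<in> L2 M" "h \<in> L2 M"
  shows "l2_inner M (\<lambda>x. f x + g x) h = l2_inner M f h + l2_inner M g h"
  using assms by (simp add: l2_inner_def distrib_right L2_mult_integrable L2_cnj)

lemma l2_inner_diff_left:
  assumes "f \<in> L2 M" "g \<in> L2 M" "h \<in> L2 M"
  shows "l2_inner M (\<lambda>x. f x - g x) h = l2_inner M f h - l2_inner M g h"
  using assms by (simp add: l2_inner_def left_diff_distrib L2_mult_integrable L2_cnj)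

lemma l2_inner_scale_left: "l2_inner M (\<lambda>x. c * f x) h = c * l2_inner M f h"
  by (simp add: l2_inner_def mult.assoc)

lemma l2_inner_commute: "l2_inner M f g = cnj (l2_inner M g f)"
  unfolding l2_inner_def
  by (subst integral_bounded_linear'[OF bounded_linear_cnj bounded_linear_cnj, symmetric]) (auto simp: mult.commute)

lemma l2_inner_add_right:
  assumes "f \<in> L2 M" "g \<in> L2 M" "h \<in> L2 M"
  shows "l2_inner M f (\<lambda>x. g x + h x) = l2_inner M f g + l2_inner M f h"
  using assms by (simp add: l2_inner_def distrib_left L2_mult_integrable L2_cnj)

lemma l2_inner_diff_right:
  assumes "f \<in> L2 M" "g \<in> L2 M" "h \<in> L2 M"
  shows "l2_inner M f (\<lambda>x. g x - h x) = l2_inner M f g - l2_inner M f h"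
  using assms by (simp add: l2_inner_def right_diff_distrib L2_mult_integrable L2_cnj)

lemma l2_inner_scale_right: "l2_inner M f (\<lambda>x. c * h x) = cnj c * l2_inner M f h"
  by (subst (1 2) l2_inner_commute) (simp add: l2_inner_scale_left)

lemma l2_inner_self: "l2_inner M f f = cor ((l2_norm M f)\<^sup>2)"
  unfolding l2_inner_def l2_norm_sq
  by (subst integral_complex_of_real[symmetric]) (simp add: complex_norm_square del: of_real_power)

lemma l2_norm_add_sq:
  assumes "f \<in> L2 M" "g \<in> L2 M"
  shows "(l2_norm M (\<lambda>x. f x + g x))\<^sup>2 = (l2_norm M f)\<^sup>2 + 2 * Re (l2_inner M f g) + (l2_norm M g)\<^sup>2"
proof -
  have "cor ((l2_norm M (\<lambda>x. f x + g x))\<^sup>2) =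
      l2_inner M f f + l2_inner M g f + (l2_inner M f g + l2_inner M g g)"
    unfolding l2_inner_self[symmetric] using assms
    by (simp add: l2_inner_add_left l2_inner_add_right L2_add)
  also have "Re \<dots> = (l2_norm M f)\<^sup>2 + 2 * Re (l2_inner M f g) + (l2_norm M g)\<^sup>2"
    by (subst l2_inner_commute[of M g f]) (simp add: l2_inner_self)
  finally show ?thesis by (metis Re_complex_of_real)
qed

lemma l2_norm_scale: "l2_norm M (\<lambda>x. c * f x) = cmod c * l2_norm M f"
  by (simp add: l2_norm_def norm_mult power_mult_distrib real_sqrt_mult)

lemma l2_norm_triangle:
  assumes "f \<in> L2 M" "g \<in> L2 M"
  shows "l2_norm M (\<lambda>x. f x + g x) \<le> l2_norm M f + l2_norm M g"
proof (rule power2_le_imp_le)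
  have "Re (l2_inner M f g) \<le> l2_norm M f * l2_norm M g"
    by (rule order_trans[OF complex_Re_le_cmod l2_inner_bound[OF assms]])
  then show "(l2_norm M (\<lambda>x. f x + g x))\<^sup>2 \<le> (l2_norm M f + l2_norm M g)\<^sup>2"
    unfolding l2_norm_add_sq[OF assms] power2_sum by simp
qed simp

lemma l2_norm_minus_commute: "l2_dist M f g = l2_dist M g f"
  by (simp add: l2_norm_def norm_minus_commute)

lemma l2_norm_triangle3:
  assumes "f \<in> L2 M" "g \<in> L2 M" "h \<in> L2 M"
  shows "l2_dist M f h \<le> l2_dist M f g + l2_dist M g h"
  using l2_norm_triangle[OF L2_diff[OF assms(1,2)] L2_diff[OF assms(2,3)]] by simp

lemma l2_inner_tendsto:
  assumes "\<And>k. f k \<in> L2 M" "u \<in> L2 M" "\<And>k. g k \<in> L2 M" "v \<in> L2 M"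
    and "(\<lambda>k. l2_dist M (f k) u) \<longlonglongrightarrow> 0" "(\<lambda>k. l2_dist M (g k) v) \<longlonglongrightarrow> 0"
  shows "(\<lambda>k. l2_inner M (f k) (g k)) \<longlonglongrightarrow> l2_inner M u v"
proof -
  let ?df = "\<lambda>k x. f k x - u x" and ?dg = "\<lambda>k x. g k x - v x"
  have *: "l2_inner M (f k) (g k) - l2_inner M u v
      = l2_inner M (?df k) (?dg k) + l2_inner M (?df k) v + l2_inner M u (?dg k)" for k
    using assms(1-4) by (simp add: l2_inner_diff_left l2_inner_diff_right L2_diff)
  have "(\<lambda>k. l2_inner M (f k) (g k) - l2_inner M u v) \<longlonglongrightarrow> 0"
  proof (rule Lim_null_comparison)
    show "\<forall>\<^sub>F k in sequentially. norm (l2_inner M (f k) (g k) - l2_inner M u v) \<le>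
        l2_norm M (?df k) * l2_norm M (?dg k) + l2_norm M (?df k) * l2_norm M v + l2_norm M u * l2_norm M (?dg k)"
      unfolding * using assms(1-4)
      by (intro always_eventually allI order_trans[OF norm_triangle_ineq] add_mono l2_inner_bound L2_diff)
    show "(\<lambda>k. l2_norm M (?df k) * l2_norm M (?dg k) + l2_norm M (?df k) * l2_norm M v + l2_norm M u * l2_norm M (?dg k)) \<longlonglongrightarrow> 0"
      using assms(5,6) by (auto intro!: tendsto_eq_intros)
  qed
  then show ?thesis by (simp add: LIM_zero_iff)
qed

text \<open>The Riesz-Fischer theorem. Along a subsequence with increments of norm at most \<open>(1/2) ^ n\<close> the series of
  \<open>2 ^ n\<close> times the squared increments has finite integral, so the increments decay geometrically almost
  everywhere and the subsequence converges pointwise. Fatou's lemma makes the pointwise limit an L2 limit.\<close>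

lemma L2_complete:
  assumes f: "\<And>k. f k \<in> L2 M"
    and Cauchy: "\<And>e. e > 0 \<Longrightarrow> \<exists>N. \<forall>j\<ge>N. \<forall>k\<ge>N. l2_dist M (f j) (f k) < e"
  shows "\<exists>u\<in>L2 M. (\<lambda>k. l2_dist M (f k) u) \<longlonglongrightarrow> 0"
proof -
  have [measurable]: "f k \<in> borel_measurable M" for k using f by (simp add: L2_measurable)
  have nn: "(\<integral>\<^sup>+x. ennreal ((cmod (f j x - f k x))\<^sup>2) \<partial>M) = ennreal ((l2_dist M (f j) (f k))\<^sup>2)" for j k
    unfolding l2_norm_sq by (intro nn_integral_eq_integral L2_integrable L2_diff f) auto
  have "\<forall>n. \<exists>N. \<forall>j\<ge>N. \<forall>k\<ge>N. l2_dist M (f j) (f k) < (1/2) ^ n"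
    using Cauchy by simp
  then obtain N where N: "\<And>n j k. j \<ge> N n \<Longrightarrow> k \<ge> N n \<Longrightarrow> l2_dist M (f j) (f k) < (1/2) ^ n"
    by metis
  \<comment> \<open>A monotone choice of indices beyond every \<open>N n\<close>.\<close>
  define r where "r n = (\<Sum>i\<le>n. N i)" for n
  have rN: "N n \<le> r n" for n unfolding r_def by (rule member_le_sum) auto
  have r_mono: "r n \<le> r (Suc n)" for n by (simp add: r_def)
  have rN': "N n \<le> r (Suc n)" for n using rN r_mono order_trans by blast
  define d where "d n x = f (r (Suc n)) x - f (r n) x" for n x
  have [measurable]: "d n \<in> borel_measurable M" for n unfolding d_def by measurable
  have d: "(\<integral>\<^sup>+x. ennreal ((cmod (d n x))\<^sup>2) \<partial>M) \<le> ennreal ((1/4) ^ n)" for n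
  proof -
    have "(l2_norm M (\<lambda>x. f (r (Suc n)) x - f (r n) x))\<^sup>2 \<le> ((1/2) ^ n)\<^sup>2"
      by (intro power_mono less_imp_le[OF N[OF rN' rN]]) simp
    then show ?thesis unfolding d_def nn
      by (intro ennreal_leI) (simp add: power2_eq_square flip: power_mult_distrib)
  qed
  have "(\<integral>\<^sup>+x. (suminf (\<lambda>n. ennreal (2 ^ n * (cmod (d n x))\<^sup>2))) \<partial>M) = (suminf (\<lambda>n. \<integral>\<^sup>+x. ennreal (2 ^ n * (cmod (d n x))\<^sup>2) \<partial>M))"
    by (rule nn_integral_suminf) measurable
  also have "\<dots> \<le> (suminf (\<lambda>n. ennreal ((1/2) ^ n)))"
  proof (intro suminf_le summableI)
    fix n
    have "(\<integral>\<^sup>+x. ennreal (2 ^ n * (cmod (d n x))\<^sup>2) \<partial>M) = ennreal (2 ^ n) * (\<integral>\<^sup>+x. ennreal ((cmod (d n x))\<^sup>2) \<partial>M)"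
      by (subst nn_integral_cmult[symmetric]) (auto simp: ennreal_mult)
    also have "\<dots> \<le> ennreal (2 ^ n) * ennreal ((1/4) ^ n)" by (intro mult_left_mono d) auto
    also have "\<dots> = ennreal ((1/2) ^ n)"
      by (simp flip: ennreal_mult power_mult_distrib)
    finally show "(\<integral>\<^sup>+x. ennreal (2 ^ n * (cmod (d n x))\<^sup>2) \<partial>M) \<le> ennreal ((1/2) ^ n)" .
  qed
  also have "\<dots> = ennreal (suminf (\<lambda>n. (1/2) ^ n))"
    by (rule suminf_ennreal2) (auto intro: summable_geometric)
  finally have fin: "(\<integral>\<^sup>+x. (suminf (\<lambda>n. ennreal (2 ^ n * (cmod (d n x))\<^sup>2))) \<partial>M) \<noteq> \<infinity>"
    by (auto simp: top_unique)
  define u where "u x = lim (\<lambda>n. f (r n) x)" for x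
  have [measurable]: "u \<in> borel_measurable M" unfolding u_def by measurable
  have conv: "AE x in M. (\<lambda>n. f (r n) x) \<longlonglongrightarrow> u x"
  proof -
    have "AE x in M. (suminf (\<lambda>n. ennreal (2 ^ n * (cmod (d n x))\<^sup>2))) \<noteq> \<infinity>"
      by (rule nn_integral_PInf_AE[OF _ fin]) measurable
    then show ?thesis
    proof (rule AE_mp, intro AE_I2 impI)
      fix x assume "(suminf (\<lambda>n. ennreal (2 ^ n * (cmod (d n x))\<^sup>2))) \<noteq> \<infinity>"
      then have "summable (\<lambda>n. 2 ^ n * (cmod (d n x))\<^sup>2)"
        by (intro summable_suminf_not_top) auto
      then have "Bseq (\<lambda>n. 2 ^ n * (cmod (d n x))\<^sup>2)" by (rule summable_imp_Bseq)
      then obtain B where "\<forall>n. norm (2 ^ n * (cmod (d n x))\<^sup>2) \<le> B"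
        by (rule BseqE) (rule that)
      then have B: "norm (2 ^ n * (cmod (d n x))\<^sup>2) \<le> B" for n by (rule spec)
      have d_le: "cmod (d n x) \<le> sqrt B * (1 / sqrt 2) ^ n" for n
      proof -
        have "(cmod (d n x))\<^sup>2 \<le> B * (1/2) ^ n" using B[of n] by (simp add: field_simps power_one_over)
        then have "sqrt ((cmod (d n x))\<^sup>2) \<le> sqrt (B * (1/2) ^ n)" by (rule real_sqrt_le_mono)
        then show ?thesis by (simp add: real_sqrt_mult real_sqrt_power real_sqrt_divide)
      qed
      have "summable (\<lambda>n. sqrt B * (1 / sqrt 2) ^ n)"
        by (intro summable_mult summable_geometric) simp
      then have "summable (\<lambda>n. d n x)"
        by (rule summable_comparison_test'[where N=0]) (rule d_le)
      then have "(\<lambda>n. f (r 0) x + (\<Sum>i<n. d i x)) \<longlonglongrightarrow> f (r 0) x + suminf (\<lambda>i. d i x)"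
        by (intro tendsto_intros summable_LIMSEQ)
      moreover have "f (r 0) x + (\<Sum>i<n. d i x) = f (r n) x" for n
        unfolding d_def by (subst sum_lessThan_telescope) simp
      ultimately show "(\<lambda>n. f (r n) x) \<longlonglongrightarrow> u x"
        unfolding u_def by (simp add: limI)
    qed
  qed
  have Fatou: "(\<integral>\<^sup>+x. ennreal ((cmod (f j x - u x))\<^sup>2) \<partial>M) \<le> ennreal ((((1/2) ^ m)\<^sup>2))" if j: "j \<ge> N m" for j m
  proof -
    have "(\<integral>\<^sup>+x. ennreal ((cmod (f j x - u x))\<^sup>2) \<partial>M) = (\<integral>\<^sup>+x. liminf (\<lambda>n. ennreal ((cmod (f j x - f (r n) x))\<^sup>2)) \<partial>M)"
    proof (rule nn_integral_cong_AE, rule AE_mp[OF conv], intro AE_I2 impI)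
      fix x assume "(\<lambda>n. f (r n) x) \<longlonglongrightarrow> u x"
      then have "(\<lambda>n. ennreal ((cmod (f j x - f (r n) x))\<^sup>2)) \<longlonglongrightarrow> ennreal ((cmod (f j x - u x))\<^sup>2)"
        by (intro tendsto_intros)
      then show "ennreal ((cmod (f j x - u x))\<^sup>2) = liminf (\<lambda>n. ennreal ((cmod (f j x - f (r n) x))\<^sup>2))"
        by (rule lim_imp_Liminf[OF sequentially_bot, symmetric])
    qed
    also have "\<dots> \<le> liminf (\<lambda>n. \<integral>\<^sup>+x. ennreal ((cmod (f j x - f (r n) x))\<^sup>2) \<partial>M)"
      by (rule nn_integral_liminf) measurable
    also have "\<dots> \<le> limsup (\<lambda>n. \<integral>\<^sup>+x. ennreal ((cmod (f j x - f (r n) x))\<^sup>2) \<partial>M)"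
      by (rule Liminf_le_Limsup) simp
    also have "\<dots> \<le> ennreal ((((1/2) ^ m)\<^sup>2))"
    proof (rule Limsup_bounded, unfold eventually_sequentially, intro exI allI impI)
      fix n assume "n \<ge> m"
      then have "r m \<le> r n" using r_mono lift_Suc_mono_le by blast
      then have "N m \<le> r n" using rN order_trans by blast
      then show "(\<integral>\<^sup>+x. ennreal ((cmod (f j x - f (r n) x))\<^sup>2) \<partial>M) \<le> ennreal (((1/2) ^ m)\<^sup>2)"
        unfolding nn by (intro ennreal_leI power_mono less_imp_le[OF N[OF j]]) auto
    qed
    finally show ?thesis .
  qed
  have int: "integrable M (\<lambda>x. (cmod (f j x - u x))\<^sup>2)" if "j \<ge> N m" for j m
    using Fatou[OF that] by (intro integrableI_nonneg) (auto simp: less_top[symmetric] top_unique)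
  have "(\<lambda>x. f (N 0) x - u x) \<in> L2 M" using int[of 0 "N 0"] by (simp add: L2_def)
  from L2_diff[OF f[of "N 0"] this] have u: "u \<in> L2 M" by simp
  have le: "l2_dist M (f j) u \<le> (1/2) ^ m" if j: "j \<ge> N m" for j m
  proof (rule power2_le_imp_le)
    have "ennreal ((l2_dist M (f j) u)\<^sup>2) = (\<integral>\<^sup>+x. ennreal ((cmod (f j x - u x))\<^sup>2) \<partial>M)"
      unfolding l2_norm_sq using int[OF j] by (intro nn_integral_eq_integral[symmetric]) auto
    also have "\<dots> \<le> ennreal (((1/2) ^ m)\<^sup>2)" by (rule Fatou[OF j])
    finally show "(l2_dist M (f j) u)\<^sup>2 \<le> ((1/2) ^ m)\<^sup>2" by simp
  qed simp
  have "(\<lambda>k. l2_dist M (f k) u) \<longlonglongrightarrow> 0"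
  proof (rule LIMSEQ_I)
    fix e :: real assume "e > 0"
    then obtain m where "(1/2) ^ m < e" using real_arch_pow_inv[of e "1/2"] by auto
    then show "\<exists>no. \<forall>n\<ge>no. norm (l2_dist M (f n) u - 0) < e"
      using le[of m] by (intro exI[of _ "N m"]) (auto intro: le_less_trans)
  qed
  with u show ?thesis by blast
qed

text \<open>A minimizing sequence for the distance from \<open>u0\<close> to the subspace is a Cauchy sequence by the
  parallelogram law, and the difference of \<open>u0\<close> and its limit is orthogonal to the subspace because the distance
  cannot decrease in any direction. The limit is given together with the sequence, as the points of the completion
  of the space of measures are given by sequences.\<close>

lemma L2_projection:
  assumes S: "S \<subseteq> L2 M" "S \<noteq> {}" and add: "\<And>f g. f \<in> S \<Longrightarrow> g \<in> S \<Longrightarrow> (\<lambda>x. f x + g x) \<in> S"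
    and scale: "\<And>c f. f \<in> S \<Longrightarrow> (\<lambda>x. c * f x) \<in> S" and u0: "u0 \<in> L2 M"
  shows "\<exists>s u. (\<forall>k::nat. s k \<in> S) \<and> u \<in> L2 M \<and> (\<lambda>k. l2_dist M (s k) u) \<longlonglongrightarrow> 0 \<and>
    (\<forall>f\<in>S. l2_inner M (\<lambda>x. u0 x - u x) f = 0)"
proof -
  let ?D = "\<lambda>f. (l2_dist M u0 f)\<^sup>2"
  define d where "d = (INF f\<in>S. ?D f)"
  have bdd: "bdd_below (?D ` S)" by (intro bdd_belowI[of _ 0]) auto
  have d_le: "d \<le> ?D f" if "f \<in> S" for f unfolding d_def by (rule cINF_lower[OF bdd that])
  have "\<exists>f\<in>S. ?D f < d + e" if "e > 0" for e
    using cInf_lessD[of "?D ` S" "d + e"] S(2) that by (auto simp: d_def)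
  then have "\<forall>k. \<exists>f\<in>S. ?D f < d + 1 / real (Suc k)" by simp
  then obtain s where s: "\<And>k. s k \<in> S" "\<And>k. ?D (s k) < d + 1 / real (Suc k)" by metis
  have SL: "f \<in> L2 M" if "f \<in> S" for f using S that by auto
  have par: "(l2_dist M f g)\<^sup>2 = 2 * ?D f + 2 * ?D g - 4 * ?D (\<lambda>x. (1/2) * (f x + g x))"
    if "f \<in> S" "g \<in> S" for f g
  proof -
    let ?a = "\<lambda>x. u0 x - f x" and ?b = "\<lambda>x. u0 x - g x"
    have L: "?a \<in> L2 M" "?b \<in> L2 M" using that u0 SL by (auto intro: L2_diff)
    have "l2_dist M f g = l2_norm M (\<lambda>x. ?b x + (- 1) * ?a x)"
      by (simp)
    then have 1: "(l2_dist M f g)\<^sup>2 = (l2_norm M ?b)\<^sup>2 - 2 * Re (l2_inner M ?b ?a) + (l2_norm M ?a)\<^sup>2"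
      using l2_norm_add_sq[OF L(2) L2_scale[OF L(1), of "-1"]] l2_norm_scale[of M "-1" ?a]
        l2_inner_scale_right[of M ?b "-1" ?a] by simp
    have "(\<lambda>x. ?b x + ?a x) = (\<lambda>x. 2 * (u0 x - (1/2) * (f x + g x)))" by (auto simp: algebra_simps)
    then have "(l2_norm M (\<lambda>x. ?b x + ?a x))\<^sup>2 = 4 * ?D (\<lambda>x. (1/2) * (f x + g x))"
      using l2_norm_scale[of M 2 "\<lambda>x. u0 x - (1/2) * (f x + g x)"] by (simp add: power_mult_distrib)
    then have "4 * ?D (\<lambda>x. (1/2) * (f x + g x)) = (l2_norm M ?b)\<^sup>2 + 2 * Re (l2_inner M ?b ?a) + (l2_norm M ?a)\<^sup>2"
      using l2_norm_add_sq[OF L(2) L(1)] by simp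
    with 1 show ?thesis by simp
  qed
  have Cauchy: "\<exists>N. \<forall>j\<ge>N. \<forall>k\<ge>N. l2_dist M (s j) (s k) < e" if e: "e > 0" for e
  proof -
    obtain N where N: "1 / real (Suc N) < e\<^sup>2 / 4"
      using e nat_approx_posE[of "e\<^sup>2 / 4"] by auto
    have "l2_dist M (s j) (s k) < e" if "j \<ge> N" "k \<ge> N" for j k
    proof (rule power2_less_imp_less)
      have "1 / real (Suc j) \<le> 1 / real (Suc N)" "1 / real (Suc k) \<le> 1 / real (Suc N)"
        using that by (auto simp: field_simps)
      moreover have "d \<le> ?D (\<lambda>x. (1/2) * (s j x + s k x))"
        by (intro d_le scale add s)
      ultimately show "(l2_dist M (s j) (s k))\<^sup>2 < e\<^sup>2"
        using par[OF s(1)[of j] s(1)[of k]] s(2)[of j] s(2)[of k] N by linarith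
    qed (use e in simp)
    then show ?thesis by blast
  qed
  obtain u where u: "u \<in> L2 M" "(\<lambda>k. l2_dist M (s k) u) \<longlonglongrightarrow> 0"
    using L2_complete[OF SL[OF s(1)] Cauchy] by blast
  let ?w = "\<lambda>x. u0 x - u x"
  have w: "?w \<in> L2 M" using u0 u(1) by (rule L2_diff)
  have w_le: "(l2_norm M ?w)\<^sup>2 \<le> d"
  proof -
    have "(\<lambda>k. l2_inner M (\<lambda>x. u0 x - s k x) (\<lambda>x. u0 x - s k x)) \<longlonglongrightarrow> l2_inner M ?w ?w"
      using u(2) by (intro l2_inner_tendsto L2_diff u0 SL[OF s(1)] u(1)) (simp_all add: l2_norm_minus_commute)
    then have "(\<lambda>k. Re (l2_inner M (\<lambda>x. u0 x - s k x) (\<lambda>x. u0 x - s k x))) \<longlonglongrightarrow> Re (l2_inner M ?w ?w)"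
      by (rule tendsto_Re)
    then have *: "(\<lambda>k. ?D (s k)) \<longlonglongrightarrow> (l2_norm M ?w)\<^sup>2" by (simp add: l2_inner_self)
    have "(\<lambda>k. d + 1 / real (Suc k)) \<longlonglongrightarrow> d + 0"
      by (intro tendsto_add tendsto_const LIMSEQ_Suc[OF lim_1_over_n])
    with * have "(l2_norm M ?w)\<^sup>2 \<le> d + 0"
      by (rule LIMSEQ_le) (use s(2) in \<open>auto intro: less_imp_le\<close>)
    then show ?thesis by simp
  qed
  have low: "d \<le> (l2_norm M (\<lambda>x. ?w x + f x))\<^sup>2" if f: "f \<in> S" for f
  proof -
    let ?g = "\<lambda>k x. u0 x - (s k x + (-1) * f x)" and ?h = "\<lambda>x. u0 x - u x + f x"
    have "(\<lambda>k. l2_inner M (?g k) (?g k)) \<longlonglongrightarrow> l2_inner M ?h ?h"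
      using u(2) by (intro l2_inner_tendsto L2_diff L2_add L2_scale u0 SL[OF s(1)] SL[OF f] u(1)) (simp_all add: l2_norm_minus_commute)
    then have "(\<lambda>k. Re (l2_inner M (?g k) (?g k))) \<longlonglongrightarrow> Re (l2_inner M ?h ?h)"
      by (rule tendsto_Re)
    then have *: "(\<lambda>k. ?D (\<lambda>x. s k x + (-1) * f x)) \<longlonglongrightarrow> (l2_norm M ?h)\<^sup>2" by (simp add: l2_inner_self)
    have "d \<le> ?D (\<lambda>x. s k x + (-1) * f x)" for k by (intro d_le add scale s f)
    with * show ?thesis by (intro LIMSEQ_le_const) auto
  qed
  have "l2_inner M ?w f = 0" if f: "f \<in> S" for f
  proof -
    define z where "z = l2_inner M ?w f"
    have "0 \<le> t * (t * ((cmod z)\<^sup>2 * (l2_norm M f)\<^sup>2) - 2 * (cmod z)\<^sup>2)" for t :: real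
    proof -
      let ?c = "cor (- t) * z"
      have "d \<le> (l2_norm M (\<lambda>x. ?w x + ?c * f x))\<^sup>2" by (intro low scale f)
      also have "\<dots> = (l2_norm M ?w)\<^sup>2 + 2 * Re (cnj ?c * z) + (cmod ?c * l2_norm M f)\<^sup>2"
        by (simp only: l2_norm_add_sq[OF w L2_scale[OF SL[OF f]]] l2_inner_scale_right l2_norm_scale z_def)
      also have "cnj ?c * z = cor (- t * (cmod z)\<^sup>2)"
        by (simp add: complex_norm_square mult_ac del: of_real_power)
      finally show ?thesis using w_le
        by (simp add: norm_mult power_mult_distrib algebra_simps power2_eq_square)
    qed
    note * = this
    have "cmod z = 0"
    proof (rule ccontr)
      assume "cmod z \<noteq> 0"
      then have pos: "(cmod z)\<^sup>2 > 0" by simp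
      \<comment> \<open>Any \<open>t > 0\<close> with \<open>t * (l2_norm M f)\<^sup>2 < 2\<close> gives a contradiction; this one also works for norm 0.\<close>
      define t where "t = 1 / (1 + (l2_norm M f)\<^sup>2)"
      have t: "t > 0" unfolding t_def by (intro divide_pos_pos add_pos_nonneg) auto
      have "t * (l2_norm M f)\<^sup>2 < 1" unfolding t_def by (simp add: divide_less_eq add_pos_nonneg)
      then have "(t * (l2_norm M f)\<^sup>2) * (cmod z)\<^sup>2 < 2 * (cmod z)\<^sup>2" using pos by (intro mult_strict_right_mono) auto
      then have "t * (t * ((cmod z)\<^sup>2 * (l2_norm M f)\<^sup>2) - 2 * (cmod z)\<^sup>2) < 0"
        using t by (intro mult_pos_neg) (auto simp: mult_ac)
      with *[of t] show False by simp
    qed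
    then show ?thesis by (simp add: z_def)
  qed
  with s(1) u show ?thesis by blast
qed

section \<open>The Fourier transform of the exponential kernel\<close>

text \<open>A rescaling of the characteristic function of the standard normal distribution.\<close>

lemma gaussian_real_fourier:
  fixes v t :: real
  assumes v: "v > 0"
  shows "has_bochner_integral lborel (\<lambda>x. cor (exp (- v * x\<^sup>2)) * exp (\<i> * cor (t * x)))
    (cor (sqrt (pi / v) * exp (- t\<^sup>2 / (4 * v))))"
proof -
  let ?g = "\<lambda>x. cor (exp (- v * x\<^sup>2)) * exp (\<i> * cor (t * x))"
  define c where "c = sqrt (2 * v)"
  have c: "c > 0" "c\<^sup>2 = 2 * v" using v by (auto simp: c_def)
  define f where "f x = std_normal_density x *\<^sub>R exp (\<i> * cor (t / c * x))" for x
  have int_f: "integrable lborel f"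
    unfolding f_def
    by (rule Bochner_Integration.integrable_bound[OF integrable_normal_density[of 1 0]])
      (auto simp: normal_density_nonneg)
  have "(LINT x|lborel. f x) = char std_normal_distribution (t / c)"
    unfolding f_def char_def by (subst integral_density) (auto simp: normal_density_nonneg)
  also have "\<dots> = cor (exp (- (t / c)\<^sup>2 / 2))"
    by (simp add: char_std_normal_distribution)
  finally have "has_bochner_integral lborel f (cor (exp (- t\<^sup>2 / (4 * v))))"
    using int_f c v by (simp add: has_bochner_integral_iff power_divide)
  then have "has_bochner_integral lborel (\<lambda>x. f (0 + c * x)) (cor (exp (- t\<^sup>2 / (4 * v))) /\<^sub>R \<bar>c\<bar>)"
    using c by (subst (asm) lborel_has_bochner_integral_real_affine_iff[of c _ _ 0]) auto
  then have "has_bochner_integral lborel (\<lambda>x. cor (sqrt (2 * pi)) * f (0 + c * x))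
      (cor (sqrt (2 * pi)) * (cor (exp (- t\<^sup>2 / (4 * v))) /\<^sub>R \<bar>c\<bar>))"
    by (rule has_bochner_integral_mult_right)
  moreover have "cor (sqrt (2 * pi)) * f (0 + c * x) = ?g x" for x
    using c v by (simp add: f_def std_normal_density_def power_mult_distrib scaleR_conv_of_real mult_ac)
  moreover have "cor (sqrt (2 * pi)) * (cor (exp (- t\<^sup>2 / (4 * v))) /\<^sub>R \<bar>c\<bar>)
      = cor (sqrt (pi / v) * exp (- t\<^sup>2 / (4 * v)))"
  proof -
    have "sqrt (2 * pi) / c = sqrt (pi / v)"
      unfolding c_def by (simp add: real_sqrt_divide real_sqrt_mult)
    then have "sqrt (2 * pi) * inverse \<bar>c\<bar> = sqrt (pi / v)"
      by (simp only: divide_inverse abs_of_pos[OF c(1)])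
    then have "sqrt (2 * pi) * (inverse \<bar>c\<bar> * exp (- t\<^sup>2 / (4 * v))) = sqrt (pi / v) * exp (- t\<^sup>2 / (4 * v))"
      by (simp only: mult.assoc[symmetric])
    then show ?thesis
      unfolding scaleR_conv_of_real of_real_mult[symmetric] by (rule arg_cong)
  qed
  ultimately show ?thesis by simp
qed

text \<open>Lebesgue measure is the image of the product of the one-dimensional measures along the basis.\<close>

lemma lborel_has_integral_prod:
  fixes f :: "'a::euclidean_space \<Rightarrow> real \<Rightarrow> complex"
  assumes f: "\<And>b. b \<in> Basis \<Longrightarrow> has_bochner_integral lborel (f b) (I b)"
  shows "has_bochner_integral lborel (\<lambda>x. \<Prod>b\<in>Basis. f b (x \<bullet> b)) (\<Prod>b\<in>Basis. I b)"
proof -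
  let ?P = "\<Pi>\<^sub>M b\<in>Basis. (lborel :: real measure)" and ?T = "\<lambda>g. \<Sum>b\<in>Basis. g b *\<^sub>R b :: 'a"
  interpret product_sigma_finite "\<lambda>_::'a. lborel :: real measure" by standard
  have T: "?T \<in> measurable ?P borel" by measurable
  have f': "integrable lborel (f b)" "integral\<^sup>L lborel (f b) = I b" "f b \<in> borel_measurable borel"
    if "b \<in> Basis" for b
    using f[OF that] by (auto simp: has_bochner_integral_iff dest: borel_measurable_integrable)
  have m: "(\<lambda>x. \<Prod>b\<in>Basis. f b (x \<bullet> b)) \<in> borel_measurable borel"
  proof (rule borel_measurable_prod)
    fix b :: 'a assume "b \<in> Basis"
    show "(\<lambda>x. f b (x \<bullet> b)) \<in> borel_measurable borel"
      by (rule measurable_compose[OF _ f'(3)[OF \<open>b \<in> Basis\<close>]]) measurable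
  qed
  have eq: "(\<Prod>b\<in>Basis. f b (?T g \<bullet> b)) = (\<Prod>b\<in>Basis. f b (g b))" for g
    by (intro prod.cong) auto
  have "integrable ?P (\<lambda>g. \<Prod>b\<in>Basis. f b (g b))"
    by (intro product_integrable_prod f'(1)) auto
  then have 1: "integrable lborel (\<lambda>x. \<Prod>b\<in>Basis. f b (x \<bullet> b))"
    by (subst lborel_eq, subst integrable_distr_eq[OF T m]) (simp add: eq del: inner_sum_left_Basis)
  have "(LINT x|lborel. (\<Prod>b\<in>Basis. f b (x \<bullet> b))) = (\<integral>g. (\<Prod>b\<in>Basis. f b (g b)) \<partial>?P)"
    by (subst lborel_eq, subst integral_distr[OF T m]) (simp add: eq del: inner_sum_left_Basis)
  also have "\<dots> = (\<Prod>b\<in>Basis. I b)"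
    by (subst product_integral_prod) (auto simp: f')
  finally show ?thesis using 1 by (simp add: has_bochner_integral_iff)
qed

lemma norm_sq_Basis: "(norm (x::'a::euclidean_space))\<^sup>2 = (\<Sum>b\<in>Basis. (x \<bullet> b)\<^sup>2)"
  unfolding power2_norm_eq_inner by (subst euclidean_inner) (simp add: power2_eq_square)

lemma gaussian_fourier:
  fixes v :: real and a :: "'a::euclidean_space"
  assumes v: "v > 0"
  shows "has_bochner_integral lborel (\<lambda>x. cor (exp (- v * (norm x)\<^sup>2)) * exp (\<i> * cor (a \<bullet> x)))
    (cor (sqrt (pi / v) ^ DIM('a) * exp (- (norm a)\<^sup>2 / (4 * v))))"
proof -
  have *: "has_bochner_integral lborel
      (\<lambda>x::'a. \<Prod>b\<in>Basis. cor (exp (- v * (x \<bullet> b)\<^sup>2)) * exp (\<i> * cor ((a \<bullet> b) * (x \<bullet> b))))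
      (\<Prod>b\<in>Basis. cor (sqrt (pi / v) * exp (- (a \<bullet> b)\<^sup>2 / (4 * v))))"
    by (rule lborel_has_integral_prod, rule gaussian_real_fourier[OF v])
  have 1: "(\<Prod>b\<in>Basis. cor (exp (- v * (x \<bullet> b)\<^sup>2)) * exp (\<i> * cor ((a \<bullet> b) * (x \<bullet> b))))
      = cor (exp (- v * (norm x)\<^sup>2)) * exp (\<i> * cor (a \<bullet> x))" for x :: 'a
  proof -
    have "exp (- v * (norm x)\<^sup>2) = (\<Prod>b\<in>Basis. exp (- v * (x \<bullet> b)\<^sup>2))"
      by (subst exp_sum[symmetric]) (auto simp: norm_sq_Basis sum_distrib_left)
    moreover have "exp (\<i> * cor (a \<bullet> x)) = (\<Prod>b\<in>Basis. exp (\<i> * cor ((a \<bullet> b) * (x \<bullet> b))))"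
      by (subst exp_sum[symmetric]) (auto simp: euclidean_inner[of a x] sum_distrib_left)
    ultimately show ?thesis by (simp add: prod.distrib)
  qed
  have 2: "(\<Prod>b\<in>Basis. cor (sqrt (pi / v) * exp (- (a \<bullet> b)\<^sup>2 / (4 * v))))
      = cor (sqrt (pi / v) ^ DIM('a) * exp (- (norm a)\<^sup>2 / (4 * v)))"
  proof -
    have "exp (- (norm a)\<^sup>2 / (4 * v)) = (\<Prod>b\<in>Basis. exp (- (a \<bullet> b)\<^sup>2 / (4 * v)))"
      by (subst exp_sum[symmetric]) (auto simp: norm_sq_Basis sum_negf sum_divide_distrib)
    then show ?thesis by (simp add: prod.distrib)
  qed
  show ?thesis using * unfolding 1 2 .
qed

text \<open>The error function, up to a factor. It is odd because its derivative is even, so the limit at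
  \<open>- \<infinity>\<close> follows from the one at \<open>\<infinity>\<close>.\<close>

lemma gaussian_antiderivative:
  "\<exists>G::real \<Rightarrow> real. (\<forall>x. (G has_real_derivative exp (- x\<^sup>2)) (at x)) \<and> G 0 = 0 \<and>
    (G \<longlongrightarrow> sqrt pi / 2) at_top \<and> (G \<longlongrightarrow> - (sqrt pi / 2)) at_bot"
proof -
  let ?f = "\<lambda>x::real. exp (- x\<^sup>2)"
  obtain F where F: "\<And>x. (F has_vector_derivative ?f x) (at x)"
    using einterval_antiderivative[of "-\<infinity>" \<infinity> ?f] by (auto intro!: continuous_intros)
  define G where "G x = F x - F 0" for x
  have dG: "(G has_real_derivative ?f x) (at x)" for x
    unfolding G_def using F[of x]
    by (auto simp: has_real_derivative_iff_has_vector_derivative intro!: derivative_eq_intros)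
  have odd: "G (- x) = - G x" for x
  proof -
    have "((\<lambda>x. G (- x) + G x) has_real_derivative 0) (at x)" for x
      by (rule derivative_eq_intros DERIV_chain2[OF dG] dG refl)+ simp
    then have "G (- x) + G x = G (- 0) + G 0" by (rule DERIV_isconst_all[rule_format, of "\<lambda>x. G (- x) + G x"])
    then show ?thesis by (simp add: G_def)
  qed
  have top: "(G \<longlongrightarrow> sqrt pi / 2) at_top"
  proof -
    let ?h = "\<lambda>x. indicator {0..} x *\<^sub>R ?f x"
    have "((\<lambda>y. LINT x|lborel. indicator {..y} x *\<^sub>R ?h x) \<longlongrightarrow> integral\<^sup>L lborel ?h) at_top"
      using gaussian_moment_0 by (intro tendsto_integral_at_top) (auto simp: has_bochner_integral_iff)
    then have *: "((\<lambda>y. LINT x|lborel. indicator {..y} x *\<^sub>R ?h x) \<longlongrightarrow> sqrt pi / 2) at_top"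
      unfolding has_bochner_integral_integral_eq[OF gaussian_moment_0] .
    have "(LINT x|lborel. indicator {..y} x *\<^sub>R ?h x) = G y" if "0 \<le> y" for y
    proof -
      have "(LINT x|lborel. indicator {0..y} x *\<^sub>R ?f x) = F y - F 0"
        using that by (intro integral_FTC_atLeastAtMost has_vector_derivative_at_within[OF F] continuous_intros)
      moreover have "indicator {..y} x *\<^sub>R ?h x = indicator {0..y} x *\<^sub>R ?f x" for x
        by (auto split: split_indicator)
      ultimately show ?thesis by (simp only: G_def)
    qed
    then have "eventually (\<lambda>y. (LINT x|lborel. indicator {..y} x *\<^sub>R ?h x) = G y) at_top"
      by (auto simp: eventually_at_top_linorder)
    with * show ?thesis by (rule Lim_transform_eventually)
  qed
  have "((\<lambda>x. - G x) \<longlongrightarrow> - (sqrt pi / 2)) at_top" by (intro tendsto_intros top)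
  then have bot: "(G \<longlongrightarrow> - (sqrt pi / 2)) at_bot"
    by (subst filterlim_at_bot_mirror) (simp add: odd)
  show ?thesis using dG top bot by (intro exI[of _ G]) (auto simp: G_def)
qed

text \<open>With \<open>G\<close> the antiderivative of \<open>exp (- x\<^sup>2)\<close>, the integrand has the antiderivative
  \<open>(exp (- 2 t) G (x - t / x) + exp (2 t) G (x + t / x)) / 2\<close>: completing the square turns both derivatives of \<open>G\<close>
  into the integrand, and the factors \<open>1 \<plusminus> t / x\<^sup>2\<close> from the chain rule add up to 2. For \<open>t = 0\<close> the limit at 0 has to be
  taken separately.\<close>

lemma subordination_integral:
  fixes t :: real
  assumes t: "t \<ge> 0"
  shows "has_bochner_integral lborel (\<lambda>x. indicator {0<..} x *\<^sub>R exp (- (x\<^sup>2 + t\<^sup>2 / x\<^sup>2))) (sqrt pi / 2 * exp (- 2 * t))"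
proof -
  obtain G :: "real \<Rightarrow> real" where dG: "\<And>x. (G has_real_derivative exp (- x\<^sup>2)) (at x)" and G0: "G 0 = 0"
    and Gtop: "(G \<longlongrightarrow> sqrt pi / 2) at_top" and Gbot: "(G \<longlongrightarrow> - (sqrt pi / 2)) at_bot"
    using gaussian_antiderivative by auto
  let ?f = "\<lambda>x. exp (- (x\<^sup>2 + t\<^sup>2 / x\<^sup>2))"
  define F where "F x = (exp (- 2 * t) * G (x - t / x) + exp (2 * t) * G (x + t / x)) / 2" for x
  define L where "L = (if t = 0 then 0 else (exp (- 2 * t) * - (sqrt pi / 2) + exp (2 * t) * (sqrt pi / 2)) / 2)"
  have F: "(F has_real_derivative ?f x) (at x)" if x: "x > 0" for x
  proof -
    have 1: "exp (- 2 * t) * exp (- (x - t / x)\<^sup>2) = ?f x" "exp (2 * t) * exp (- (x + t / x)\<^sup>2) = ?f x"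
      using x by (auto simp: power2_eq_square field_simps simp flip: exp_add)
    have "(F has_real_derivative (exp (- 2 * t) * (exp (- (x - t / x)\<^sup>2) * (1 + t / x\<^sup>2)) +
        exp (2 * t) * (exp (- (x + t / x)\<^sup>2) * (1 - t / x\<^sup>2))) / 2) (at x)"
      unfolding F_def using x
      by (auto intro!: derivative_eq_intros DERIV_chain2[OF dG] simp: power2_eq_square)
    also have "(exp (- 2 * t) * (exp (- (x - t / x)\<^sup>2) * (1 + t / x\<^sup>2)) +
        exp (2 * t) * (exp (- (x + t / x)\<^sup>2) * (1 - t / x\<^sup>2))) / 2 = ?f x"
      unfolding mult.assoc[symmetric] 1 by (simp add: algebra_simps)
    finally show ?thesis .
  qed
  have lim_top: "(F \<longlongrightarrow> (exp (- 2 * t) * (sqrt pi / 2) + exp (2 * t) * (sqrt pi / 2)) / 2) at_top"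
  proof -
    have "filterlim (\<lambda>x. x - t / x) at_top at_top" "filterlim (\<lambda>x. x + t / x) at_top at_top"
      by real_asymp+
    then show ?thesis unfolding F_def
      by (intro tendsto_intros filterlim_compose[OF Gtop]) auto
  qed
  have lim_0: "(F \<longlongrightarrow> L) (at_right 0)"
  proof (cases "t = 0")
    case True
    have "isCont G 0" using dG[of 0] by (rule DERIV_isCont)
    then have "(G \<longlongrightarrow> 0) (at 0)" by (simp add: isCont_def G0)
    then have "(G \<longlongrightarrow> 0) (at_right 0)" by (rule tendsto_within_subset) auto
    then show ?thesis using True by (simp add: F_def[abs_def] L_def)
  next
    case False
    then have "t > 0" using t by simp
    then have "filterlim (\<lambda>x. x - t / x) at_bot (at_right 0)" "filterlim (\<lambda>x. x + t / x) at_top (at_right 0)"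
      by real_asymp+
    then have "((\<lambda>x. G (x - t / x)) \<longlongrightarrow> - (sqrt pi / 2)) (at_right 0)"
      "((\<lambda>x. G (x + t / x)) \<longlongrightarrow> sqrt pi / 2) (at_right 0)"
      using filterlim_compose[OF Gbot] filterlim_compose[OF Gtop] by blast+
    then have "(F \<longlongrightarrow> (exp (- 2 * t) * - (sqrt pi / 2) + exp (2 * t) * (sqrt pi / 2)) / 2) (at_right 0)"
      unfolding F_def[abs_def] by (intro tendsto_intros) auto
    then show ?thesis using False by (simp only: L_def if_False)
  qed
  have A: "((F \<circ> real_of_ereal) \<longlongrightarrow> L) (at_right (0::ereal))"
    using lim_0 by (simp add: ereal_tendsto_simps zero_ereal_def)
  have B: "((F \<circ> real_of_ereal) \<longlongrightarrow> (exp (- 2 * t) * (sqrt pi / 2) + exp (2 * t) * (sqrt pi / 2)) / 2) (at_left \<infinity>)"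
    using lim_top by (simp add: ereal_tendsto_simps)
  have e: "einterval 0 \<infinity> = {0<..}" by (auto simp: einterval_def)
  have C: "isCont ?f x" if "x > 0" for x
    using that by (intro continuous_intros) auto
  have 1: "set_integrable lborel (einterval 0 \<infinity>) ?f"
    by (rule interval_integral_FTC_nonneg(1)[OF _ _ _ _ A B]) (use F C in auto)
  have 2: "(LBINT x=0..\<infinity>. ?f x) = (exp (- 2 * t) * (sqrt pi / 2) + exp (2 * t) * (sqrt pi / 2)) / 2 - L"
    by (rule interval_integral_FTC_nonneg(2)[OF _ _ _ _ A B]) (use F C in auto)
  have "(exp (- 2 * t) * (sqrt pi / 2) + exp (2 * t) * (sqrt pi / 2)) / 2 - L = sqrt pi / 2 * exp (- 2 * t)"
    by (auto simp: L_def field_simps)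
  with 1 2 show ?thesis
    by (simp add: has_bochner_integral_iff set_integrable_def e interval_lebesgue_integral_def set_lebesgue_integral_def)
qed


text \<open>The value of the integral of \<open>v ^ n * exp (- v\<^sup>2)\<close> over the positive half line, that is, half of
  \<open>Gamma ((n + 1) / 2)\<close>, written out by the parity of \<open>n\<close>, as is usual for ball volumes.\<close>

definition half_moment :: "nat \<Rightarrow> real" where
  "half_moment n = (if even n then sqrt pi / 2 * (fact n / (2 ^ n * fact (n div 2))) else fact (n div 2) / 2)"

lemma half_moment_pos: "0 < half_moment n"
  by (simp add: half_moment_def)

lemma half_moment_has_integral:
  "has_bochner_integral lborel (\<lambda>v::real. indicator {0<..} v *\<^sub>R (v ^ n * exp (- v\<^sup>2))) (half_moment n)"
proof -
  have "has_bochner_integral lborel (\<lambda>v::real. indicator {0..} v *\<^sub>R (v ^ n * exp (- v\<^sup>2))) (half_moment n)"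
  proof (cases "even n")
    case True
    then obtain k where "n = 2 * k" by (elim evenE)
    then show ?thesis using gaussian_moment_even_pos[of k] by (simp add: half_moment_def mult.commute)
  next
    case False
    then obtain k where "n = 2 * k + 1" by (elim oddE)
    then show ?thesis using gaussian_moment_odd_pos[of k] by (simp add: half_moment_def mult.commute)
  qed
  then show ?thesis
    by (rule has_bochner_integral_discrete_difference[where X="{0}", THEN iffD1, rotated 4])
      (auto split: split_indicator)
qed

lemma scaled_half_moment:
  assumes r: "r > 0"
  shows "has_bochner_integral lborel (\<lambda>v::real. indicator {0<..} v *\<^sub>R (v ^ n * exp (- r * v\<^sup>2)))
    (half_moment n * r powr (- ((real n + 1) / 2)))"
proof -
  define c where "c = sqrt r"
  have c: "c > 0" "c\<^sup>2 = r" using r by (auto simp: c_def)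
  let ?f = "\<lambda>v::real. indicator {0<..} v *\<^sub>R (v ^ n * exp (- v\<^sup>2))"
  have "has_bochner_integral lborel (\<lambda>x. ?f (0 + c * x)) (half_moment n /\<^sub>R \<bar>c\<bar>)"
    using half_moment_has_integral[of n] c
    by (subst (asm) lborel_has_bochner_integral_real_affine_iff[of c _ _ 0]) auto
  then have "has_bochner_integral lborel (\<lambda>x. inverse (c ^ n) * ?f (0 + c * x)) (inverse (c ^ n) * (half_moment n /\<^sub>R \<bar>c\<bar>))"
    by (rule has_bochner_integral_mult_right)
  moreover have "inverse (c ^ n) * ?f (0 + c * x) = indicator {0<..} x *\<^sub>R (x ^ n * exp (- r * x\<^sup>2))" for x
    using c by (auto simp: power_mult_distrib zero_less_mult_iff split: split_indicator)
  moreover have "inverse (c ^ n) * (half_moment n /\<^sub>R \<bar>c\<bar>) = half_moment n * r powr (- ((real n + 1) / 2))"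
  proof -
    have "r powr ((real n + 1) / 2) = (r powr (1/2)) ^ (n + 1)"
      by (subst powr_power) (use r in \<open>auto simp: field_simps\<close>)
    also have "\<dots> = c ^ (n + 1)" using r by (simp add: powr_half_sqrt c_def)
    finally show ?thesis using c by (simp add: powr_minus)
  qed
  ultimately show ?thesis by (simp only:)
qed

text \<open>The weight of the Bessel potential space of order \<open>- (n + 1) / 2\<close>.\<close>

definition bessel_weight :: "'a::euclidean_space \<Rightarrow> real" where
  "bessel_weight x = (1 + (norm x)\<^sup>2) powr (- ((real DIM('a) + 1) / 2))"

lemma one_plus_sq_pos: "0 < 1 + (norm x)\<^sup>2"
  by (rule add_pos_nonneg) auto

text \<open>By \<open>scaled_half_moment\<close> the weight is a superposition of the Gaussians
  \<open>exp (- v\<^sup>2 (norm \<xi>)\<^sup>2)\<close> with density \<open>v ^ n * exp (- v\<^sup>2)\<close>. Exchanging the integrals, the Fourier transform of the Gaussian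
  cancels \<open>v ^ n\<close> and leaves the subordination integral at \<open>t = norm a / 2\<close>. Integrability on the product space follows from the
  same computation at \<open>a = 0\<close>, where the integrand is its own absolute value.\<close>

lemma bessel_weight_fourier_half_moment:
  fixes a :: "'a::euclidean_space"
  shows "has_bochner_integral lborel (\<lambda>\<xi>. cor (bessel_weight \<xi>) * exp (\<i> * cor (a \<bullet> \<xi>)))
    (cor (sqrt pi ^ (DIM('a) + 1) / (2 * half_moment DIM('a)) * exp (- norm a)))"
proof -
  let ?n = "DIM('a)"
  define H :: "'a \<Rightarrow> real \<Rightarrow> 'a \<Rightarrow> complex" where
    "H a v \<xi> = cor (indicator {0<..} v * (v ^ ?n * exp (- v\<^sup>2))) *
      (cor (exp (- v\<^sup>2 * (norm \<xi>)\<^sup>2)) * exp (\<i> * cor (a \<bullet> \<xi>)))" for a v \<xi>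
  define N where "N a v = sqrt pi ^ ?n * (indicator {0<..} v *\<^sub>R exp (- (v\<^sup>2 + (norm a / 2)\<^sup>2 / v\<^sup>2)))" for a :: 'a and v :: real
  have inner_\<xi>: "has_bochner_integral lborel (H a v) (cor (N a v))" for a v
  proof (cases "v > 0")
    case True
    have "has_bochner_integral lborel (H a v)
      (cor (indicator {0<..} v * (v ^ ?n * exp (- v\<^sup>2))) *
        cor (sqrt (pi / v\<^sup>2) ^ ?n * exp (- (norm a)\<^sup>2 / (4 * v\<^sup>2))))"
      unfolding H_def[abs_def] using True by (intro has_bochner_integral_mult_right gaussian_fourier) auto
    also have "cor (indicator {0<..} v * (v ^ ?n * exp (- v\<^sup>2))) *
        cor (sqrt (pi / v\<^sup>2) ^ ?n * exp (- (norm a)\<^sup>2 / (4 * v\<^sup>2)))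
      = cor (v ^ ?n * exp (- v\<^sup>2) * (sqrt (pi / v\<^sup>2) ^ ?n * exp (- (norm a)\<^sup>2 / (4 * v\<^sup>2))))"
      using True by simp
    also have "v ^ ?n * exp (- v\<^sup>2) * (sqrt (pi / v\<^sup>2) ^ ?n * exp (- (norm a)\<^sup>2 / (4 * v\<^sup>2))) = N a v"
    proof -
      have "exp (- v\<^sup>2) * exp (- (norm a)\<^sup>2 / (4 * v\<^sup>2)) = exp (- (v\<^sup>2 + (norm a / 2)\<^sup>2 / v\<^sup>2))"
        by (simp add: power_divide flip: exp_add)
      moreover have "v ^ ?n * sqrt (pi / v\<^sup>2) ^ ?n = sqrt pi ^ ?n"
        using True by (simp add: real_sqrt_divide flip: power_mult_distrib)
      moreover have "N a v = sqrt pi ^ ?n * exp (- (v\<^sup>2 + (norm a / 2)\<^sup>2 / v\<^sup>2))"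
        using True by (simp add: N_def)
      ultimately show ?thesis by (metis (no_types, lifting) mult.assoc mult.left_commute)
    qed
    finally show ?thesis .
  next
    case False
    then have "H a v = (\<lambda>_. 0)" "N a v = 0" by (auto simp: H_def N_def)
    then show ?thesis by (simp add: has_bochner_integral_zero)
  qed
  have norm_H: "cor (norm (H a v \<xi>)) = H 0 v \<xi>" for v \<xi>
    by (simp add: H_def norm_mult norm_power indicator_def)
  have "(LINT \<xi>|lborel. norm (H a v \<xi>)) = N 0 v" for v
  proof -
    have "cor (LINT \<xi>|lborel. norm (H a v \<xi>)) = (LINT \<xi>|lborel. H 0 v \<xi>)"
      by (simp only: norm_H flip: integral_complex_of_real)
    also have "\<dots> = cor (N 0 v)" using inner_\<xi>[of 0 v] by (rule has_bochner_integral_integral_eq)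
    finally show ?thesis by (simp only: of_real_eq_iff)
  qed
  moreover have N: "has_bochner_integral lborel (N a) (sqrt pi ^ ?n * (sqrt pi / 2 * exp (- 2 * (norm a / 2))))" for a
    unfolding N_def[abs_def] by (intro has_bochner_integral_mult_right subordination_integral) auto
  ultimately have int1: "integrable lborel (\<lambda>v. LINT \<xi>|lborel. norm (H a v \<xi>))"
    by (simp add: has_bochner_integral_iff)
  have int: "integrable (lborel \<Otimes>\<^sub>M lborel) (case_prod (H a))"
  proof (rule lborel_pair.Fubini_integrable)
    show "case_prod (H a) \<in> borel_measurable (lborel \<Otimes>\<^sub>M lborel)"
      unfolding H_def by measurable
    show "AE v in lborel. integrable lborel (\<lambda>\<xi>. case_prod (H a) (v, \<xi>))"
      using inner_\<xi> by (auto simp: has_bochner_integral_iff)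
  qed (use int1 in simp)
  have inner_v: "(LINT v|lborel. H a v \<xi>) = cor (half_moment ?n) * (cor (bessel_weight \<xi>) * exp (\<i> * cor (a \<bullet> \<xi>)))" for \<xi>
  proof -
    let ?g = "\<lambda>v::real. indicator {0<..} v *\<^sub>R (v ^ ?n * exp (- (1 + (norm \<xi>)\<^sup>2) * v\<^sup>2))"
    have "H a v \<xi> = cor (?g v) * exp (\<i> * cor (a \<bullet> \<xi>))" for v
      by (simp add: H_def algebra_simps exp_add exp_diff exp_minus divide_inverse)
    then have "(LINT v|lborel. H a v \<xi>) = cor (LINT v|lborel. ?g v) * exp (\<i> * cor (a \<bullet> \<xi>))"
      by (simp only: integral_mult_left_zero integral_complex_of_real)
    also have "(LINT v|lborel. ?g v) = half_moment ?n * bessel_weight \<xi>"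
      unfolding bessel_weight_def
      by (rule has_bochner_integral_integral_eq[OF scaled_half_moment[OF one_plus_sq_pos]])
    finally show ?thesis by simp
  qed
  let ?w = "\<lambda>\<xi>. cor (bessel_weight \<xi>) * exp (\<i> * cor (a \<bullet> \<xi>))"
  have "integrable lborel (\<lambda>\<xi>. cor (half_moment ?n) * ?w \<xi>)"
    using lborel_pair.integrable_snd[OF int] by (simp add: inner_v)
  then have "integrable lborel (\<lambda>\<xi>. cor (1 / half_moment ?n) * (cor (half_moment ?n) * ?w \<xi>))"
    by (rule integrable_mult_right)
  moreover have "cor (1 / half_moment ?n) * (cor (half_moment ?n) * z) = z" for z
    using half_moment_pos[of ?n] by simp
  ultimately have iw: "integrable lborel ?w" by (simp only:)
  have "cor (half_moment ?n) * (LINT \<xi>|lborel. ?w \<xi>) = (LINT \<xi>|lborel. LINT v|lborel. H a v \<xi>)"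
    by (simp add: inner_v)
  also have "\<dots> = (LINT v|lborel. LINT \<xi>|lborel. H a v \<xi>)"
    by (simp only: lborel_pair.integral_snd[OF int] lborel_pair.integral_fst[OF int])
  also have "\<dots> = (LINT v|lborel. cor (N a v))"
    by (simp only: has_bochner_integral_integral_eq[OF inner_\<xi>])
  also have "\<dots> = cor (sqrt pi ^ ?n * (sqrt pi / 2 * exp (- 2 * (norm a / 2))))"
    by (simp only: integral_complex_of_real has_bochner_integral_integral_eq[OF N])
  also have "\<dots> = cor (half_moment ?n) * cor (sqrt pi ^ (?n + 1) / (2 * half_moment ?n) * exp (- norm a))"
  proof -
    have "sqrt pi ^ ?n * (sqrt pi / 2 * exp (- 2 * (norm a / 2)))
        = half_moment ?n * (sqrt pi ^ (?n + 1) / (2 * half_moment ?n) * exp (- norm a))"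
      using half_moment_pos[of ?n] by (simp add: field_simps)
    then show ?thesis unfolding of_real_mult[symmetric] by (rule arg_cong)
  qed
  finally have "(LINT \<xi>|lborel. ?w \<xi>) = cor (sqrt pi ^ (?n + 1) / (2 * half_moment ?n) * exp (- norm a))"
    using half_moment_pos[of ?n] by (subst (asm) mult_cancel_left) auto
  with iw show ?thesis by (simp only: has_bochner_integral_iff)
qed

text \<open>The duplication formula for the Gamma function, in the form of the two parities of \<open>n\<close>.\<close>

lemma fact_unit_ball_vol:
  "fact n * unit_ball_vol (real n) = (2 * pi) ^ n * (2 * half_moment n) / sqrt pi ^ (n + 1)"
proof (cases "even n")
  case True
  then obtain k where k: "n = 2 * k" by (elim evenE)
  have 1: "sqrt pi ^ (n + 1) = sqrt pi * pi ^ k" by (simp add: k power_mult)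
  have "pi ^ n = pi ^ k * pi ^ k" by (simp only: k mult_2 power_add)
  then have 2: "(2 * pi) ^ n = 2 ^ n * (pi ^ k * pi ^ k)" by (simp only: power_mult_distrib)
  have 3: "unit_ball_vol (real n) = pi ^ k / fact k" unfolding k by (rule unit_ball_vol_even)
  have 4: "half_moment n = sqrt pi / 2 * (fact n / (2 ^ n * fact k))" using True by (simp add: half_moment_def k)
  have "a * (p / f) = t * (p * p) * (2 * (s / 2 * (a / (t * f)))) / (s * p)"
    if "p > 0" "f > 0" "t > 0" "s > 0" for a p f t s :: real
    using that by (simp add: field_simps)
  then show ?thesis unfolding 1 2 3 4 by simp
next
  case False
  then obtain k where k: "n = 2 * k + 1" by (elim oddE)
  have "sqrt pi ^ (n + 1) = (sqrt pi ^ 2) ^ (k + 1)" unfolding k power_mult[symmetric] by simp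
  then have 1: "sqrt pi ^ (n + 1) = pi * pi ^ k" by simp
  have "pi ^ n = pi * pi ^ k * pi ^ k" by (simp only: k mult_2 power_add power_one_right) (simp only: mult_ac)
  then have 2: "(2 * pi) ^ n = 2 ^ n * (pi * pi ^ k * pi ^ k)" by (simp only: power_mult_distrib)
  have 3: "unit_ball_vol (real n) = (2 ^ (2 * Suc k) * fact (Suc k)) / fact (2 * Suc k) * pi ^ k"
    unfolding k by (rule unit_ball_vol_odd)
  have 4: "half_moment n = fact k / 2" using False by (simp add: half_moment_def k)
  have 5: "(fact (2 * Suc k) :: real) = (2 * (real k + 1)) * fact n" by (simp add: k algebra_simps)
  have 6: "(fact (Suc k) :: real) = (real k + 1) * fact k" by simp
  have 7: "(2::real) ^ (2 * Suc k) = 2 * 2 ^ n" by (simp add: k)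
  have "a * (2 * t * (c * f) / (2 * c * a) * p) = t * (q * p * p) * (2 * (f / 2)) / (q * p)"
    if "a > 0" "p > 0" "f > 0" "t > 0" "c > 0" "q > 0" for a p f t c q :: real
    using that by (simp add: field_simps)
  then show ?thesis unfolding 1 2 3 4 5 6 7 by this auto
qed

text \<open>The constant \<open>K\<close> of the introduction.\<close>

definition magnitude_const :: "'a::euclidean_space itself \<Rightarrow> real" where
  "magnitude_const _ = fact DIM('a) * unit_ball_vol (real DIM('a))"

lemma magnitude_const_pos: "0 < magnitude_const TYPE('a::euclidean_space)"
  by (simp add: magnitude_const_def)

lemma bessel_weight_fourier:
  fixes a :: "'a::euclidean_space"
  shows "has_bochner_integral lborel (\<lambda>\<xi>. cor (bessel_weight \<xi>) * exp (\<i> * cor (a \<bullet> \<xi>)))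
    (cor ((2 * pi) ^ DIM('a) / magnitude_const TYPE('a) * exp (- norm a)))"
  using bessel_weight_fourier_half_moment[of a] half_moment_pos[of "DIM('a)"]
  by (simp add: magnitude_const_def fact_unit_ball_vol power_mult_distrib)

lemma bessel_weight_integrable: "integrable lborel (bessel_weight :: 'a::euclidean_space \<Rightarrow> real)"
proof -
  have "integrable lborel (\<lambda>\<xi>::'a. cor (bessel_weight \<xi>))"
    using bessel_weight_fourier[of "0::'a"] by (simp add: has_bochner_integral_iff)
  from integrable_Re[OF this] show ?thesis by simp
qed

section \<open>The Fourier transform on Schwartz space\<close>

lemma smooth_continuous: "f \<in> smooth_in D \<Longrightarrow> continuous_on UNIV f"
  by (auto intro!: differentiable_imp_continuous_on simp: differentiable_on_def smooth_inD(2))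

lemma schwartz_continuous: "f \<in> schwartz \<Longrightarrow> continuous_on UNIV f"
  by (simp add: schwartz_eq_smooth_in smooth_continuous)

lemma schwartz_measurable: "f \<in> schwartz \<Longrightarrow> f \<in> borel_measurable borel"
  by (intro borel_measurable_continuous_onI schwartz_continuous)

lemma slow_measurable: "f \<in> slow \<Longrightarrow> f \<in> borel_measurable borel"
  unfolding slow_def by (intro borel_measurable_continuous_onI smooth_continuous)

lemma schwartz_rapid: "f \<in> schwartz \<Longrightarrow> f \<in> rapid"
  by (auto simp: schwartz_eq_smooth_in dest: smooth_inD)

lemma schwartz_partial: "f \<in> schwartz \<Longrightarrow> b \<in> Basis \<Longrightarrow> partial b f \<in> schwartz"
  by (simp add: schwartz_eq_smooth_in smooth_inD(3))

lemma schwartz_has_derivative: "f \<in> schwartz \<Longrightarrow> (f has_derivative frechet_derivative f (at x)) (at x)"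
  by (simp add: schwartz_eq_smooth_in smooth_inD(5))

lemma schwartz_iter_partial: "f \<in> schwartz \<Longrightarrow> set bs \<subseteq> Basis \<Longrightarrow> iter_partial bs f \<in> schwartz"
  by (induction bs) (auto intro: schwartz_partial)

lemma bessel_weight_pos: "0 < bessel_weight x"
  using one_plus_sq_pos[of x] by (simp add: bessel_weight_def)

lemma bessel_weight_measurable [measurable]: "bessel_weight \<in> borel_measurable borel"
  unfolding bessel_weight_def by measurable

text \<open>The weight is integrable, so decay of order \<open>n + 1\<close> suffices for integrability on an \<open>n\<close>-dimensional
  space.\<close>

lemma le_bessel_weight: 
  fixes x :: "'a::euclidean_space"
  assumes "(1 + norm x) ^ (DIM('a) + 1) * c \<le> C" "0 \<le> c"
  shows "c \<le> C * bessel_weight x"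
proof -
  have "(1 + (norm x)\<^sup>2) powr ((real DIM('a) + 1) / 2) \<le> ((1 + norm x)\<^sup>2) powr ((real DIM('a) + 1) / 2)"
    by (intro powr_mono2) (auto simp: power2_eq_square algebra_simps)
  also have "\<dots> = (1 + norm x) ^ (DIM('a) + 1)"
  proof -
    have p: "0 < 1 + norm x" by (rule add_pos_nonneg) auto
    then have "((1 + norm x)\<^sup>2) powr ((real DIM('a) + 1) / 2) = (1 + norm x) powr (2 * ((real DIM('a) + 1) / 2))"
      by (simp only: powr_powr powr_numeral[symmetric])
    also have "2 * ((real DIM('a) + 1) / 2) = real (DIM('a) + 1)" by simp
    finally show ?thesis using p by (simp only: powr_realpow)
  qed
  finally have "(1 + (norm x)\<^sup>2) powr ((real DIM('a) + 1) / 2) * c \<le> (1 + norm x) ^ (DIM('a) + 1) * c"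
    using assms(2) by (rule mult_right_mono)
  with assms(1) have le: "(1 + (norm x)\<^sup>2) powr ((real DIM('a) + 1) / 2) * c \<le> C" by linarith
  have "bessel_weight x * (1 + (norm x)\<^sup>2) powr ((real DIM('a) + 1) / 2) = 1"
    using one_plus_sq_pos[of x] by (simp add: bessel_weight_def flip: powr_add)
  then have "c = bessel_weight x * ((1 + (norm x)\<^sup>2) powr ((real DIM('a) + 1) / 2) * c)"
    unfolding mult.assoc[symmetric] by simp
  also have "\<dots> \<le> bessel_weight x * C"
    using le by (rule mult_left_mono) (rule less_imp_le[OF bessel_weight_pos])
  finally show ?thesis by (simp add: mult.commute)
qed

lemma rapid_bessel_weight:
  assumes "f \<in> rapid"
  shows "\<exists>C\<ge>0. \<forall>x. cmod (f x) \<le> C * bessel_weight x"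
proof -
  obtain C where "C \<ge> 0" "\<And>x. (1 + norm x) ^ (DIM('a) + 1) * cmod (f x) \<le> C"
    using assms unfolding rapid_iff by meson
  then show ?thesis by (auto intro!: le_bessel_weight exI[of _ C])
qed

lemma rapid_bounded:
  assumes "f \<in> rapid"
  shows "\<exists>B\<ge>0. \<forall>x. cmod (f x) \<le> B"
proof -
  obtain B where "B \<ge> 0" "\<forall>x. (1 + norm x) ^ 0 * cmod (f x) \<le> B"
    using assms unfolding rapid_iff by meson
  then show ?thesis by auto
qed

lemma integrable_bessel_weight_bound:
  fixes f :: "'a::euclidean_space \<Rightarrow> 'b::{banach, second_countable_topology}"
  assumes "f \<in> borel_measurable borel" "\<And>x. norm (f x) \<le> C * bessel_weight x"
  shows "integrable lborel f"
  by (rule Bochner_Integration.integrable_bound[of _ "\<lambda>x. C * bessel_weight x"])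
    (use assms bessel_weight_integrable in \<open>auto intro!: AE_I2 order_trans[OF assms(2)]\<close>)

lemma schwartz_integrable: "f \<in> schwartz \<Longrightarrow> integrable lborel f"
  using rapid_bessel_weight[OF schwartz_rapid, of f]
  by (auto intro: integrable_bessel_weight_bound[OF schwartz_measurable])

lemma schwartz_integrable_mult_bounded:
  assumes "f \<in> schwartz" "g \<in> borel_measurable borel" "\<And>x. cmod (g x) \<le> B"
  shows "integrable lborel (\<lambda>x. g x * f x)"
proof (rule Bochner_Integration.integrable_bound[of _ "\<lambda>x. B * cmod (f x)"])
  show "integrable lborel (\<lambda>x. B * cmod (f x))"
    using schwartz_integrable[OF assms(1)] by simp
  show "(\<lambda>x. g x * f x) \<in> borel_measurable lborel"
    using assms(2) schwartz_measurable[OF assms(1)] by simp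
  show "AE x in lborel. norm (g x * f x) \<le> norm (B * cmod (f x))"
  proof (rule AE_I2)
    fix x
    have "norm (g x * f x) \<le> B * cmod (f x)"
      unfolding norm_mult by (rule mult_right_mono[OF assms(3)]) simp
    then show "norm (g x * f x) \<le> norm (B * cmod (f x))" by simp
  qed
qed

text \<open>Convergence to 0 uniformly against all polynomial weights. A null sequence of Schwartz functions
  has this property for every sequence of iterated partial derivatives.\<close>

definition rapid_null :: "(nat \<Rightarrow> 'a::euclidean_space \<Rightarrow> complex) \<Rightarrow> bool" where
  "rapid_null f \<longleftrightarrow> (\<forall>k. \<forall>e>0. \<forall>\<^sub>F j in sequentially. \<forall>x. (1 + norm x) ^ k * cmod (f j x) \<le> e)"

lemma rapid_nullI:
  assumes f: "\<forall>k. \<forall>e>0. \<forall>\<^sub>F j in sequentially. \<forall>x. norm x ^ k * cmod (f j x) \<le> e"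
  shows "rapid_null f"
  unfolding rapid_null_def
proof (intro allI impI)
  fix k and e :: real assume e: "e > 0"
  define d where "d = e / (2 ^ k * 2)"
  have d: "d > 0" using e by (simp add: d_def)
  have "\<forall>\<^sub>F j in sequentially. \<forall>x. norm x ^ 0 * cmod (f j x) \<le> d" "\<forall>\<^sub>F j in sequentially. \<forall>x. norm x ^ k * cmod (f j x) \<le> d"
    using f d by blast+
  then show "\<forall>\<^sub>F j in sequentially. \<forall>x. (1 + norm x) ^ k * cmod (f j x) \<le> e"
  proof eventually_elim
    case (elim j)
    show ?case
    proof
      fix x
      have "(1 + norm x) ^ k * cmod (f j x) \<le> 2 ^ k * (1 + norm x ^ k) * cmod (f j x)"
        by (intro mult_right_mono one_plus_norm_power_le) auto
      also have "\<dots> = 2 ^ k * (norm x ^ 0 * cmod (f j x) + norm x ^ k * cmod (f j x))"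
        by (simp add: algebra_simps)
      also have "\<dots> \<le> 2 ^ k * (d + d)" using elim by (intro mult_left_mono add_mono) auto
      also have "\<dots> = e" by (simp add: d_def)
      finally show "(1 + norm x) ^ k * cmod (f j x) \<le> e" .
    qed
  qed
qed

lemma schwartz_null_seq_rapid_null:
  assumes "schwartz_null_seq \<phi>" "set bs \<subseteq> Basis"
  shows "rapid_null (\<lambda>j. iter_partial bs (\<phi> j))"
proof (intro rapid_nullI allI impI)
  fix k and e :: real assume "e > 0"
  have "uniform_limit UNIV (\<lambda>j x. norm x ^ k *\<^sub>R iter_partial bs (\<phi> j) x) (\<lambda>_. 0) sequentially"
    using assms by (auto simp: schwartz_null_seq_def)
  then have "\<forall>\<^sub>F j in sequentially. \<forall>x\<in>UNIV. dist (norm x ^ k *\<^sub>R iter_partial bs (\<phi> j) x) 0 < e"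
    using \<open>e > 0\<close> by (rule uniform_limitD)
  then show "\<forall>\<^sub>F j in sequentially. \<forall>x. norm x ^ k * cmod (iter_partial bs (\<phi> j) x) \<le> e"
    by eventually_elim (auto intro: less_imp_le)
qed

lemma rapid_null_integral:
  fixes f :: "nat \<Rightarrow> 'a::euclidean_space \<Rightarrow> complex"
  assumes f: "\<And>j. f j \<in> borel_measurable borel" and null: "rapid_null f" and e: "e > 0"
  shows "\<forall>\<^sub>F j in sequentially. (LINT x|lborel. cmod (f j x)) \<le> e"
proof -
  let ?I = "integral\<^sup>L lborel (bessel_weight :: 'a \<Rightarrow> real)"
  have I: "0 \<le> ?I" by (intro integral_nonneg_AE AE_I2 less_imp_le bessel_weight_pos)
  define d where "d = e / (?I + 1)"
  have d: "d > 0" using e I by (simp add: d_def)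
  then have "\<forall>\<^sub>F j in sequentially. \<forall>x. (1 + norm x) ^ (DIM('a) + 1) * cmod (f j x) \<le> d"
    using null unfolding rapid_null_def by blast
  then show ?thesis
  proof eventually_elim
    case (elim j)
    then have le: "cmod (f j x) \<le> d * bessel_weight x" for x by (intro le_bessel_weight) auto
    have "(LINT x|lborel. cmod (f j x)) \<le> (LINT x|lborel. d * bessel_weight (x::'a))"
    proof (rule integral_mono)
      show "integrable lborel (\<lambda>x. cmod (f j x))"
        by (rule integrable_norm, rule integrable_bessel_weight_bound[OF f le])
      show "integrable lborel (\<lambda>x::'a. d * bessel_weight x)"
        by (rule integrable_mult_right, rule bessel_weight_integrable)
    qed (rule le)
    also have "\<dots> = d * ?I" by simp
    also have "\<dots> \<le> d * (?I + 1)" using d by (intro mult_left_mono) auto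
    also have "\<dots> = e" using I by (simp add: d_def)
    finally show ?case .
  qed
qed

lemma lborel_integral_affine:
  fixes f :: "'a::euclidean_space \<Rightarrow> complex"
  assumes f: "f \<in> borel_measurable borel" and c: "c \<noteq> 0"
  shows "integral\<^sup>L lborel f = \<bar>c\<bar> ^ DIM('a) *\<^sub>R (LINT x|lborel. f (t + c *\<^sub>R x))"
proof -
  have m: "(\<lambda>x. t + c *\<^sub>R x) \<in> measurable lborel (borel :: 'a measure)" by measurable
  have "integral\<^sup>L lborel f = (LINT x|distr lborel borel (\<lambda>x. t + c *\<^sub>R x). \<bar>c\<bar> ^ DIM('a) *\<^sub>R f x)"
    by (subst lborel_affine[OF c, of t], subst integral_density) (use f in auto)
  also have "\<dots> = (LINT x|lborel. \<bar>c\<bar> ^ DIM('a) *\<^sub>R f (t + c *\<^sub>R x))"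
    by (rule integral_distr[OF m]) (use f in auto)
  finally show ?thesis by simp
qed

lemma lborel_integral_translate:
  fixes f :: "'a::euclidean_space \<Rightarrow> complex"
  assumes f: "f \<in> borel_measurable borel"
  shows "(LINT x|lborel. f (x + t)) = integral\<^sup>L lborel f"
  using lborel_integral_affine[OF f, of 1 t] by (simp add: add.commute)

text \<open>Dominates difference quotients of a Schwartz function with steps of length at most 1. The constant comes from
  \<open>1 + (norm x)\<^sup>2 \<le> 3 * (1 + (norm (x + y))\<^sup>2)\<close>.\<close>

lemma bessel_weight_shift:
  fixes x y :: "'a::euclidean_space"
  assumes y: "norm y \<le> 1"
  shows "bessel_weight (x + y) \<le> 3 powr ((real DIM('a) + 1) / 2) * bessel_weight x"
proof -
  let ?s = "(real DIM('a) + 1) / 2"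
  have "norm x \<le> norm (x + y) + norm y" by (metis add_diff_cancel_right' norm_triangle_ineq4)
  then have "norm x \<le> norm (x + y) + 1" using y by linarith
  then have "(norm x)\<^sup>2 \<le> (norm (x + y) + 1)\<^sup>2" by (intro power_mono) auto
  also have "\<dots> \<le> 2 * (norm (x + y))\<^sup>2 + 2"
    using zero_le_power2[of "norm (x + y) - 1"] by (simp add: power2_eq_square algebra_simps)
  finally have le: "(norm x)\<^sup>2 \<le> 2 * (norm (x + y))\<^sup>2 + 2" .
  have "(1 + u) / 3 \<le> 1 + w" if "u \<le> 2 * w + 2" "0 \<le> w" for u w :: real
    using that by simp
  from this[OF le] have "(1 + (norm x)\<^sup>2) / 3 \<le> 1 + (norm (x + y))\<^sup>2" by simp
  then have "(1 + (norm (x + y))\<^sup>2) powr - ?s \<le> ((1 + (norm x)\<^sup>2) / 3) powr - ?s"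
    using one_plus_sq_pos[of x] by (intro powr_mono2') auto
  also have "\<dots> = 3 powr ?s * (1 + (norm x)\<^sup>2) powr - ?s"
    using one_plus_sq_pos[of x] by (simp add: powr_divide powr_minus field_simps)
  finally show ?thesis by (simp add: bessel_weight_def)
qed

text \<open>All difference quotients in direction \<open>b\<close> have integral 0 by translation invariance, and they converge to
  the partial derivative under a common integrable bound.\<close>

lemma integral_partial_eq_0:
  fixes f :: "'a::euclidean_space \<Rightarrow> complex"
  assumes f: "f \<in> schwartz" and b: "b \<in> Basis"
  shows "(LINT x|lborel. partial b f x) = 0"
proof -
  obtain C where C: "C \<ge> 0" "\<And>x. cmod (partial b f x) \<le> C * bessel_weight x"
    using rapid_bessel_weight[OF schwartz_rapid[OF schwartz_partial[OF f b]]] by auto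
  let ?D = "C * 3 powr ((real DIM('a) + 1) / 2)"
  let ?t = "\<lambda>k. 1 / real (Suc k)"
  define g where "g k x = (f (x + ?t k *\<^sub>R b) - f x) /\<^sub>R ?t k" for k x
  have fm: "f \<in> borel_measurable borel" by (rule schwartz_measurable[OF f])
  have fint: "integrable lborel f" by (rule schwartz_integrable[OF f])
  have gm: "g k \<in> borel_measurable borel" for k
    unfolding g_def[abs_def]
    by (intro borel_measurable_scaleR borel_measurable_const borel_measurable_diff fm measurable_compose[OF _ fm]) measurable
  have line: "((\<lambda>s. f (x + s *\<^sub>R b)) has_derivative (\<lambda>h. h *\<^sub>R partial b f (x + s *\<^sub>R b))) (at s)" for x s
  proof -
    have "((\<lambda>s. x + s *\<^sub>R b) has_derivative (\<lambda>h. h *\<^sub>R b)) (at s)" by (auto intro!: derivative_eq_intros)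
    from has_derivative_compose[OF this schwartz_has_derivative[OF f]]
    show ?thesis
      by (simp add: linear_scale[OF has_derivative_linear[OF schwartz_has_derivative[OF f]]])
  qed
  have bound: "cmod (g k x) \<le> ?D * bessel_weight x" for k x
  proof -
    have t: "0 < ?t k" "?t k \<le> 1" by auto
    have cont: "continuous_on {0..?t k} (\<lambda>s. f (x + s *\<^sub>R b))"
      by (intro continuous_at_imp_continuous_on ballI has_derivative_continuous[OF line])
    have "\<exists>s\<in>{0<..<?t k}. norm (f (x + ?t k *\<^sub>R b) - f (x + 0 *\<^sub>R b)) \<le> norm ((?t k - 0) *\<^sub>R partial b f (x + s *\<^sub>R b))"
      by (rule mvt_general[OF t(1) cont line])
    then obtain s where s: "s \<in> {0<..<?t k}" "norm (f (x + ?t k *\<^sub>R b) - f (x + 0 *\<^sub>R b)) \<le> norm ((?t k - 0) *\<^sub>R partial b f (x + s *\<^sub>R b))"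
      by (rule bexE)
    have s1: "0 \<le> s" "s \<le> 1"
      using s(1) t(2) unfolding greaterThanLessThan_iff by linarith+
    have "cmod (g k x) = norm (f (x + ?t k *\<^sub>R b) - f (x + 0 *\<^sub>R b)) / ?t k"
      using t by (simp add: g_def divide_inverse mult.commute)
    also have "\<dots> \<le> norm ((?t k - 0) *\<^sub>R partial b f (x + s *\<^sub>R b)) / ?t k"
      using s t by (intro divide_right_mono) auto
    also have "\<dots> = cmod (partial b f (x + s *\<^sub>R b))" using t by simp
    also have "\<dots> \<le> C * bessel_weight (x + s *\<^sub>R b)" by (rule C)
    also have "\<dots> \<le> C * (3 powr ((real DIM('a) + 1) / 2) * bessel_weight x)"
      using C(1) s1 b by (intro mult_left_mono bessel_weight_shift) auto
    finally show ?thesis by (simp add: mult.assoc)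
  qed
  have lim: "(\<lambda>k. g k x) \<longlonglongrightarrow> partial b f x" for x
  proof -
    let ?d = "partial b f x"
    have 1: "(\<lambda>h. norm (f (x + (0 + h) *\<^sub>R b) - f (x + 0 *\<^sub>R b) - h *\<^sub>R ?d) / norm h) \<midarrow>0\<rightarrow> 0"
      using line[of x 0] unfolding has_derivative_at by simp
    have 2: "filterlim ?t (at 0) sequentially"
      unfolding filterlim_at using LIMSEQ_Suc[OF lim_1_over_n] by auto
    have "norm (f (x + (0 + ?t k) *\<^sub>R b) - f (x + 0 *\<^sub>R b) - ?t k *\<^sub>R ?d) / norm (?t k) = norm (g k x - ?d)" for k
    proof -
      have "g k x - ?d = (f (x + (0 + ?t k) *\<^sub>R b) - f (x + 0 *\<^sub>R b) - ?t k *\<^sub>R ?d) /\<^sub>R ?t k"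
        by (simp add: g_def scaleR_diff_right)
      then show ?thesis by (simp add: divide_inverse mult.commute)
    qed
    with filterlim_compose[OF 1 2] have "(\<lambda>k. norm (g k x - ?d)) \<longlonglongrightarrow> 0" by simp
    then show ?thesis by (simp add: tendsto_norm_zero_iff LIM_zero_iff)
  qed
  have "(\<lambda>k. integral\<^sup>L lborel (g k)) \<longlonglongrightarrow> integral\<^sup>L lborel (partial b f)"
  proof (rule integral_dominated_convergence[where w="\<lambda>x. ?D * bessel_weight x"])
    show "integrable lborel (\<lambda>x::'a. ?D * bessel_weight x)"
      by (rule integrable_mult_right, rule bessel_weight_integrable)
  qed (use lim bound gm schwartz_measurable[OF schwartz_partial[OF f b]] in auto)
  moreover have "integral\<^sup>L lborel (g k) = 0" for k
  proof -
    obtain B where B: "B \<ge> 0" "\<And>x. cmod (f x) \<le> B * bessel_weight x"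
      using rapid_bessel_weight[OF schwartz_rapid[OF f]] by auto
    have "integrable lborel (\<lambda>x. f (x + ?t k *\<^sub>R b))"
    proof (rule integrable_bessel_weight_bound)
      show "(\<lambda>x. f (x + ?t k *\<^sub>R b)) \<in> borel_measurable borel"
        by (rule measurable_compose[OF _ fm]) measurable
      fix x
      have "norm (f (x + ?t k *\<^sub>R b)) \<le> B * bessel_weight (x + ?t k *\<^sub>R b)" by (rule B)
      also have "\<dots> \<le> B * (3 powr ((real DIM('a) + 1) / 2) * bessel_weight x)"
        using B(1) b by (intro mult_left_mono bessel_weight_shift) auto
      finally show "norm (f (x + ?t k *\<^sub>R b)) \<le> (B * 3 powr ((real DIM('a) + 1) / 2)) * bessel_weight x"
        by (simp add: mult.assoc)
    qed
    then show ?thesis unfolding g_def using fint lborel_integral_translate[OF fm, of "?t k *\<^sub>R b"] by simp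
  qed
  ultimately show ?thesis by (simp add: LIMSEQ_const_iff)
qed


definition fourier_const :: "'a::euclidean_space itself \<Rightarrow> real" where
  "fourier_const _ = (2 * pi) powr (- (real DIM('a) / 2))"

lemma fourier_const_pos: "0 < fourier_const TYPE('a::euclidean_space)"
  by (simp add: fourier_const_def)

lemma fourier_const_sq: "(fourier_const TYPE('a::euclidean_space))\<^sup>2 * (2 * pi) ^ DIM('a) = 1"
proof -
  have "(fourier_const TYPE('a))\<^sup>2 = (2 * pi) powr (- real DIM('a))"
    by (simp add: fourier_const_def power2_eq_square flip: powr_add)
  also have "\<dots> = inverse ((2 * pi) ^ DIM('a))"
    by (simp add: powr_minus powr_realpow)
  finally have eq: "(fourier_const TYPE('a))\<^sup>2 = inverse ((2 * pi) ^ DIM('a))" .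
  have "(2 * pi) ^ DIM('a) \<noteq> 0" by simp
  then show ?thesis unfolding eq by (rule left_inverse)
qed

abbreviation character :: "'a::euclidean_space \<Rightarrow> 'a \<Rightarrow> complex" where
  "character \<xi> y \<equiv> exp (- (\<i> * cor (\<xi> \<bullet> y)))"

lemma cmod_character [simp]: "cmod (character \<xi> y) = 1"
  by (simp add: norm_exp_eq_Re)

lemma fourier_eq:
  fixes f :: "'a::euclidean_space \<Rightarrow> complex"
  shows "fourier f \<xi> = cor (fourier_const TYPE('a)) * (LINT y|lborel. f y * character \<xi> y)"
  by (simp add: fourier_def fourier_const_def scaleR_conv_of_real)

lemma character_slow: "character \<xi> \<in> slow"
  using exp_imag_slow[of "- \<xi>"] by (simp add: inner_commute)

lemma character_measurable: "character \<xi> \<in> borel_measurable borel"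
  by (rule slow_measurable[OF character_slow])

lemma mult_character_schwartz: "f \<in> schwartz \<Longrightarrow> (\<lambda>y. f y * character \<xi> y) \<in> schwartz"
  using slow_mult_schwartz[OF character_slow] by (simp add: mult.commute)

lemma integrable_mult_character:
  assumes "integrable lborel f" shows "integrable lborel (\<lambda>y. f y * character \<xi> y)"
  by (rule Bochner_Integration.integrable_bound[OF assms])
    (use character_measurable borel_measurable_integrable[OF assms] in \<open>auto simp: norm_mult\<close>)

lemma cmod_fourier_le:
  fixes f :: "'a::euclidean_space \<Rightarrow> complex"
  assumes "integrable lborel f"
  shows "cmod (fourier f \<xi>) \<le> fourier_const TYPE('a) * (LINT y|lborel. cmod (f y))"
proof -
  have "cmod (LINT y|lborel. f y * character \<xi> y) \<le> (LINT y|lborel. cmod (f y * character \<xi> y))"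
    by (rule integral_norm_bound)
  also have "\<dots> = (LINT y|lborel. cmod (f y))" by (simp add: norm_mult)
  finally show ?thesis unfolding fourier_eq norm_mult using fourier_const_pos[where 'a='a]
    by (intro mult_mono) auto
qed

lemma fourier_scale: "fourier (\<lambda>y. c * f y) \<xi> = c * fourier f \<xi>"
  by (simp add: fourier_eq mult.assoc)

lemma fourier_add:
  assumes "integrable lborel f" "integrable lborel g"
  shows "fourier (\<lambda>y. f y + g y) \<xi> = fourier f \<xi> + fourier g \<xi>"
  using integrable_mult_character[OF assms(1)] integrable_mult_character[OF assms(2)]
  by (simp add: fourier_eq distrib_right distrib_left)

text \<open>Integration by parts: the partial derivative of \<open>f y * character \<xi> y\<close> has integral 0.\<close>

lemma fourier_partial:
  assumes f: "f \<in> schwartz" and b: "b \<in> Basis"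
  shows "fourier (partial b f) \<xi> = \<i> * cor (\<xi> \<bullet> b) * fourier f \<xi>"
proof -
  let ?g = "\<lambda>y. f y * character \<xi> y"
  have D: "(character \<xi> has_derivative (\<lambda>h. - (\<i> * cor (\<xi> \<bullet> h)) * character \<xi> y)) (at y)" for y
  proof -
    have "((\<lambda>y. - (\<i> * cor (\<xi> \<bullet> y))) has_derivative (\<lambda>h. - (\<i> * cor (\<xi> \<bullet> h)))) (at y)"
      by (auto intro!: derivative_eq_intros)
    from has_derivative_compose[OF this DERIV_exp[unfolded has_field_derivative_def]]
    show ?thesis by (simp add: mult.commute)
  qed
  have "(?g has_derivative (\<lambda>h. f y * (- (\<i> * cor (\<xi> \<bullet> h)) * character \<xi> y)
      + frechet_derivative f (at y) h * character \<xi> y)) (at y)" for y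
    by (rule has_derivative_mult[OF schwartz_has_derivative[OF f] D])
  then have "partial b ?g = (\<lambda>y. f y * (- (\<i> * cor (\<xi> \<bullet> b)) * character \<xi> y)
      + frechet_derivative f (at y) b * character \<xi> y)"
    by (rule has_derivative_imp_partial)
  then have "0 = (LINT y|lborel. f y * (- (\<i> * cor (\<xi> \<bullet> b)) * character \<xi> y)
      + frechet_derivative f (at y) b * character \<xi> y)"
    using integral_partial_eq_0[OF mult_character_schwartz[OF f] b, of \<xi>] by simp
  also have "\<dots> = (LINT y|lborel. - (\<i> * cor (\<xi> \<bullet> b)) * (f y * character \<xi> y)
      + frechet_derivative f (at y) b * character \<xi> y)"
    by (simp add: mult_ac)
  also have "\<dots> = - (\<i> * cor (\<xi> \<bullet> b)) * (LINT y|lborel. f y * character \<xi> y)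
      + (LINT y|lborel. frechet_derivative f (at y) b * character \<xi> y)"
    by (subst Bochner_Integration.integral_add)
      (use schwartz_integrable[OF mult_character_schwartz] f schwartz_partial[OF f b] in \<open>auto intro!: integrable_mult_right\<close>)
  finally show ?thesis unfolding fourier_eq by (simp add: algebra_simps)
qed

text \<open>The remainder of the first-order expansion of \<open>character h y\<close> is at most \<open>(norm h)\<^sup>2 (norm y)\<^sup>2\<close>, and \<open>(norm y)\<^sup>2 f y\<close>
  is integrable. This gives differentiability as a function of several variables at once.\<close>

lemma fourier_has_derivative:
  fixes f :: "'a::euclidean_space \<Rightarrow> complex"
  assumes f: "f \<in> schwartz"
  shows "(fourier f has_derivative (\<lambda>h. fourier (\<lambda>y. (- \<i> * cor (y \<bullet> h)) * f y) \<xi>)) (at \<xi>)"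
proof -
  let ?c = "fourier_const TYPE('a)"
  let ?D = "\<lambda>h. fourier (\<lambda>y. (- \<i> * cor (y \<bullet> h)) * f y) \<xi>"
  have hs: "(\<lambda>y. (- \<i> * cor (y \<bullet> h)) * f y) \<in> schwartz" for h
    by (intro slow_mult_schwartz slow_mult slow_const slow_inner f)
  have sq: "(\<lambda>y. cor ((norm y)\<^sup>2) * f y) \<in> schwartz"
    by (intro slow_mult_schwartz slow_norm_sq f)
  define B where "B = ?c * (LINT y|lborel. cmod (cor ((norm y)\<^sup>2) * f y))"
  have "linear ?D"
  proof (rule linearI)
    fix h k :: 'a and r :: real
    have "(\<lambda>y. (- \<i> * cor (y \<bullet> (h + k))) * f y)
        = (\<lambda>y. (- \<i> * cor (y \<bullet> h)) * f y + (- \<i> * cor (y \<bullet> k)) * f y)"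
      by (simp add: inner_add_right algebra_simps)
    then show "?D (h + k) = ?D h + ?D k"
      by (simp only: fourier_add[OF schwartz_integrable[OF hs] schwartz_integrable[OF hs]])
    have "(\<lambda>y. (- \<i> * cor (y \<bullet> (r *\<^sub>R h))) * f y)
        = (\<lambda>y. cor r * ((- \<i> * cor (y \<bullet> h)) * f y))"
      by (simp add: algebra_simps)
    then show "?D (r *\<^sub>R h) = r *\<^sub>R ?D h"
      by (simp only: fourier_scale scaleR_conv_of_real)
  qed
  then have bl: "bounded_linear ?D" by (simp add: linear_conv_bounded_linear)
  have rem: "cmod (fourier f (\<xi> + h) - fourier f \<xi> - ?D h) \<le> B * (norm h)\<^sup>2" for h
  proof -
    let ?r = "\<lambda>y. f y * character \<xi> y * (character h y - 1 + \<i> * cor (h \<bullet> y))"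
    have int: "integrable lborel (\<lambda>y. f y * character (\<xi> + h) y)" "integrable lborel (\<lambda>y. f y * character \<xi> y)"
      "integrable lborel (\<lambda>y. ((- \<i> * cor (y \<bullet> h)) * f y) * character \<xi> y)"
      by (intro schwartz_integrable mult_character_schwartz f hs)+
    have eq: "f y * character (\<xi> + h) y - f y * character \<xi> y - ((- \<i> * cor (y \<bullet> h)) * f y) * character \<xi> y = ?r y" for y
    proof -
      have "character (\<xi> + h) y = character \<xi> y * character h y"
        by (simp add: inner_add_left distrib_left flip: exp_add)
      then show ?thesis by (simp add: algebra_simps inner_commute)
    qed
    have I: "(LINT y|lborel. ?r y) = (LINT y|lborel. f y * character (\<xi> + h) y) - (LINT y|lborel. f y * character \<xi> y)
        - (LINT y|lborel. ((- \<i> * cor (y \<bullet> h)) * f y) * character \<xi> y)"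
      unfolding eq[symmetric] by (simp only: Bochner_Integration.integral_diff Bochner_Integration.integrable_diff int)
    have "fourier f (\<xi> + h) - fourier f \<xi> - ?D h = cor ?c * (LINT y|lborel. ?r y)"
      unfolding fourier_eq I by (simp only: right_diff_distrib)
    moreover have "cmod (LINT y|lborel. ?r y) \<le> (LINT y|lborel. (norm h)\<^sup>2 * cmod (cor ((norm y)\<^sup>2) * f y))"
    proof (rule Bochner_Integration.integral_norm_bound_integral)
      show "integrable lborel ?r"
        unfolding eq[symmetric] by (intro Bochner_Integration.integrable_diff int)
      show "integrable lborel (\<lambda>y. (norm h)\<^sup>2 * cmod (cor ((norm y)\<^sup>2) * f y))"
        by (intro integrable_mult_right integrable_norm schwartz_integrable sq)
      fix y
      have "cmod (character h y - 1 + \<i> * cor (h \<bullet> y)) \<le> \<bar>- (h \<bullet> y)\<bar> ^ 2 / 2"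
        using iexp_approx1[of "- (h \<bullet> y)" 1] by (simp add: numeral_2_eq_2 algebra_simps)
      also have "\<dots> \<le> \<bar>h \<bullet> y\<bar> ^ 2" by simp
      also have "\<dots> \<le> (norm h * norm y) ^ 2" by (intro power_mono Cauchy_Schwarz_ineq2) auto
      finally have "cmod (f y * character \<xi> y) * cmod (character h y - 1 + \<i> * cor (h \<bullet> y)) \<le> cmod (f y) * (norm h * norm y) ^ 2"
        unfolding norm_mult cmod_character mult_1_right by (rule mult_left_mono) simp
      also have "\<dots> = (norm h)\<^sup>2 * cmod (cor ((norm y)\<^sup>2) * f y)"
        by (simp add: norm_mult norm_power power_mult_distrib mult_ac)
      finally show "norm (?r y) \<le> (norm h)\<^sup>2 * cmod (cor ((norm y)\<^sup>2) * f y)"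
        by (simp only: norm_mult)
    qed
    ultimately have "cmod (fourier f (\<xi> + h) - fourier f \<xi> - ?D h) \<le> ?c * ((norm h)\<^sup>2 * (LINT y|lborel. cmod (cor ((norm y)\<^sup>2) * f y)))"
      using fourier_const_pos[where 'a='a] by (simp add: norm_mult)
    then show ?thesis by (simp add: B_def mult_ac)
  qed
  show ?thesis
    unfolding has_derivative_at
  proof (intro conjI bl)
    show "(\<lambda>h. norm (fourier f (\<xi> + h) - fourier f \<xi> - ?D h) / norm h) \<midarrow>0\<rightarrow> 0"
    proof (rule Lim_null_comparison)
      show "((\<lambda>h::'a. B * norm h) \<longlongrightarrow> 0) (at 0)" by (auto intro!: tendsto_eq_intros)
      show "\<forall>\<^sub>F h in at 0. norm (norm (fourier f (\<xi> + h) - fourier f \<xi> - ?D h) / norm h) \<le> B * norm h"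
      proof (rule eventually_at_ball'[of 1, THEN eventually_mono])
        fix h :: 'a assume "h \<in> ball 0 1 \<and> h \<noteq> 0 \<and> h \<in> UNIV"
        then have "norm h > 0" by simp
        then show "norm (norm (fourier f (\<xi> + h) - fourier f \<xi> - ?D h) / norm h) \<le> B * norm h"
          using rem[of h] by (simp add: divide_le_eq power2_eq_square mult.assoc)
      qed simp
    qed
  qed
qed

lemma norm_power_le_sum_Basis:
  fixes x :: "'a::euclidean_space"
  shows "norm x ^ k \<le> real DIM('a) ^ k * (\<Sum>b\<in>Basis. \<bar>x \<bullet> b\<bar> ^ k)"
proof -
  have "Max ((\<lambda>b. \<bar>x \<bullet> b\<bar>) ` Basis) \<in> (\<lambda>b. \<bar>x \<bullet> b\<bar>) ` Basis" by (intro Max_in) auto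
  then obtain c where c: "Max ((\<lambda>b. \<bar>x \<bullet> b\<bar>) ` Basis) = \<bar>x \<bullet> c\<bar>" "c \<in> Basis" by (rule imageE)
  then have max: "\<bar>x \<bullet> b\<bar> \<le> \<bar>x \<bullet> c\<bar>" if "b \<in> Basis" for b
    by (metis Max_ge finite_Basis finite_imageI imageI that)
  have "norm x \<le> (\<Sum>b\<in>Basis. \<bar>x \<bullet> b\<bar>)" by (rule norm_le_l1)
  also have "\<dots> \<le> real DIM('a) * \<bar>x \<bullet> c\<bar>" by (intro sum_bounded_above max)
  finally have "norm x ^ k \<le> (real DIM('a) * \<bar>x \<bullet> c\<bar>) ^ k" by (intro power_mono) auto
  also have "\<dots> = real DIM('a) ^ k * \<bar>x \<bullet> c\<bar> ^ k" by (simp add: power_mult_distrib)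
  also have "\<dots> \<le> real DIM('a) ^ k * (\<Sum>b\<in>Basis. \<bar>x \<bullet> b\<bar> ^ k)"
    by (intro mult_left_mono member_le_sum[of c, where f="\<lambda>b. \<bar>x \<bullet> b\<bar> ^ k"] c) auto
  finally show ?thesis .
qed

text \<open>Up to the factor \<open>\<i>\<close>, multiplication of the Fourier transform by a coordinate is the Fourier transform of a
  partial derivative.
  The bound is explicit to serve for single functions as well as for null sequences.\<close>

lemma fourier_decay:
  fixes f :: "'a::euclidean_space \<Rightarrow> complex"
  assumes f: "f \<in> schwartz"
  shows "norm \<xi> ^ k * cmod (fourier f \<xi>) \<le> real DIM('a) ^ k *
    (\<Sum>b\<in>Basis. fourier_const TYPE('a) * (LINT y|lborel. cmod (iter_partial (replicate k b) f y)))"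
proof -
  have iter: "set (replicate k b) \<subseteq> Basis" if "b \<in> Basis" for b k using that by (cases k) auto
  have *: "fourier (iter_partial (replicate k b) f) \<xi> = (\<i> * cor (\<xi> \<bullet> b)) ^ k * fourier f \<xi>"
    if b: "b \<in> Basis" for b
  proof (induction k)
    case (Suc k)
    then show ?case
      using fourier_partial[OF schwartz_iter_partial[OF f iter[OF b]] b, of k \<xi>] by (simp add: mult_ac)
  qed simp
  have "norm \<xi> ^ k * cmod (fourier f \<xi>) \<le> (real DIM('a) ^ k * (\<Sum>b\<in>Basis. \<bar>\<xi> \<bullet> b\<bar> ^ k)) * cmod (fourier f \<xi>)"
    by (rule mult_right_mono[OF norm_power_le_sum_Basis]) simp
  also have "\<dots> = real DIM('a) ^ k * (\<Sum>b\<in>Basis. \<bar>\<xi> \<bullet> b\<bar> ^ k * cmod (fourier f \<xi>))"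
    by (simp add: sum_distrib_right mult.assoc)
  also have "\<dots> = real DIM('a) ^ k * (\<Sum>b\<in>Basis. cmod (fourier (iter_partial (replicate k b) f) \<xi>))"
    by (simp add: * norm_mult norm_power cong: sum.cong)
  also have "\<dots> \<le> real DIM('a) ^ k *
    (\<Sum>b\<in>Basis. fourier_const TYPE('a) * (LINT y|lborel. cmod (iter_partial (replicate k b) f y)))"
    by (intro mult_left_mono sum_mono cmod_fourier_le schwartz_integrable schwartz_iter_partial f iter) auto
  finally show ?thesis .
qed

text \<open>The Fourier transforms of Schwartz functions are closed under partial derivatives, since differentiation
  becomes multiplication by a coordinate; \<open>fourier_decay\<close> bounds each of them.\<close>

lemma fourier_schwartz:
  assumes f: "f \<in> schwartz" shows "fourier f \<in> schwartz"
  unfolding schwartz_eq_smooth_in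
proof (rule smooth_in_coinduct[OF plus_closed_rapid, where S="fourier ` schwartz"])
  fix g :: "'a \<Rightarrow> complex" assume "g \<in> fourier ` schwartz"
  then obtain f :: "'a \<Rightarrow> complex" where g: "g = fourier f" and f: "f \<in> schwartz" by blast
  show "g \<in> rapid"
    unfolding rapid_def bounded_iff g using fourier_decay[OF f] by (auto simp: norm_power)
  show "\<exists>F. (\<forall>x. (g has_derivative F x) (at x)) \<and> (\<forall>b\<in>Basis. (\<lambda>x. F x b) \<in> plus_closure (fourier ` schwartz))"
    unfolding g
    by (intro exI conjI allI ballI, rule fourier_has_derivative[OF f])
      (intro plus_closure.base imageI slow_mult_schwartz slow_mult slow_const slow_inner f)
qed (use f in blast)

lemma fourier_rapid_null:
  fixes \<phi> :: "nat \<Rightarrow> 'a::euclidean_space \<Rightarrow> complex"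
  assumes \<phi>: "schwartz_null_seq \<phi>"
  shows "rapid_null (\<lambda>j. fourier (\<phi> j))"
proof (intro rapid_nullI allI impI)
  fix k and e :: real assume e: "e > 0"
  let ?c = "fourier_const TYPE('a)" and ?n = "real DIM('a)"
  define d where "d = e / (?n ^ k * (?n * ?c))"
  have n: "?n > 0" by simp
  have pos: "?n ^ k * (?n * ?c) > 0" using fourier_const_pos[where 'a='a] by simp
  then have d: "d > 0" using e unfolding d_def by (rule divide_pos_pos[rotated])
  have \<phi>s: "\<phi> j \<in> schwartz" for j using \<phi> by (simp add: schwartz_null_seq_def)
  have iter: "set (replicate k b) \<subseteq> Basis" if "b \<in> Basis" for b :: 'a using that by (cases k) auto
  have "\<forall>b\<in>Basis. \<forall>\<^sub>F j in sequentially. (LINT y|lborel. cmod (iter_partial (replicate k b) (\<phi> j) y)) \<le> d"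
    by (intro ballI rapid_null_integral schwartz_null_seq_rapid_null[OF \<phi>] iter d
        schwartz_measurable schwartz_iter_partial \<phi>s)
  then have "\<forall>\<^sub>F j in sequentially. \<forall>b\<in>Basis. (LINT y|lborel. cmod (iter_partial (replicate k b) (\<phi> j) y)) \<le> d"
    by (simp add: eventually_ball_finite)
  then show "\<forall>\<^sub>F j in sequentially. \<forall>x. norm x ^ k * cmod (fourier (\<phi> j) x) \<le> e"
  proof eventually_elim
    case (elim j)
    show ?case
    proof
      fix \<xi> :: 'a
      have "norm \<xi> ^ k * cmod (fourier (\<phi> j) \<xi>) \<le> ?n ^ k *
        (\<Sum>b\<in>Basis. ?c * (LINT y|lborel. cmod (iter_partial (replicate k b) (\<phi> j) y)))"
        by (rule fourier_decay[OF \<phi>s])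
      also have "\<dots> \<le> ?n ^ k * (\<Sum>b\<in>(Basis::'a set). ?c * d)"
        using elim fourier_const_pos[where 'a='a] by (intro mult_left_mono sum_mono) auto
      also have "\<dots> = (?n ^ k * (?n * ?c)) * d" by simp
      also have "\<dots> = e" 
        using nonzero_mult_div_cancel_left[OF less_imp_neq[OF pos, symmetric], of e]
        unfolding d_def times_divide_eq_right .
      finally show "norm \<xi> ^ k * cmod (fourier (\<phi> j) \<xi>) \<le> e" .
    qed
  qed
qed

section \<open>Fourier inversion\<close>

lemma gaussian_integral:
  "v > 0 \<Longrightarrow> (LINT x::'a::euclidean_space|lborel. cor (exp (- v * (norm x)\<^sup>2))) = cor (sqrt (pi / v) ^ DIM('a))"
  using has_bochner_integral_integral_eq[OF gaussian_fourier[of v "0::'a"]] by simp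

text \<open>Inserting a Gaussian makes the double integral absolutely convergent. After exchanging the integrals
  the inner one is the Fourier transform of the Gaussian; the variance is parametrized by \<open>c\<close> so that the substitution
  \<open>y = x + c z\<close> removes it from the exponent.\<close>

lemma gaussian_regularized_inversion:
  fixes f :: "'a::euclidean_space \<Rightarrow> complex"
  assumes f: "f \<in> schwartz" and c: "c > 0"
  shows "(LINT \<xi>|lborel. fourier f \<xi> * (cor (exp (- (c\<^sup>2 / 4) * (norm \<xi>)\<^sup>2)) * exp (\<i> * cor (x \<bullet> \<xi>))))
    = cor (fourier_const TYPE('a) * (2 * sqrt pi) ^ DIM('a)) *
      (LINT z|lborel. f (x + c *\<^sub>R z) * cor (exp (- (norm z)\<^sup>2)))"
proof -
  let ?k = "cor (fourier_const TYPE('a))" and ?v = "c\<^sup>2 / 4" and ?n = "DIM('a)"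
  let ?G = "\<lambda>\<xi>. cor (exp (- ?v * (norm \<xi>)\<^sup>2)) * exp (\<i> * cor (x \<bullet> \<xi>))"
  have v: "?v > 0" using c by simp
  define H where "H \<xi> y = f y * character \<xi> y * ?G \<xi>" for \<xi> y
  have fint: "integrable lborel f" by (rule schwartz_integrable[OF f])
  have [measurable]: "f \<in> borel_measurable borel" by (rule schwartz_measurable[OF f])
  have Gint: "integrable lborel (\<lambda>\<xi>::'a. exp (- ?v * (norm \<xi>)\<^sup>2))"
  proof -
    have "integrable lborel (\<lambda>\<xi>::'a. cor (exp (- ?v * (norm \<xi>)\<^sup>2)))"
      using gaussian_fourier[OF v, of "0::'a"] by (simp add: has_bochner_integral_iff)
    from integrable_Re[OF this] show ?thesis by simp
  qed
  have nH: "norm (H \<xi> y) = cmod (f y) * exp (- ?v * (norm \<xi>)\<^sup>2)" for \<xi> y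
    by (simp add: H_def norm_mult)
  have int: "integrable (lborel \<Otimes>\<^sub>M lborel) (case_prod H)"
  proof (rule lborel_pair.Fubini_integrable)
    show "case_prod H \<in> borel_measurable (lborel \<Otimes>\<^sub>M lborel)"
      unfolding H_def by measurable
    show "integrable lborel (\<lambda>\<xi>. LINT y|lborel. norm (case_prod H (\<xi>, y)))"
      using Gint by (simp add: nH)
    show "AE \<xi> in lborel. integrable lborel (\<lambda>y. case_prod H (\<xi>, y))"
      unfolding H_def using integrable_mult_character[OF fint] by (intro AE_I2) simp
  qed
  have inner: "(LINT \<xi>|lborel. H \<xi> y) = f y * cor (sqrt (pi / ?v) ^ ?n * exp (- (norm (x - y))\<^sup>2 / (4 * ?v)))" for y
  proof -
    have "H \<xi> y = f y * (cor (exp (- ?v * (norm \<xi>)\<^sup>2)) * exp (\<i> * cor ((x - y) \<bullet> \<xi>)))" for \<xi>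
    proof -
      have "exp (\<i> * cor ((x - y) \<bullet> \<xi>)) = character \<xi> y * exp (\<i> * cor (x \<bullet> \<xi>))"
        by (simp add: inner_diff_left inner_commute algebra_simps flip: exp_add)
      then show ?thesis by (simp add: H_def mult_ac)
    qed
    then show ?thesis
      using has_bochner_integral_integral_eq[OF gaussian_fourier[OF v, of "x - y"]] by simp
  qed
  have "(LINT \<xi>|lborel. fourier f \<xi> * ?G \<xi>) = (LINT \<xi>|lborel. ?k * (LINT y|lborel. H \<xi> y))"
  proof -
    have "fourier f \<xi> * ?G \<xi> = ?k * (LINT y|lborel. H \<xi> y)" for \<xi>
      unfolding fourier_eq H_def by (subst integral_mult_left_zero) (simp only: mult.assoc)
    then show ?thesis by (simp only:)
  qed
  also have "\<dots> = ?k * (LINT \<xi>|lborel. (LINT y|lborel. H \<xi> y))" by simp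
  also have "\<dots> = ?k * (LINT y|lborel. (LINT \<xi>|lborel. H \<xi> y))"
    by (simp only: lborel_pair.integral_snd[OF int] lborel_pair.integral_fst[OF int])
  also have "(LINT y|lborel. (LINT \<xi>|lborel. H \<xi> y)) =
      (LINT y|lborel. f y * cor (sqrt (pi / ?v) ^ ?n * exp (- (norm (x - y))\<^sup>2 / (4 * ?v))))"
    by (simp only: inner)
  also have "\<dots> = \<bar>c\<bar> ^ ?n *\<^sub>R (LINT z|lborel. f (x + c *\<^sub>R z) * cor (sqrt (pi / ?v) ^ ?n * exp (- (norm (x - (x + c *\<^sub>R z)))\<^sup>2 / (4 * ?v))))"
    by (rule lborel_integral_affine) (use c in auto)
  also have "\<dots> = \<bar>c\<bar> ^ ?n *\<^sub>R (LINT z|lborel. cor (sqrt (pi / ?v) ^ ?n) * (f (x + c *\<^sub>R z) * cor (exp (- (norm z)\<^sup>2))))"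
  proof -
    have "(norm (x - (x + c *\<^sub>R z)))\<^sup>2 / (4 * ?v) = (norm z)\<^sup>2" for z
      using c by (simp add: power_mult_distrib)
    then show ?thesis by (simp add: mult_ac)
  qed
  also have "\<dots> = cor (\<bar>c\<bar> ^ ?n * sqrt (pi / ?v) ^ ?n) * (LINT z|lborel. f (x + c *\<^sub>R z) * cor (exp (- (norm z)\<^sup>2)))"
    by (simp add: scaleR_conv_of_real)
  also have "\<bar>c\<bar> ^ ?n * sqrt (pi / ?v) ^ ?n = (2 * sqrt pi) ^ ?n"
  proof -
    have "sqrt (pi / ?v) = 2 * sqrt pi / c"
      by (rule real_sqrt_unique) (use c in \<open>simp_all add: power_divide power_mult_distrib\<close>)
    then have "\<bar>c\<bar> * sqrt (pi / ?v) = 2 * sqrt pi" using c by simp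
    then show ?thesis by (simp only: power_mult_distrib[symmetric])
  qed
  finally show ?thesis by simp
qed

text \<open>Let the width \<open>c\<close> of the regularization tend to 0 on both sides, under dominated convergence.\<close>

lemma fourier_inversion:
  fixes f :: "'a::euclidean_space \<Rightarrow> complex"
  assumes f: "f \<in> schwartz"
  shows "fourier (fourier f) (- x) = f x"
proof -
  let ?k = "fourier_const TYPE('a)" and ?n = "DIM('a)"
  define c where "c j = 1 / real (Suc j)" for j
  have c: "c j > 0" "c j \<le> 1" for j by (auto simp: c_def)
  have c0: "c \<longlonglongrightarrow> 0" unfolding c_def[abs_def] by (rule LIMSEQ_Suc[OF lim_1_over_n])
  have [measurable]: "f \<in> borel_measurable borel" "fourier f \<in> borel_measurable borel"
    by (intro schwartz_measurable fourier_schwartz f)+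
  let ?G = "\<lambda>j \<xi>. fourier f \<xi> * (cor (exp (- ((c j)\<^sup>2 / 4) * (norm \<xi>)\<^sup>2)) * exp (\<i> * cor (x \<bullet> \<xi>)))"
  have 1: "(\<lambda>j. LINT \<xi>|lborel. ?G j \<xi>) \<longlonglongrightarrow> (LINT \<xi>|lborel. fourier f \<xi> * exp (\<i> * cor (x \<bullet> \<xi>)))"
  proof (rule integral_dominated_convergence[where w="\<lambda>\<xi>. cmod (fourier f \<xi>)"])
    show "integrable lborel (\<lambda>\<xi>. cmod (fourier f \<xi>))"
      by (intro integrable_norm schwartz_integrable fourier_schwartz f)
    show "AE \<xi> in lborel. (\<lambda>j. ?G j \<xi>) \<longlonglongrightarrow> fourier f \<xi> * exp (\<i> * cor (x \<bullet> \<xi>))"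
    proof (rule AE_I2)
      fix \<xi> :: 'a
      have "(\<lambda>j. ?G j \<xi>) \<longlonglongrightarrow> fourier f \<xi> * (cor (exp (- (0\<^sup>2 / 4) * (norm \<xi>)\<^sup>2)) * exp (\<i> * cor (x \<bullet> \<xi>)))"
        by (intro tendsto_intros c0) simp
      then show "(\<lambda>j. ?G j \<xi>) \<longlonglongrightarrow> fourier f \<xi> * exp (\<i> * cor (x \<bullet> \<xi>))" by simp
    qed
    show "AE \<xi> in lborel. norm (?G j \<xi>) \<le> cmod (fourier f \<xi>)" for j
      by (intro AE_I2) (simp add: norm_mult mult_left_le)
  qed measurable
  obtain B where B: "B \<ge> 0" "\<And>x. cmod (f x) \<le> B"
    using rapid_bounded[OF schwartz_rapid[OF f]] by blast
  have gauss: "integrable lborel (\<lambda>z::'a. cor (exp (- 1 * (norm z)\<^sup>2)))"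
    using gaussian_fourier[of 1 "0::'a"] by (simp add: has_bochner_integral_iff)
  have 2: "(\<lambda>j. LINT z|lborel. f (x + c j *\<^sub>R z) * cor (exp (- (norm z)\<^sup>2)))
      \<longlonglongrightarrow> (LINT z::'a|lborel. f x * cor (exp (- (norm z)\<^sup>2)))"
  proof (rule integral_dominated_convergence[where w="\<lambda>z. B * cmod (cor (exp (- 1 * (norm z)\<^sup>2)))"])
    show "integrable lborel (\<lambda>z::'a. B * cmod (cor (exp (- 1 * (norm z)\<^sup>2))))"
      by (intro integrable_mult_right integrable_norm gauss)
    show "AE z in lborel. (\<lambda>j. f (x + c j *\<^sub>R z) * cor (exp (- (norm z)\<^sup>2)))
        \<longlonglongrightarrow> f x * cor (exp (- (norm z)\<^sup>2))"
    proof (intro AE_I2 tendsto_intros)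
      fix z :: 'a
      have "(\<lambda>j. x + c j *\<^sub>R z) \<longlonglongrightarrow> x + 0 *\<^sub>R z" by (intro tendsto_intros c0)
      then have "(\<lambda>j. x + c j *\<^sub>R z) \<longlonglongrightarrow> x" by simp
      with schwartz_continuous[OF f] show "(\<lambda>j. f (x + c j *\<^sub>R z)) \<longlonglongrightarrow> f x"
        by (auto intro: continuous_on_tendsto_compose)
    qed
    show "AE z in lborel. norm (f (x + c j *\<^sub>R z) * cor (exp (- (norm z)\<^sup>2)))
        \<le> B * cmod (cor (exp (- 1 * (norm z)\<^sup>2)))" for j
      by (intro AE_I2) (simp add: norm_mult mult_right_mono B)
  qed measurable
  have Geq: "(LINT z::'a|lborel. f x * cor (exp (- (norm z)\<^sup>2))) = f x * cor (sqrt pi ^ ?n)"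
    using gaussian_integral[of 1, where 'a='a] by simp
  from 2[unfolded Geq] have "(\<lambda>j. cor (?k * (2 * sqrt pi) ^ ?n) *
      (LINT z|lborel. f (x + c j *\<^sub>R z) * cor (exp (- (norm z)\<^sup>2))))
      \<longlonglongrightarrow> cor (?k * (2 * sqrt pi) ^ ?n) * (f x * cor (sqrt pi ^ ?n))"
    by (rule tendsto_mult_left)
  with 1 have "(LINT \<xi>|lborel. fourier f \<xi> * exp (\<i> * cor (x \<bullet> \<xi>)))
      = cor (?k * (2 * sqrt pi) ^ ?n) * (f x * cor (sqrt pi ^ ?n))"
    unfolding gaussian_regularized_inversion[OF f c(1)] by (rule LIMSEQ_unique)
  moreover have "fourier (fourier f) (- x) = cor ?k * (LINT \<xi>|lborel. fourier f \<xi> * exp (\<i> * cor (x \<bullet> \<xi>)))"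
    by (simp add: fourier_eq[of "fourier f"])
  moreover have "?k * (?k * (2 * sqrt pi) ^ ?n) * sqrt pi ^ ?n = 1"
  proof -
    have "2 * sqrt pi * sqrt pi = 2 * pi" by simp
    then have "(2 * sqrt pi) ^ ?n * sqrt pi ^ ?n = (2 * pi) ^ ?n"
      by (simp only: power_mult_distrib[symmetric])
    then show ?thesis using fourier_const_sq[where 'a='a] by (simp only: power2_eq_square mult.assoc)
  qed
  then have "cor (?k * (?k * (2 * sqrt pi) ^ ?n) * sqrt pi ^ ?n) * f x = f x" by (simp only: of_real_1 mult_1)
  then have "cor ?k * (cor (?k * (2 * sqrt pi) ^ ?n) * (f x * cor (sqrt pi ^ ?n))) = f x"
    by (simp only: of_real_mult mult_ac)
  ultimately show ?thesis by (simp only:)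
qed

section \<open>Functions are determined by their Schwartz pairings\<close>

lemma flatexp_one_bounds: "0 \<le> flatexp 1 t" "flatexp 1 t \<le> 1"
  by (auto simp: flatexp_def)

lemma flatexp_one_tendsto:
  "(\<lambda>m. flatexp 1 (real (Suc m) * t)) \<longlonglongrightarrow> (if t > 0 then 1 else 0)"
proof (cases "t > 0")
  case True
  have "(\<lambda>m. exp (- (1 / t * (1 / real (Suc m))))) \<longlonglongrightarrow> exp (- (1 / t * 0))"
    by (intro tendsto_intros LIMSEQ_Suc[OF lim_1_over_n])
  moreover have "flatexp 1 (real (Suc m) * t) = exp (- (1 / t * (1 / real (Suc m))))" for m
    using True by (simp add: flatexp_def not_le mult_le_0_iff divide_simps)
  ultimately show ?thesis using True by simp
next
  case False
  then have "flatexp 1 (real (Suc m) * t) = 0" for m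
    by (simp add: flatexp_def mult_nonneg_nonpos)
  then show ?thesis using False by simp
qed

text \<open>Multiplying by a Gaussian makes \<open>g\<close> integrable. The indicator of an open box is the bounded pointwise limit
  of products of dilated functions \<open>flatexp 1\<close>, one for each face, and these products are multipliers. So the integrals over all boxes vanish,
  hence those over all Borel sets, as the boxes generate them and are closed under intersection.\<close>

lemma annihilates_schwartz_imp_AE_0:
  fixes g :: "'a::euclidean_space \<Rightarrow> complex"
  assumes g: "g \<in> borel_measurable borel"
    and int: "\<And>\<phi>. \<phi> \<in> schwartz \<Longrightarrow> integrable lborel (\<lambda>x. g x * \<phi> x)"
    and zero: "\<And>\<phi>. \<phi> \<in> schwartz \<Longrightarrow> (LINT x|lborel. g x * \<phi> x) = 0"
  shows "AE x in lborel. g x = 0"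
proof -
  define G where "G x = exp (- cor (1 * (norm x)\<^sup>2))" for x :: 'a
  have G: "G \<in> schwartz" unfolding G_def[abs_def] by (rule gaussian_in_schwartz) simp
  define f where "f x = g x * G x" for x
  have f: "integrable lborel f" unfolding f_def by (rule int[OF G])
  have [measurable]: "f \<in> borel_measurable borel" using borel_measurable_integrable[OF f] by simp
  have box: "(LINT x:box a c|lborel. f x) = 0" for a c
  proof -
    define P where "P m x = (\<Prod>b\<in>Basis. cor (flatexp 1 (real (Suc m) * (x \<bullet> b - a \<bullet> b))) *
        cor (flatexp 1 (real (Suc m) * (c \<bullet> b - x \<bullet> b))))" for m x
    have P: "P m \<in> slow" for m
      unfolding P_def
    proof (intro slow_prod slow_mult)
      fix b :: 'a
      show "(\<lambda>x. cor (flatexp 1 (real (Suc m) * (x \<bullet> b - a \<bullet> b)))) \<in> slow"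
        using flatexp_affine_slow[of 1 "real (Suc m) *\<^sub>R b" "- (real (Suc m) * (a \<bullet> b))"]
        by (simp add: algebra_simps)
      show "(\<lambda>x. cor (flatexp 1 (real (Suc m) * (c \<bullet> b - x \<bullet> b)))) \<in> slow"
        using flatexp_affine_slow[of 1 "- (real (Suc m) *\<^sub>R b)" "real (Suc m) * (c \<bullet> b)"]
        by (simp add: algebra_simps)
    qed
    have P_le: "cmod (P m x) \<le> 1" for m x
      unfolding P_def prod_norm[symmetric]
      by (rule prod_le_1) (auto simp: norm_mult flatexp_one_bounds intro!: mult_le_one)
    have P_lim: "(\<lambda>m. P m x) \<longlonglongrightarrow> indicator (box a c) x" for x
    proof -
      let ?i = "\<lambda>t::real. if t > 0 then 1 else 0 :: real"
      have "(\<lambda>m. P m x) \<longlonglongrightarrow> (\<Prod>b\<in>Basis. cor (?i (x \<bullet> b - a \<bullet> b)) * cor (?i (c \<bullet> b - x \<bullet> b)))"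
        unfolding P_def by (intro tendsto_prod tendsto_mult tendsto_of_real flatexp_one_tendsto)
      also have "(\<Prod>b\<in>Basis. cor (?i (x \<bullet> b - a \<bullet> b)) * cor (?i (c \<bullet> b - x \<bullet> b))) = indicator (box a c) x"
      proof (cases "x \<in> box a c")
        case True
        then have "(\<Prod>b\<in>Basis. cor (?i (x \<bullet> b - a \<bullet> b)) * cor (?i (c \<bullet> b - x \<bullet> b))) = (\<Prod>b\<in>(Basis::'a set). 1)"
          by (intro prod.cong) (auto simp: mem_box)
        then show ?thesis using True by simp
      next
        case False
        then obtain b where "b \<in> Basis" "\<not> (a \<bullet> b < x \<bullet> b \<and> x \<bullet> b < c \<bullet> b)" by (auto simp: mem_box)
        then have "(\<Prod>b\<in>Basis. cor (?i (x \<bullet> b - a \<bullet> b)) * cor (?i (c \<bullet> b - x \<bullet> b))) = 0"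
          by (intro prod_zero) auto
        then show ?thesis using False by simp
      qed
      finally show ?thesis .
    qed
    have "(\<lambda>m. LINT x|lborel. P m x * f x) \<longlonglongrightarrow> (LINT x|lborel. indicator (box a c) x * f x)"
    proof (rule integral_dominated_convergence[where w="\<lambda>x. cmod (f x)"])
      show "integrable lborel (\<lambda>x. cmod (f x))" using f by (rule integrable_norm)
      show "(\<lambda>x. P m x * f x) \<in> borel_measurable lborel" for m
        using slow_measurable[OF P] by simp
      show "AE x in lborel. (\<lambda>m. P m x * f x) \<longlonglongrightarrow> indicator (box a c) x * f x"
        by (intro AE_I2 tendsto_intros P_lim)
      show "AE x in lborel. norm (P m x * f x) \<le> cmod (f x)" for m
        by (intro AE_I2) (simp add: norm_mult mult_left_le_one_le P_le)
    qed measurable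
    moreover have "(LINT x|lborel. P m x * f x) = 0" for m
      using zero[OF slow_mult_schwartz[OF P G], of m] by (simp add: f_def mult_ac)
    ultimately have "(LINT x|lborel. indicator (box a c) x * f x) = 0"
      by (simp add: LIMSEQ_const_iff)
    moreover have "indicator (box a c) x *\<^sub>R f x = indicator (box a c) x * f x" for x
      by (simp split: split_indicator)
    ultimately show ?thesis unfolding set_lebesgue_integral_def by simp
  qed
  have all: "(LINT x:A|lborel. f x) = 0" if A: "A \<in> sets borel" for A
  proof -
    have sub: "set_integrable lborel B f" if "B \<in> sets borel" for B
      unfolding set_integrable_def by (rule integrable_mult_indicator[OF _ f]) (use that in simp)
    have "Int_stable (range (\<lambda>(a, b). box a b :: 'a set))"
      by (auto simp: Int_stable_def box_Int_box)
    moreover have "range (\<lambda>(a, b). box a b :: 'a set) \<subseteq> Pow UNIV" by auto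
    moreover have "A \<in> sigma_sets UNIV (range (\<lambda>(a, b). box a b))"
      using A unfolding borel_eq_box by simp
    ultimately show ?thesis
    proof (induction rule: sigma_sets_induct_disjoint)
      case (basic A)
      then show ?case using box by auto
    next
      case empty
      then show ?case by (simp add: set_lebesgue_integral_def)
    next
      case (compl A)
      then have [measurable]: "A \<in> sets borel" by (simp add: borel_eq_box)
      have "(LINT x:UNIV|lborel. f x) = (LINT x:A|lborel. f x) + (LINT x:UNIV - A|lborel. f x)"
        using set_integral_Un[of A "UNIV - A" lborel f] sub[of A] sub[of "UNIV - A"] by simp
      moreover have "(LINT x:UNIV|lborel. f x) = 0"
        using zero[OF G] by (simp add: set_lebesgue_integral_def f_def)
      ultimately show ?case using compl by simp
    next
      case (union F)
      then have [measurable]: "\<And>i. F i \<in> sets borel" by (simp add: borel_eq_box subset_eq)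
      have "(LINT x:(\<Union>i. F i)|lborel. f x) = suminf (\<lambda>i. LINT x:F i|lborel. f x)"
        by (rule lebesgue_integral_countable_add)
          (use union(1) sub[of "\<Union>i. F i"] in \<open>auto simp: disjoint_family_on_def\<close>)
      then show ?case using union by simp
    qed
  qed
  have part: "AE x in lborel. h (f x) = 0" if h: "bounded_linear h" for h :: "complex \<Rightarrow> real"
  proof (rule density_unique_real)
    show "integrable lborel (\<lambda>x. h (f x))" by (rule integrable_bounded_linear[OF h f])
    show "integrable lborel (\<lambda>x::'a. 0 :: real)" by simp
    fix A :: "'a set" assume A: "A \<in> sets lborel"
    have "(LINT x:A|lborel. h (f x)) = (LINT x|lborel. h (indicator A x *\<^sub>R f x))"
      unfolding set_lebesgue_integral_def using linear_scale[OF bounded_linear.linear[OF h]] by simp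
    also have "\<dots> = h (LINT x:A|lborel. f x)"
      unfolding set_lebesgue_integral_def
      by (rule integral_bounded_linear[OF h]) (rule integrable_mult_indicator[OF A f])
    also have "\<dots> = 0" using all A linear_0[OF bounded_linear.linear[OF h]] by simp
    finally show "(LINT x:A|lborel. h (f x)) = (LINT x:A|lborel. 0)" by (simp add: set_lebesgue_integral_def)
  qed
  have "AE x in lborel. Re (f x) = 0" "AE x in lborel. Im (f x) = 0"
    by (intro part bounded_linear_Re bounded_linear_Im)+
  then show ?thesis
  proof eventually_elim
    case (elim x)
    then have "f x = 0" by (simp add: complex_eq_iff)
    then show ?case by (simp add: f_def G_def)
  qed
qed

lemma represents_unique:
  assumes "represents g T" "represents g' T"
  shows "AE x in lborel. g x = g' x"
proof -
  have m: "g \<in> borel_measurable borel" "g' \<in> borel_measurable borel"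
    using assms by (auto simp: represents_def)
  have i: "integrable lborel (\<lambda>x. g x * \<phi> x)" "integrable lborel (\<lambda>x. g' x * \<phi> x)"
    "(LINT x|lborel. g x * \<phi> x) = (LINT x|lborel. g' x * \<phi> x)" if "\<phi> \<in> schwartz" for \<phi>
    using assms that by (auto simp: represents_def)
  have "AE x in lborel. g x - g' x = 0"
    by (rule annihilates_schwartz_imp_AE_0) (use m i in \<open>auto simp: left_diff_distrib\<close>)
  then show ?thesis by simp
qed

section \<open>Bessel potential spaces as weighted L2 spaces\<close>

text \<open>A power of the Japanese bracket, normalized so that \<open>bracket \<alpha>\<close> has order \<open>\<alpha>\<close>.\<close>

definition bracket :: "real \<Rightarrow> 'a::euclidean_space \<Rightarrow> real" where
  "bracket \<alpha> x = (1 + (norm x)\<^sup>2) powr (\<alpha> / 2)"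

abbreviation weighted :: "real \<Rightarrow> ('a::euclidean_space \<Rightarrow> complex) \<Rightarrow> 'a \<Rightarrow> complex" where
  "weighted \<alpha> g \<equiv> (\<lambda>x. cor (bracket \<alpha> x) * g x)"

lemma bracket_pos: "0 < bracket \<alpha> x"
  using one_plus_sq_pos[of x] by (simp add: bracket_def)

lemma bracket_measurable [measurable]: "bracket \<alpha> \<in> borel_measurable borel"
  unfolding bracket_def[abs_def] by measurable

lemma bracket_minus [simp]: "bracket \<alpha> x * bracket (- \<alpha>) x = 1" "bracket (- \<alpha>) x * bracket \<alpha> x = 1"
  using one_plus_sq_pos[of x] by (simp_all add: bracket_def flip: powr_add)

lemma bracket_sq: "(bracket \<alpha> x)\<^sup>2 = (1 + (norm x)\<^sup>2) powr \<alpha>"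
  by (simp add: bracket_def power2_eq_square flip: powr_add)

lemma bracket_bessel_weight:
  "(bracket (- ((real DIM('a) + 1) / 2)) (x::'a::euclidean_space))\<^sup>2 = bessel_weight x"
  unfolding bracket_sq bessel_weight_def by simp

lemma bessel_weight_le_1: "bessel_weight x \<le> 1"
proof -
  have "bessel_weight x \<le> (1 + (norm x)\<^sup>2) powr 0"
    unfolding bessel_weight_def by (rule powr_mono) auto
  then show ?thesis using one_plus_sq_pos[of x] by simp
qed

lemma bracket_le: "bracket \<alpha> x \<le> (1 + norm x) ^ nat \<lceil>\<bar>\<alpha>\<bar>\<rceil>"
proof -
  have p: "1 \<le> 1 + norm x" by simp
  have "bracket \<alpha> x \<le> (1 + (norm x)\<^sup>2) powr (\<bar>\<alpha>\<bar> / 2)"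
    unfolding bracket_def by (rule powr_mono) auto
  also have "\<dots> \<le> ((1 + norm x)\<^sup>2) powr (\<bar>\<alpha>\<bar> / 2)"
    by (intro powr_mono2) (auto simp: power2_eq_square algebra_simps)
  also have "\<dots> = (1 + norm x) powr \<bar>\<alpha>\<bar>"
  proof -
    have "((1 + norm x)\<^sup>2) powr (\<bar>\<alpha>\<bar> / 2) = (1 + norm x) powr (2 * (\<bar>\<alpha>\<bar> / 2))"
      using p by (simp only: powr_powr powr_numeral[symmetric])
    then show ?thesis by simp
  qed
  also have "\<dots> \<le> (1 + norm x) powr real (nat \<lceil>\<bar>\<alpha>\<bar>\<rceil>)"
    using p by (intro powr_mono) (auto simp: real_nat_ceiling_ge)
  also have "\<dots> = (1 + norm x) ^ nat \<lceil>\<bar>\<alpha>\<bar>\<rceil>"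
    by (subst powr_realpow) (auto intro: add_pos_nonneg)
  finally show ?thesis .
qed

text \<open>Sufficiently fast decay absorbs both the growth of the bracket and the integration. The norm bound
  is linear in the decay constant, which turns convergence of null sequences into convergence of L2 norms.\<close>

lemma bracket_mult_L2:
  fixes f :: "'a::euclidean_space \<Rightarrow> complex"
  assumes f: "f \<in> borel_measurable borel" and C: "C \<ge> 0"
    and le: "\<And>x. (1 + norm x) ^ (DIM('a) + 1 + nat \<lceil>\<bar>\<alpha>\<bar>\<rceil>) * cmod (f x) \<le> C"
  shows "weighted \<alpha> f \<in> L2 lborel"
    and "l2_norm lborel (weighted \<alpha> f) \<le> C * sqrt (integral\<^sup>L lborel (bessel_weight :: 'a \<Rightarrow> real))"
proof -
  let ?f = "\<lambda>x. cor (bracket \<alpha> x) * f x"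
  have [measurable]: "?f \<in> borel_measurable borel" using f by measurable
  have sq: "(cmod (?f x))\<^sup>2 \<le> C\<^sup>2 * bessel_weight x" for x
  proof -
    have "cmod (?f x) = bracket \<alpha> x * cmod (f x)" using bracket_pos[of \<alpha> x] by (simp add: norm_mult)
    also have "\<dots> \<le> C * bessel_weight x"
    proof (rule le_bessel_weight)
      have "bracket \<alpha> x * cmod (f x) \<le> (1 + norm x) ^ nat \<lceil>\<bar>\<alpha>\<bar>\<rceil> * cmod (f x)"
        by (rule mult_right_mono[OF bracket_le]) simp
      then have "(1 + norm x) ^ (DIM('a) + 1) * (bracket \<alpha> x * cmod (f x)) \<le>
          (1 + norm x) ^ (DIM('a) + 1) * ((1 + norm x) ^ nat \<lceil>\<bar>\<alpha>\<bar>\<rceil> * cmod (f x))"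
        by (rule mult_left_mono) simp
      also have "\<dots> \<le> C" using le[of x] by (simp only: power_add mult.assoc)
      finally show "(1 + norm x) ^ (DIM('a) + 1) * (bracket \<alpha> x * cmod (f x)) \<le> C" .
      show "0 \<le> bracket \<alpha> x * cmod (f x)" using bracket_pos[of \<alpha> x] by simp
    qed
    finally have "(cmod (?f x))\<^sup>2 \<le> (C * bessel_weight x)\<^sup>2" by (intro power_mono) auto
    also have "\<dots> = C\<^sup>2 * (bessel_weight x * bessel_weight x)" by (simp add: power2_eq_square)
    also have "\<dots> \<le> C\<^sup>2 * (bessel_weight x * 1)"
      using bessel_weight_pos[of x] by (intro mult_left_mono bessel_weight_le_1) auto
    finally show ?thesis by simp
  qed
  have bw: "integrable lborel (\<lambda>x::'a. C\<^sup>2 * bessel_weight x)"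
    by (rule integrable_mult_right, rule bessel_weight_integrable)
  have int: "integrable lborel (\<lambda>x. (cmod (?f x))\<^sup>2)"
    by (rule Bochner_Integration.integrable_bound[OF bw]) (auto intro!: AE_I2 order_trans[OF sq])
  then show "?f \<in> L2 lborel" by (simp add: L2_def)
  have "(LINT x|lborel. (cmod (?f x))\<^sup>2) \<le> (LINT x::'a|lborel. C\<^sup>2 * bessel_weight x)"
    by (rule integral_mono[OF int bw sq])
  also have "\<dots> = C\<^sup>2 * integral\<^sup>L lborel (bessel_weight :: 'a \<Rightarrow> real)" by simp
  finally have "l2_norm lborel ?f \<le> sqrt (C\<^sup>2 * integral\<^sup>L lborel (bessel_weight :: 'a \<Rightarrow> real))"
    unfolding l2_norm_def by (rule real_sqrt_le_mono)
  then show "l2_norm lborel ?f \<le> C * sqrt (integral\<^sup>L lborel (bessel_weight :: 'a \<Rightarrow> real))"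
    using C by (simp add: real_sqrt_mult)
qed

lemma rapid_bracket_L2:
  assumes "f \<in> rapid" "f \<in> borel_measurable borel"
  shows "weighted \<alpha> f \<in> L2 lborel"
proof -
  obtain C where "C \<ge> 0" "\<And>x. (1 + norm x) ^ (DIM('a) + 1 + nat \<lceil>\<bar>\<alpha>\<bar>\<rceil>) * cmod (f x) \<le> C"
    using assms(1) unfolding rapid_iff by meson
  with assms(2) show ?thesis by (rule bracket_mult_L2(1))
qed

lemma rapid_null_bracket_L2:
  fixes f :: "nat \<Rightarrow> 'a::euclidean_space \<Rightarrow> complex"
  assumes "rapid_null f" "\<And>j. f j \<in> borel_measurable borel"
  shows "(\<lambda>j. l2_norm lborel (weighted \<alpha> (f j))) \<longlonglongrightarrow> 0"
proof (rule tendstoI)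
  fix e :: real assume e: "e > 0"
  define J where "J = sqrt (integral\<^sup>L lborel (bessel_weight :: 'a \<Rightarrow> real))"
  have I: "0 \<le> J" unfolding J_def by (intro real_sqrt_ge_zero integral_nonneg_AE AE_I2 less_imp_le bessel_weight_pos)
  define d where "d = e / (J + 1)"
  have d: "d > 0" using e I by (simp add: d_def)
  have de: "d * J < e"
  proof -
    have "d * J < d * (J + 1)" using d by simp
    also have "\<dots> = e" using I by (simp add: d_def)
    finally show ?thesis .
  qed
  have "\<forall>\<^sub>F j in sequentially. \<forall>x. (1 + norm x) ^ (DIM('a) + 1 + nat \<lceil>\<bar>\<alpha>\<bar>\<rceil>) * cmod (f j x) \<le> d"
    using assms(1) d unfolding rapid_null_def by blast
  then show "\<forall>\<^sub>F j in sequentially. dist (l2_norm lborel (weighted \<alpha> (f j))) 0 < e"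
  proof eventually_elim
    case (elim j)
    then have "l2_norm lborel (weighted \<alpha> (f j)) \<le> d * J"
      unfolding J_def using d by (intro bracket_mult_L2(2) assms(2)) auto
    then show ?case using de by simp
  qed
qed

text \<open>The distribution with Fourier transform \<open>g\<close>. By duality, the inverse Fourier transform is applied to the
  test function; it is the reflected Fourier transform.\<close>

definition dist_of :: "('a::euclidean_space \<Rightarrow> complex) \<Rightarrow> ('a \<Rightarrow> complex) \<Rightarrow> complex" where
  "dist_of g \<phi> = (if \<phi> \<in> schwartz then LINT \<xi>|lborel. g \<xi> * fourier \<phi> (- \<xi>) else 0)"

lemma rapid_reflect: "f \<in> rapid \<Longrightarrow> (\<lambda>x. f (- x)) \<in> rapid"
  unfolding rapid_iff by (metis norm_minus_cancel)

lemma rapid_null_reflect: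
  assumes f: "rapid_null f" shows "rapid_null (\<lambda>j x. f j (- x))"
  unfolding rapid_null_def
proof (intro allI impI)
  fix k and e :: real assume "e > 0"
  then have "\<forall>\<^sub>F j in sequentially. \<forall>x. (1 + norm x) ^ k * cmod (f j x) \<le> e"
    using f unfolding rapid_null_def by blast
  then show "\<forall>\<^sub>F j in sequentially. \<forall>x. (1 + norm x) ^ k * cmod (f j (- x)) \<le> e"
  proof eventually_elim
    case (elim j)
    show ?case
    proof
      fix x show "(1 + norm x) ^ k * cmod (f j (- x)) \<le> e" using spec[OF elim, of "- x"] by simp
    qed
  qed
qed

lemma measurable_reflect: "f \<in> borel_measurable borel \<Longrightarrow> (\<lambda>x::'a::euclidean_space. f (- x)) \<in> borel_measurable borel"
  by (rule measurable_compose[of uminus borel borel]) auto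

text \<open>The Bessel spaces of opposite orders are dual to each other.\<close>

lemma weighted_L2_pairing:
  assumes g: "g \<in> borel_measurable borel" "weighted \<alpha> g \<in> L2 lborel"
    and f: "(weighted (- \<alpha>) f) \<in> L2 lborel"
  shows "integrable lborel (\<lambda>x. g x * f x)"
    and "cmod (LINT x|lborel. g x * f x) \<le>
      l2_norm lborel (weighted \<alpha> g) * l2_norm lborel (weighted (- \<alpha>) f)"
proof -
  have eq: "(cor (bracket \<alpha> x) * g x) * (cor (bracket (- \<alpha>) x) * f x) = g x * f x" for x
  proof -
    have "(cor (bracket \<alpha> x) * g x) * (cor (bracket (- \<alpha>) x) * f x)
        = cor (bracket \<alpha> x * bracket (- \<alpha>) x) * (g x * f x)"
      by (simp only: of_real_mult mult_ac)
    then show ?thesis by (simp only: bracket_minus of_real_1 mult_1)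
  qed
  show "integrable lborel (\<lambda>x. g x * f x)"
    using L2_mult_integrable[OF g(2) f] unfolding eq .
  show "cmod (LINT x|lborel. g x * f x) \<le>
      l2_norm lborel (weighted \<alpha> g) * l2_norm lborel (weighted (- \<alpha>) f)"
    using L2_Cauchy_Schwarz[OF g(2) f] unfolding eq .
qed

lemma dist_of_tempered:
  fixes g :: "'a::euclidean_space \<Rightarrow> complex"
  assumes g: "g \<in> borel_measurable borel" "weighted \<alpha> g \<in> L2 lborel"
  shows "dist_of g \<in> tempered"
proof -
  have fm: "(\<lambda>\<xi>. fourier \<phi> (- \<xi>)) \<in> borel_measurable borel" if "\<phi> \<in> schwartz" for \<phi> :: "'a \<Rightarrow> complex"
    by (rule measurable_reflect[OF schwartz_measurable[OF fourier_schwartz[OF that]]])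
  have fL: "(\<lambda>\<xi>. cor (bracket (- \<alpha>) \<xi>) * fourier \<phi> (- \<xi>)) \<in> L2 lborel" if "\<phi> \<in> schwartz" for \<phi> :: "'a \<Rightarrow> complex"
    by (rule rapid_bracket_L2[OF rapid_reflect[OF schwartz_rapid[OF fourier_schwartz[OF that]]] fm[OF that]])
  have int: "integrable lborel (\<lambda>\<xi>. g \<xi> * fourier \<phi> (- \<xi>))" if "\<phi> \<in> schwartz" for \<phi>
    by (rule weighted_L2_pairing(1)[OF g fL[OF that]])
  have add: "dist_of g (\<lambda>x. \<phi> x + \<psi> x) = dist_of g \<phi> + dist_of g \<psi>" if "\<phi> \<in> schwartz" "\<psi> \<in> schwartz" for \<phi> \<psi>
    using that int by (simp add: dist_of_def schwartz_add fourier_add schwartz_integrable distrib_left)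
  have scale: "dist_of g (\<lambda>x. c * \<phi> x) = c * dist_of g \<phi>" if "\<phi> \<in> schwartz" for c \<phi>
    using that by (simp add: dist_of_def schwartz_scale fourier_scale mult.left_commute)
  have null: "(\<lambda>j. dist_of g (\<phi> j)) \<longlonglongrightarrow> 0" if \<phi>: "schwartz_null_seq \<phi>" for \<phi>
  proof (rule Lim_null_comparison)
    have s: "\<phi> j \<in> schwartz" for j using \<phi> by (simp add: schwartz_null_seq_def)
    let ?a = "l2_norm lborel (weighted \<alpha> g)"
    let ?b = "\<lambda>j. l2_norm lborel (\<lambda>\<xi>. cor (bracket (- \<alpha>) \<xi>) * fourier (\<phi> j) (- \<xi>))"
    show "\<forall>\<^sub>F j in sequentially. norm (dist_of g (\<phi> j)) \<le> ?a * ?b j"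
      using weighted_L2_pairing(2)[OF g fL[OF s]] by (simp add: dist_of_def s)
    have "?b \<longlonglongrightarrow> 0"
      by (rule rapid_null_bracket_L2[OF rapid_null_reflect[OF fourier_rapid_null[OF \<phi>]] fm[OF s]])
    then show "(\<lambda>j. ?a * ?b j) \<longlonglongrightarrow> 0" by (rule tendsto_mult_right_zero)
  qed
  show ?thesis
    unfolding tempered_def using add scale null by (auto simp: dist_of_def)
qed

lemma represents_fourier_dist_of:
  fixes g :: "'a::euclidean_space \<Rightarrow> complex"
  assumes g: "g \<in> borel_measurable borel" "weighted \<alpha> g \<in> L2 lborel"
  shows "represents g (fourier_dist (dist_of g))"
  unfolding represents_def
proof (intro conjI ballI)
  show "g \<in> borel_measurable lborel" using g by simp
  fix \<phi> :: "'a \<Rightarrow> complex" assume \<phi>: "\<phi> \<in> schwartz"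
  show "integrable lborel (\<lambda>x. g x * \<phi> x)"
    by (rule weighted_L2_pairing(1)[OF g rapid_bracket_L2[OF schwartz_rapid[OF \<phi>] schwartz_measurable[OF \<phi>]]])
  show "fourier_dist (dist_of g) \<phi> = (LINT x|lborel. g x * \<phi> x)"
    using \<phi> by (simp add: fourier_dist_def dist_of_def fourier_schwartz fourier_inversion)
qed

lemma dist_of_bessel_space:
  fixes g :: "'a::euclidean_space \<Rightarrow> complex"
  assumes g: "g \<in> borel_measurable borel" "weighted \<alpha> g \<in> L2 lborel"
  shows "dist_of g \<in> bessel_space \<alpha>"
  using dist_of_tempered[OF g] represents_fourier_dist_of[OF g] L2_integrable[OF g(2)]
  unfolding bessel_space_def bracket_def scaleR_conv_of_real by blast

text \<open>The norm is defined by an arbitrary representing function; it is well defined because all of them agree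
  almost everywhere.\<close>

lemma bessel_norm_eq:
  fixes T :: "('a::euclidean_space \<Rightarrow> complex) \<Rightarrow> complex"
  assumes "represents g (fourier_dist T)"
  shows "bessel_norm \<alpha> T = l2_norm lborel (weighted \<alpha> g)"
proof -
  define g' where "g' = (SOME g. represents g (fourier_dist T))"
  have g': "represents g' (fourier_dist T)" unfolding g'_def by (rule someI[of "\<lambda>g. represents g (fourier_dist T)", OF assms])
  have m: "g \<in> borel_measurable borel" "g' \<in> borel_measurable borel"
    using assms g' by (auto simp: represents_def)
  have "(LINT x|lborel. (1 + (norm x)\<^sup>2) powr \<alpha> * (cmod (g' x))\<^sup>2) = (LINT x|lborel. (cmod (cor (bracket \<alpha> x) * g x))\<^sup>2)"
  proof (rule integral_cong_AE)
    show "AE x in lborel. (1 + (norm x)\<^sup>2) powr \<alpha> * (cmod (g' x))\<^sup>2 = (cmod (cor (bracket \<alpha> x) * g x))\<^sup>2"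
      using represents_unique[OF g' assms]
      by eventually_elim (simp add: norm_mult power_mult_distrib bracket_sq)
  qed (use m in measurable)
  then show ?thesis by (simp add: bessel_norm_def l2_norm_def Let_def g'_def)
qed

lemma bessel_norm_dist_of:
  fixes g :: "'a::euclidean_space \<Rightarrow> complex"
  assumes g: "g \<in> borel_measurable borel" "weighted \<alpha> g \<in> L2 lborel"
  shows "bessel_norm \<alpha> (dist_of g) = l2_norm lborel (weighted \<alpha> g)"
  by (rule bessel_norm_eq[OF represents_fourier_dist_of[OF g]])

text \<open>By inversion every test function is the Fourier transform of its reflected Fourier transform, so an element
  of the space is determined by the function that represents its Fourier transform. The reflection of a Fourier transform is a Schwartz function
  because it is the third iterate of the Fourier transform.\<close>

lemma bessel_spaceE:
  assumes "T \<in> bessel_space \<alpha>"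
  obtains g where "g \<in> borel_measurable borel" "weighted \<alpha> g \<in> L2 lborel" "T = dist_of g"
proof -
  obtain g where T: "T \<in> tempered" and g: "represents g (fourier_dist T)"
    and int: "integrable lborel (\<lambda>x. (cmod ((1 + (norm x)\<^sup>2) powr (\<alpha> / 2) *\<^sub>R g x))\<^sup>2)"
    using assms by (auto simp: bessel_space_def)
  have m: "g \<in> borel_measurable borel" using g by (simp add: represents_def)
  have L: "weighted \<alpha> g \<in> L2 lborel"
    using int m by (simp add: L2_def bracket_def scaleR_conv_of_real)
  have "T \<phi> = dist_of g \<phi>" for \<phi>
  proof (cases "\<phi> \<in> schwartz")
    case True
    define \<psi> where "\<psi> x = fourier \<phi> (- x)" for x
    have \<psi>_eq: "\<psi> = fourier (fourier (fourier \<phi>))"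
      unfolding \<psi>_def using fourier_inversion[OF fourier_schwartz[OF True], of "- _"] by auto
    have \<psi>: "\<psi> \<in> schwartz" unfolding \<psi>_eq by (intro fourier_schwartz True)
    have "fourier \<psi> x = \<phi> x" for x
      unfolding \<psi>_eq
      using fourier_inversion[OF fourier_schwartz[OF fourier_schwartz[OF True]], of "- x"] fourier_inversion[OF True, of x]
      by simp
    then have "fourier \<psi> = \<phi>" by (rule ext)
    have "T \<phi> = fourier_dist T \<psi>" using \<psi> \<open>fourier \<psi> = \<phi>\<close> by (simp add: fourier_dist_def)
    also have "\<dots> = (LINT x|lborel. g x * \<psi> x)" using g \<psi> by (simp add: represents_def)
    finally show ?thesis using True by (simp add: dist_of_def \<psi>_def)
  next
    case False
    then show ?thesis using T by (simp add: tempered_def dist_of_def)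
  qed
  then have "T = dist_of g" by (rule ext)
  with m L that show ?thesis by blast
qed

section \<open>Fourier synthesis at the critical order\<close>

lemma continuous_AE_eq_imp_eq:
  fixes f g :: "'a::euclidean_space \<Rightarrow> complex"
  assumes f: "continuous_on UNIV f" and g: "continuous_on UNIV g" and eq: "AE x in lborel. f x = g x"
  shows "f = g"
proof (rule ccontr)
  assume "f \<noteq> g"
  then obtain c where c: "f c \<noteq> g c" by auto
  have "open {x. f x \<noteq> g x}" by (rule open_Collect_neq[OF f g])
  then obtain r where r: "r > 0" "ball c r \<subseteq> {x. f x \<noteq> g x}"
    using c open_contains_ball[of "{x. f x \<noteq> g x}"] by auto
  have "AE x in lborel. x \<notin> ball c r" using eq by eventually_elim (use r in auto)
  then have "emeasure lborel (ball c r) = 0"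
    by (subst (asm) AE_iff_measurable[of "ball c r"]) auto
  moreover have "emeasure lborel (ball c r) > 0"
    using r(1) by (simp add: emeasure_ball ennreal_zero_less_mult_iff unit_ball_vol_pos)
  ultimately show False by simp
qed

text \<open>The order of the Bessel potential spaces that belong to magnitude. Its square-integrable weight makes the
  functions in the positive space have integrable Fourier transforms.\<close>

definition crit :: "'a::euclidean_space itself \<Rightarrow> real" where
  "crit _ = (real DIM('a) + 1) / 2"

text \<open>The inverse Fourier transform.\<close>

definition synthesis :: "('a::euclidean_space \<Rightarrow> complex) \<Rightarrow> 'a \<Rightarrow> complex" where
  "synthesis g x = fourier g (- x)"

lemma bracket_crit_L2: "(\<lambda>x::'a::euclidean_space. cor (bracket (- crit TYPE('a)) x)) \<in> L2 lborel"
proof -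
  have "integrable lborel (\<lambda>x::'a. (bracket (- crit TYPE('a)) x)\<^sup>2)"
    unfolding crit_def bracket_bessel_weight by (rule bessel_weight_integrable)
  then show ?thesis by (simp add: L2_def)
qed

lemma critical_integrable:
  fixes g :: "'a::euclidean_space \<Rightarrow> complex"
  assumes g: "g \<in> borel_measurable borel" "(weighted (crit TYPE('a)) g) \<in> L2 lborel"
  shows "integrable lborel g"
  using weighted_L2_pairing(1)[OF g, of "\<lambda>_. 1"] bracket_crit_L2[where 'a='a] by simp

lemma synthesis_continuous:
  fixes g :: "'a::euclidean_space \<Rightarrow> complex"
  assumes g: "integrable lborel g"
  shows "continuous_on UNIV (synthesis g)"
proof (intro continuous_at_imp_continuous_on ballI)
  fix x :: 'a
  show "isCont (synthesis g) x"
    unfolding continuous_at_sequentially comp_def synthesis_def fourier_eq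
  proof (intro allI impI tendsto_mult tendsto_const)
    fix X assume X: "X \<longlonglongrightarrow> x"
    show "(\<lambda>n. LINT y|lborel. g y * character (- X n) y) \<longlonglongrightarrow> (LINT y|lborel. g y * character (- x) y)"
    proof (rule integral_dominated_convergence[where w="\<lambda>y. cmod (g y)"])
      show "integrable lborel (\<lambda>y. cmod (g y))" using g by simp
      show "AE y in lborel. (\<lambda>n. g y * character (- X n) y) \<longlonglongrightarrow> g y * character (- x) y"
        by (intro AE_I2 tendsto_intros X)
      show "AE y in lborel. norm (g y * character (- X n) y) \<le> cmod (g y)" for n
        by (intro AE_I2) (simp add: norm_mult)
      show "(\<lambda>y. g y * character (- X n) y) \<in> borel_measurable lborel" for n
        using borel_measurable_integrable[OF integrable_mult_character[OF g]] .
      show "(\<lambda>y. g y * character (- x) y) \<in> borel_measurable lborel"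
        using borel_measurable_integrable[OF integrable_mult_character[OF g]] .
    qed
  qed
qed

text \<open>Fubini's theorem, applicable because both \<open>g\<close> and the test function are integrable.\<close>

lemma synthesis_represents:
  fixes g :: "'a::euclidean_space \<Rightarrow> complex"
  assumes g: "integrable lborel g"
  shows "represents (synthesis g) (dist_of g)"
  unfolding represents_def
proof (intro conjI ballI)
  have m: "synthesis g \<in> borel_measurable borel"
    by (rule borel_measurable_continuous_onI[OF synthesis_continuous[OF g]])
  then show "synthesis g \<in> borel_measurable lborel" by simp
  have [measurable]: "g \<in> borel_measurable borel" using borel_measurable_integrable[OF g] by simp
  fix \<phi> :: "'a \<Rightarrow> complex" assume \<phi>: "\<phi> \<in> schwartz"
  have [measurable]: "\<phi> \<in> borel_measurable borel" by (rule schwartz_measurable[OF \<phi>])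
  show "integrable lborel (\<lambda>x. synthesis g x * \<phi> x)"
    by (rule schwartz_integrable_mult_bounded[OF \<phi> m]) (unfold synthesis_def, rule cmod_fourier_le[OF g])
  let ?k = "cor (fourier_const TYPE('a))"
  define H where "H x y = (g y * character (- x) y) * \<phi> x" for x y
  have nH: "norm (H x y) = cmod (g y) * cmod (\<phi> x)" for x y by (simp add: H_def norm_mult)
  have int: "integrable (lborel \<Otimes>\<^sub>M lborel) (case_prod H)"
  proof (rule lborel_pair.Fubini_integrable)
    show "case_prod H \<in> borel_measurable (lborel \<Otimes>\<^sub>M lborel)"
      unfolding H_def by measurable
    show "integrable lborel (\<lambda>x. LINT y|lborel. norm (case_prod H (x, y)))"
      using schwartz_integrable[OF \<phi>] by (simp add: nH)
    show "AE x in lborel. integrable lborel (\<lambda>y. case_prod H (x, y))"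
      unfolding H_def
      by (intro AE_I2) (simp only: prod.case, rule integrable_mult_left, rule integrable_mult_character[OF g])
  qed
  have "(LINT x|lborel. synthesis g x * \<phi> x) = (LINT x|lborel. ?k * (LINT y|lborel. H x y))"
  proof -
    have "synthesis g x * \<phi> x = ?k * (LINT y|lborel. H x y)" for x
      unfolding synthesis_def fourier_eq H_def by (subst integral_mult_left_zero) (simp only: mult.assoc)
    then show ?thesis by (simp only:)
  qed
  also have "\<dots> = ?k * (LINT x|lborel. (LINT y|lborel. H x y))" by (rule integral_mult_right_zero)
  also have "\<dots> = ?k * (LINT y|lborel. (LINT x|lborel. H x y))"
    by (simp only: lborel_pair.integral_snd[OF int] lborel_pair.integral_fst[OF int])
  also have "\<dots> = (LINT y|lborel. g y * fourier \<phi> (- y))"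
  proof -
    have "?k * (LINT x|lborel. H x y) = g y * fourier \<phi> (- y)" for y
    proof -
      have "H x y = g y * (\<phi> x * character (- y) x)" for x
        by (simp add: H_def inner_commute mult_ac)
      then have "(LINT x|lborel. H x y) = g y * (LINT x|lborel. \<phi> x * character (- y) x)"
        by (simp only: integral_mult_right_zero)
      then show ?thesis by (simp only: fourier_eq mult_ac)
    qed
    then show ?thesis by (simp only: integral_mult_right_zero[symmetric])
  qed
  finally show "dist_of g \<phi> = (LINT x|lborel. synthesis g x * \<phi> x)"
    using \<phi> by (simp add: dist_of_def)
qed

section \<open>Finitely supported measures\<close>

abbreviation support :: "'a fm \<Rightarrow> 'a set" where
  "support \<mu> \<equiv> Poly_Mapping.keys \<mu>"

abbreviation mass :: "'a fm \<Rightarrow> 'a \<Rightarrow> complex" where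
  "mass \<mu> \<equiv> Poly_Mapping.lookup \<mu>"

text \<open>The Fourier transform of the measure.\<close>

definition fm_hat :: "'a::euclidean_space fm \<Rightarrow> 'a \<Rightarrow> complex" where
  "fm_hat \<mu> \<xi> = cor (fourier_const TYPE('a)) *
    (\<Sum>a\<in>support \<mu>. mass \<mu> a * character \<xi> a)"

text \<open>The weight turns the norm of the negative Bessel space into the plain L2 norm.\<close>

definition fm_emb :: "'a::euclidean_space fm \<Rightarrow> 'a \<Rightarrow> complex" where
  "fm_emb \<mu> \<xi> = cor (bracket (- crit TYPE('a)) \<xi>) * fm_hat \<mu> \<xi>"

abbreviation point_mass :: "'a \<Rightarrow> 'a fm" where
  "point_mass a \<equiv> Poly_Mapping.single a 1"

lemma fm_hat_superset:
  fixes \<mu> :: "'a::euclidean_space fm"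
  assumes "finite S" "support \<mu> \<subseteq> S"
  shows "fm_hat \<mu> \<xi> = cor (fourier_const TYPE('a)) * (\<Sum>a\<in>S. mass \<mu> a * character \<xi> a)"
  unfolding fm_hat_def
  by (rule arg_cong[where f="(*) _"], rule sum.mono_neutral_left) (use assms in \<open>auto simp: in_keys_iff\<close>)

lemma fm_hat_add: "fm_hat (\<mu> + \<nu>) \<xi> = fm_hat \<mu> \<xi> + fm_hat \<nu> \<xi>"
proof -
  let ?S = "support \<mu> \<union> support \<nu>"
  have "support (\<mu> + \<nu>) \<subseteq> ?S" by (rule Poly_Mapping.keys_add)
  then show ?thesis
    by (simp add: fm_hat_superset[of ?S] lookup_add distrib_right distrib_left sum.distrib)
qed

lemma fm_hat_diff: "fm_hat (\<mu> - \<nu>) \<xi> = fm_hat \<mu> \<xi> - fm_hat \<nu> \<xi>"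
  using fm_hat_add[of "\<mu> - \<nu>" \<nu> \<xi>] by (simp add: algebra_simps)

lemma fm_hat_scale: "fm_hat (Poly_Mapping.map ((*) c) \<mu>) \<xi> = c * fm_hat \<mu> \<xi>"
proof -
  have l: "mass (Poly_Mapping.map ((*) c) \<mu>) a = c * mass \<mu> a" for a
    by (simp add: Poly_Mapping.map.rep_eq when_def)
  then have "support (Poly_Mapping.map ((*) c) \<mu>) \<subseteq> support \<mu>"
    by (auto simp: in_keys_iff)
  then show ?thesis
    by (simp add: fm_hat_superset[of "support \<mu>"] l sum_distrib_left mult_ac)
qed

lemma keys_map_scale: "support (Poly_Mapping.map ((*) c) \<mu>) \<subseteq> support (\<mu> :: 'a fm)"
  by (auto simp: in_keys_iff Poly_Mapping.map.rep_eq when_def)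

lemma fm_emb_add: "fm_emb (\<mu> + \<nu>) = (\<lambda>\<xi>. fm_emb \<mu> \<xi> + fm_emb \<nu> \<xi>)"
  by (simp add: fm_emb_def fm_hat_add distrib_left fun_eq_iff)

lemma fm_emb_diff: "fm_emb (\<mu> - \<nu>) = (\<lambda>\<xi>. fm_emb \<mu> \<xi> - fm_emb \<nu> \<xi>)"
  by (simp add: fm_emb_def fm_hat_diff right_diff_distrib fun_eq_iff)

lemma fm_emb_scale: "fm_emb (Poly_Mapping.map ((*) c) \<mu>) = (\<lambda>\<xi>. c * fm_emb \<mu> \<xi>)"
  by (simp add: fm_emb_def fm_hat_scale fun_eq_iff)

lemma fm_hat_point_mass: "fm_hat (point_mass a) \<xi> = cor (fourier_const TYPE('a::euclidean_space)) * character \<xi> (a::'a)"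
  by (simp add: fm_hat_def)

lemma fm_emb_sum: "fm_emb \<mu> \<xi> = (\<Sum>a\<in>support \<mu>. mass \<mu> a * fm_emb (point_mass a) \<xi>)"
  by (simp add: fm_emb_def fm_hat_point_mass) (simp add: fm_hat_def sum_distrib_left mult_ac)

lemma fm_hat_measurable: "fm_hat \<mu> \<in> borel_measurable borel"
  unfolding fm_hat_def[abs_def]
  by (intro borel_measurable_times borel_measurable_const borel_measurable_sum) measurable

lemma fm_emb_L2: "fm_emb \<mu> \<in> L2 lborel"
proof -
  let ?B = "fourier_const TYPE('a) * (\<Sum>a\<in>support \<mu>. cmod (mass \<mu> a))"
  have "cmod (fm_hat \<mu> \<xi>) \<le> ?B" for \<xi>
  proof -
    have "cmod (\<Sum>a\<in>support \<mu>. mass \<mu> a * character \<xi> a) \<le> (\<Sum>a\<in>support \<mu>. cmod (mass \<mu> a))"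
      by (rule sum_norm_le) (simp add: norm_mult)
    then show ?thesis using fourier_const_pos[where 'a='a] by (simp add: fm_hat_def norm_mult)
  qed
  then have "(\<lambda>\<xi>. fm_hat \<mu> \<xi> * cor (bracket (- crit TYPE('a)) \<xi>)) \<in> L2 lborel"
    using fm_hat_measurable[of \<mu>] by (intro L2_mult_bounded bracket_crit_L2) auto
  then show ?thesis by (simp add: fm_emb_def[abs_def] mult.commute)
qed

lemma l2_inner_fm_emb:
  fixes \<mu> :: "'a::euclidean_space fm"
  assumes u: "u \<in> L2 lborel"
  shows "l2_inner lborel u (fm_emb \<mu>) =
    (\<Sum>a\<in>support \<mu>. cnj (mass \<mu> a) * l2_inner lborel u (fm_emb (point_mass a)))"
proof -
  have "l2_inner lborel u (fm_emb \<mu>) = (LINT \<xi>|lborel. (\<Sum>a\<in>support \<mu>.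
      cnj (mass \<mu> a) * (u \<xi> * cnj (fm_emb (point_mass a) \<xi>))))"
    unfolding l2_inner_def by (subst fm_emb_sum) (simp add: sum_distrib_left mult_ac)
  also have "\<dots> = (\<Sum>a\<in>support \<mu>. LINT \<xi>|lborel.
      cnj (mass \<mu> a) * (u \<xi> * cnj (fm_emb (point_mass a) \<xi>)))"
    by (rule Bochner_Integration.integral_sum)
      (intro integrable_mult_right L2_mult_integrable u L2_cnj fm_emb_L2)
  finally show ?thesis by (simp add: l2_inner_def)
qed

text \<open>The two brackets cancel, and the pairing is evaluation: point masses are the reproducing elements.\<close>

lemma l2_inner_point_mass:
  fixes g :: "'a::euclidean_space \<Rightarrow> complex"
  shows "l2_inner lborel (weighted (crit TYPE('a)) g) (fm_emb (point_mass x)) = synthesis g x"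
proof -
  let ?c = "crit TYPE('a)" and ?k = "cor (fourier_const TYPE('a))"
  have "cor (bracket ?c \<xi>) * g \<xi> * cnj (fm_emb (point_mass x) \<xi>) = ?k * (g \<xi> * character (- x) \<xi>)" for \<xi>
  proof -
    have "cor (bracket ?c \<xi>) * g \<xi> * cnj (fm_emb (point_mass x) \<xi>)
        = cor (bracket ?c \<xi> * bracket (- ?c) \<xi>) * (?k * (g \<xi> * cnj (character \<xi> x)))"
      by (simp only: fm_emb_def fm_hat_point_mass complex_cnj_mult complex_cnj_complex_of_real of_real_mult mult_ac)
    also have "cnj (character \<xi> x) = character (- x) \<xi>"
      by (simp add: exp_cnj inner_commute)
    finally show ?thesis by (simp only: bracket_minus of_real_1 mult_1)
  qed
  then show ?thesis
    unfolding l2_inner_def synthesis_def fourier_eq by (simp only: integral_mult_right_zero)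
qed

text \<open>By sesquilinearity it suffices to consider two point masses; there it is the Fourier transform of the weight.\<close>

lemma fm_inner_eq:
  fixes \<mu> \<nu> :: "'a::euclidean_space fm"
  shows "fm_inner \<mu> \<nu> = cor (magnitude_const TYPE('a)) * l2_inner lborel (fm_emb \<mu>) (fm_emb \<nu>)"
proof -
  let ?K = "magnitude_const TYPE('a)" and ?k = "fourier_const TYPE('a)" and ?c = "crit TYPE('a)"
  have point: "cor ?K * l2_inner lborel (fm_emb (point_mass a)) (fm_emb (point_mass b)) = cor (exp (- norm (a - b)))" for a b :: 'a
  proof -
    have "fm_emb (point_mass a) \<xi> * cnj (fm_emb (point_mass b) \<xi>) =
        cor (?k\<^sup>2) * (cor (bessel_weight \<xi>) * exp (\<i> * cor ((b - a) \<bullet> \<xi>)))" for \<xi>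
    proof -
      have "exp (\<i> * cor ((b - a) \<bullet> \<xi>)) = character \<xi> a * cnj (character \<xi> b)"
        by (simp add: exp_cnj inner_diff_left inner_commute algebra_simps flip: exp_add)
      moreover have "cor (bessel_weight \<xi>) = cor (bracket (- ?c) \<xi>) * cor (bracket (- ?c) \<xi>)"
        unfolding crit_def bracket_bessel_weight[symmetric] by (simp add: power2_eq_square)
      ultimately show ?thesis
        by (simp add: fm_emb_def fm_hat_point_mass power2_eq_square mult_ac)
    qed
    then have "l2_inner lborel (fm_emb (point_mass a)) (fm_emb (point_mass b)) =
        cor (?k\<^sup>2) * cor ((2 * pi) ^ DIM('a) / ?K * exp (- norm (b - a)))"
      unfolding l2_inner_def
      by (simp only: integral_mult_right_zero has_bochner_integral_integral_eq[OF bessel_weight_fourier])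
    also have "\<dots> = cor (?k\<^sup>2 * (2 * pi) ^ DIM('a) / ?K * exp (- norm (a - b)))"
      unfolding of_real_mult[symmetric] by (simp add: norm_minus_commute)
    also have "\<dots> = cor (1 / ?K * exp (- norm (a - b)))"
      by (simp only: fourier_const_sq)
    finally show ?thesis using magnitude_const_pos[where 'a='a] by simp
  qed
  have "cor ?K * l2_inner lborel (fm_emb \<mu>) (fm_emb \<nu>) =
      (\<Sum>b\<in>support \<nu>. \<Sum>a\<in>support \<mu>. cnj (mass \<nu> b) *
        (mass \<mu> a * (cor ?K * l2_inner lborel (fm_emb (point_mass a)) (fm_emb (point_mass b)))))"
  proof -
    have "l2_inner lborel (fm_emb \<mu>) (fm_emb (point_mass b)) =
        (\<Sum>a\<in>support \<mu>. mass \<mu> a * l2_inner lborel (fm_emb (point_mass a)) (fm_emb (point_mass b)))" for b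
    proof -
      have "l2_inner lborel (fm_emb \<mu>) (fm_emb (point_mass b)) = cnj (\<Sum>a\<in>support \<mu>.
          cnj (mass \<mu> a) * l2_inner lborel (fm_emb (point_mass b)) (fm_emb (point_mass a)))"
        by (subst l2_inner_commute, subst l2_inner_fm_emb[OF fm_emb_L2]) (rule refl)
      also have "\<dots> = (\<Sum>a\<in>support \<mu>. mass \<mu> a * cnj (l2_inner lborel (fm_emb (point_mass b)) (fm_emb (point_mass a))))"
        by simp
      finally show ?thesis by (simp only: l2_inner_commute[symmetric])
    qed
    then show ?thesis
      by (subst l2_inner_fm_emb[OF fm_emb_L2]) (simp only: sum_distrib_left mult_ac)
  qed
  also have "\<dots> = fm_inner \<mu> \<nu>"
    unfolding point fm_inner_def by (subst sum.swap) (simp only: mult_ac)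
  finally show ?thesis by simp
qed

lemma fm_norm_eq:
  fixes \<mu> :: "'a::euclidean_space fm"
  shows "fm_norm \<mu> = sqrt (magnitude_const TYPE('a)) * l2_norm lborel (fm_emb \<mu>)"
  by (simp add: fm_norm_def fm_inner_eq l2_inner_self real_sqrt_mult)

text \<open>Inversion at the points of the support.\<close>

lemma fm_dist_eq: "fm_dist \<mu> = dist_of (fm_hat \<mu>)"
proof
  fix \<phi> :: "'a \<Rightarrow> complex"
  show "fm_dist \<mu> \<phi> = dist_of (fm_hat \<mu>) \<phi>"
  proof (cases "\<phi> \<in> schwartz")
    case True
    let ?k = "cor (fourier_const TYPE('a))"
    have F: "fourier \<phi> \<in> schwartz" by (rule fourier_schwartz[OF True])
    have m: "(\<lambda>\<xi>. fourier \<phi> (- \<xi>) * character \<xi> a) \<in> borel_measurable borel" for a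
    proof (rule borel_measurable_times)
      show "(\<lambda>\<xi>. fourier \<phi> (- \<xi>)) \<in> borel_measurable borel"
        by (rule measurable_reflect[OF schwartz_measurable[OF F]])
    qed measurable
    have eq: "(LINT \<xi>|lborel. fourier \<phi> (- \<xi>) * character \<xi> a) = (LINT \<xi>|lborel. fourier \<phi> \<xi> * character (- a) \<xi>)" for a
    proof -
      have "(LINT \<xi>|lborel. fourier \<phi> (- \<xi>) * character \<xi> a) = (LINT \<xi>|lborel. fourier \<phi> (- (0 + (-1) *\<^sub>R \<xi>)) * character (0 + (-1) *\<^sub>R \<xi>) a)"
        using lborel_integral_affine[OF m[of a], where c="-1" and t=0] by simp
      then show ?thesis by (simp add: inner_commute)
    qed
    have int: "integrable lborel (\<lambda>\<xi>. fourier \<phi> (- \<xi>) * character \<xi> a)" for a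
    proof -
      have "(\<lambda>x. fourier \<phi> (- x)) = fourier (fourier (fourier \<phi>))"
        using fourier_inversion[OF F, of "- _"] by auto
      then have "(\<lambda>x. fourier \<phi> (- x)) \<in> schwartz" by (simp add: fourier_schwartz F)
      then have "integrable lborel (\<lambda>\<xi>. character \<xi> a * fourier \<phi> (- \<xi>))"
        by (rule schwartz_integrable_mult_bounded[where B=1]) auto
      then show ?thesis by (simp add: mult.commute)
    qed
    have "dist_of (fm_hat \<mu>) \<phi> = (LINT \<xi>|lborel. (\<Sum>a\<in>support \<mu>.
        (?k * mass \<mu> a) * (fourier \<phi> (- \<xi>) * character \<xi> a)))"
      using True unfolding dist_of_def fm_hat_def by (simp add: sum_distrib_left sum_distrib_right mult_ac)
    also have "\<dots> = (\<Sum>a\<in>support \<mu>. LINT \<xi>|lborel. (?k * mass \<mu> a) * (fourier \<phi> (- \<xi>) * character \<xi> a))"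
      by (rule Bochner_Integration.integral_sum) (intro integrable_mult_right int)
    also have "\<dots> = (\<Sum>a\<in>support \<mu>. mass \<mu> a * fourier (fourier \<phi>) (- a))"
      by (simp only: integral_mult_right_zero eq fourier_eq[of "fourier \<phi>"] mult_ac)
    also have "\<dots> = fm_dist \<mu> \<phi>" using True by (simp add: fm_dist_def fourier_inversion)
    finally show ?thesis by simp
  qed (simp add: fm_dist_def dist_of_def)
qed

section \<open>The completion inside L2\<close>

text \<open>The L2 function that represents a point of the completion.\<close>

definition W_limit :: "'a::euclidean_space W \<Rightarrow> ('a \<Rightarrow> complex) \<Rightarrow> bool" where
  "W_limit w u \<longleftrightarrow> w \<in> W_space \<and> u \<in> L2 lborel \<and>
    (\<forall>s\<in>w. (\<lambda>k. l2_dist lborel (fm_emb (s k)) u) \<longlonglongrightarrow> 0)"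

lemma fm_norm_diff_eq:
  fixes \<mu> \<nu> :: "'a::euclidean_space fm"
  shows "fm_norm (\<mu> - \<nu>) = sqrt (magnitude_const TYPE('a)) * l2_dist lborel (fm_emb \<mu>) (fm_emb \<nu>)"
  by (simp add: fm_norm_eq fm_emb_diff)

lemma sqrt_magnitude_const_pos: "0 < sqrt (magnitude_const TYPE('a::euclidean_space))"
  using magnitude_const_pos[where 'a='a] by simp

lemma fm_norm_tendsto_0_iff:
  fixes s t :: "nat \<Rightarrow> 'a::euclidean_space fm"
  shows "(\<lambda>k. fm_norm (s k - t k)) \<longlonglongrightarrow> 0 \<longleftrightarrow>
    (\<lambda>k. l2_dist lborel (fm_emb (s k)) (fm_emb (t k))) \<longlonglongrightarrow> 0"
  unfolding fm_norm_diff_eq using sqrt_magnitude_const_pos[where 'a='a]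
  by (subst tendsto_mult_left_iff[of "sqrt (magnitude_const TYPE('a))" _ 0, simplified]) auto

lemma fm_Cauchy_iff:
  fixes s :: "nat \<Rightarrow> 'a::euclidean_space fm"
  shows "s \<in> fm_Cauchy \<longleftrightarrow>
    (\<forall>e>0. \<exists>N. \<forall>j\<ge>N. \<forall>k\<ge>N. l2_dist lborel (fm_emb (s j)) (fm_emb (s k)) < e)"
    (is "_ \<longleftrightarrow> (\<forall>e>0. ?Q e)")
proof -
  let ?c = "sqrt (magnitude_const TYPE('a))"
  have c: "?c > 0" by (rule sqrt_magnitude_const_pos)
  have ce: "e * ?c / ?c = e" for e
    using less_imp_neq[OF c, symmetric] by (rule nonzero_mult_div_cancel_right)
  have *: "fm_norm (s j - s k) < e \<longleftrightarrow> l2_dist lborel (fm_emb (s j)) (fm_emb (s k)) < e / ?c" for e j k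
    unfolding fm_norm_diff_eq using c by (simp only: pos_less_divide_eq mult.commute)
  show ?thesis
  proof
    assume s: "s \<in> fm_Cauchy"
    show "\<forall>e>0. ?Q e"
    proof (intro allI impI)
      fix e :: real assume "e > 0"
      then have "e * ?c > 0" using c by (rule mult_pos_pos)
      with s have "\<exists>N. \<forall>j\<ge>N. \<forall>k\<ge>N. fm_norm (s j - s k) < e * ?c" unfolding fm_Cauchy_def by blast
      then show "?Q e" unfolding * ce .
    qed
  next
    assume Q: "\<forall>e>0. ?Q e"
    have Qc: "?Q (e / ?c)" if "e > 0" for e using Q divide_pos_pos[OF that c] by blast
    show "s \<in> fm_Cauchy" unfolding fm_Cauchy_def mem_Collect_eq * by (intro allI impI, rule Qc)
  qed
qed

lemma convergent_imp_fm_Cauchy: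
  fixes s :: "nat \<Rightarrow> 'a::euclidean_space fm"
  assumes u: "u \<in> L2 lborel" and lim: "(\<lambda>k. l2_dist lborel (fm_emb (s k)) u) \<longlonglongrightarrow> 0"
  shows "s \<in> fm_Cauchy"
  unfolding fm_Cauchy_iff
proof (intro allI impI)
  fix e :: real assume "e > 0"
  then obtain N where N: "\<And>k. k \<ge> N \<Longrightarrow> l2_dist lborel (fm_emb (s k)) u < e / 2"
    using LIMSEQ_D[OF lim, of "e / 2"] by auto
  have "l2_dist lborel (fm_emb (s j)) (fm_emb (s k)) < e" if "j \<ge> N" "k \<ge> N" for j k
  proof -
    have "l2_dist lborel (fm_emb (s j)) (fm_emb (s k)) \<le>
        l2_dist lborel (fm_emb (s j)) u + l2_dist lborel u (fm_emb (s k))"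
      by (rule l2_norm_triangle3[OF fm_emb_L2 u fm_emb_L2])
    also have "l2_dist lborel u (fm_emb (s k)) = l2_dist lborel (fm_emb (s k)) u"
      by (rule l2_norm_minus_commute)
    finally show ?thesis using N[OF that(1)] N[OF that(2)] by linarith
  qed
  then show "\<exists>N. \<forall>j\<ge>N. \<forall>k\<ge>N. l2_dist lborel (fm_emb (s j)) (fm_emb (s k)) < e" by blast
qed

lemma l2_limit_transfer:
  assumes L: "\<And>k. f k \<in> L2 M" "\<And>k. g k \<in> L2 M" "u \<in> L2 M"
    and "(\<lambda>k. l2_dist M (f k) (g k)) \<longlonglongrightarrow> 0" "(\<lambda>k. l2_dist M (f k) u) \<longlonglongrightarrow> 0"
  shows "(\<lambda>k. l2_dist M (g k) u) \<longlonglongrightarrow> 0"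
proof (rule Lim_null_comparison)
  show "\<forall>\<^sub>F k in sequentially. norm (l2_dist M (g k) u) \<le>
      l2_dist M (f k) (g k) + l2_dist M (f k) u"
  proof (intro always_eventually allI)
    fix k
    have "l2_dist M (g k) u \<le> l2_dist M (g k) (f k) + l2_dist M (f k) u"
      by (rule l2_norm_triangle3[OF L(2) L(1) L(3)])
    also have "l2_dist M (g k) (f k) = l2_dist M (f k) (g k)"
      by (rule l2_norm_minus_commute)
    finally show "norm (l2_dist M (g k) u) \<le> l2_dist M (f k) (g k) + l2_dist M (f k) u"
      by simp
  qed
  show "(\<lambda>k. l2_dist M (f k) (g k) + l2_dist M (f k) u) \<longlonglongrightarrow> 0"
    using tendsto_add[OF assms(4,5)] by simp
qed

lemma equiv_fm_equiv: "equiv fm_Cauchy (fm_equiv :: ((nat \<Rightarrow> 'a::euclidean_space fm) \<times> _) set)"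
proof (rule equivI)
  let ?R = "fm_equiv :: ((nat \<Rightarrow> 'a fm) \<times> _) set"
  show "?R \<subseteq> fm_Cauchy \<times> fm_Cauchy" by (auto simp: fm_equiv_def)
  show "refl_on fm_Cauchy ?R"
    by (auto simp: refl_on_def fm_equiv_def fm_norm_def fm_inner_def)
  show "sym ?R"
  proof (rule symI)
    fix s t :: "nat \<Rightarrow> 'a fm" assume "(s, t) \<in> fm_equiv"
    moreover have "(\<lambda>k. l2_dist lborel (fm_emb (s k)) (fm_emb (t k))) =
        (\<lambda>k. l2_dist lborel (fm_emb (t k)) (fm_emb (s k)))"
      by (rule ext, rule l2_norm_minus_commute)
    ultimately show "(t, s) \<in> fm_equiv"
      unfolding fm_equiv_def fm_norm_tendsto_0_iff by simp
  qed
  show "trans ?R"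
  proof (rule transI)
    fix r s t :: "nat \<Rightarrow> 'a fm" assume "(r, s) \<in> fm_equiv" "(s, t) \<in> fm_equiv"
    then have C: "r \<in> fm_Cauchy" "t \<in> fm_Cauchy"
      and rs: "(\<lambda>k. l2_dist lborel (fm_emb (r k)) (fm_emb (s k))) \<longlonglongrightarrow> 0"
      and st: "(\<lambda>k. l2_dist lborel (fm_emb (s k)) (fm_emb (t k))) \<longlonglongrightarrow> 0"
      by (auto simp: fm_equiv_def fm_norm_tendsto_0_iff)
    have "(\<lambda>k. l2_dist lborel (fm_emb (r k)) (fm_emb (t k))) \<longlonglongrightarrow> 0"
    proof (rule Lim_null_comparison)
      show "\<forall>\<^sub>F k in sequentially. norm (l2_dist lborel (fm_emb (r k)) (fm_emb (t k))) \<le>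
          l2_dist lborel (fm_emb (r k)) (fm_emb (s k)) + l2_dist lborel (fm_emb (s k)) (fm_emb (t k))"
        by (intro always_eventually allI)
          (simp only: real_norm_def abs_of_nonneg[OF l2_norm_nonneg] l2_norm_triangle3[OF fm_emb_L2 fm_emb_L2 fm_emb_L2])
    qed (use tendsto_add[OF rs st] in simp)
    with C show "(r, t) \<in> fm_equiv" by (simp add: fm_equiv_def fm_norm_tendsto_0_iff)
  qed
qed

lemma W_limit_class:
  fixes s :: "nat \<Rightarrow> 'a::euclidean_space fm"
  assumes u: "u \<in> L2 lborel" and lim: "(\<lambda>k. l2_dist lborel (fm_emb (s k)) u) \<longlonglongrightarrow> 0"
  shows "W_limit (fm_equiv `` {s}) u"
proof -
  have "fm_equiv `` {s} \<in> W_space"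
    unfolding W_space_def by (rule quotientI[OF convergent_imp_fm_Cauchy[OF assms]])
  moreover have "(\<lambda>k. l2_dist lborel (fm_emb (t k)) u) \<longlonglongrightarrow> 0" if "t \<in> fm_equiv `` {s}" for t
    by (rule l2_limit_transfer[OF fm_emb_L2 fm_emb_L2 u _ lim])
      (use that in \<open>auto simp: fm_equiv_def fm_norm_tendsto_0_iff\<close>)
  ultimately show ?thesis using u by (simp add: W_limit_def)
qed

lemma W_limit_exists:
  fixes w :: "'a::euclidean_space W"
  assumes w: "w \<in> W_space" shows "\<exists>u. W_limit w u"
proof -
  obtain s where s: "s \<in> fm_Cauchy" "w = fm_equiv `` {s}"
    using w unfolding W_space_def by (rule quotientE)
  obtain u where "u \<in> L2 lborel" "(\<lambda>k. l2_dist lborel (fm_emb (s k)) u) \<longlonglongrightarrow> 0"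
    using L2_complete[of "\<lambda>k. fm_emb (s k)" lborel] s(1)[unfolded fm_Cauchy_iff] fm_emb_L2 by blast
  then show ?thesis unfolding s(2) by (blast intro: W_limit_class)
qed

lemma W_rep_in: "w \<in> W_space \<Longrightarrow> W_rep w \<in> w"
proof -
  assume "w \<in> W_space"
  then have "\<exists>s. s \<in> w"
    unfolding W_space_def using in_quotient_imp_non_empty[OF equiv_fm_equiv] by blast
  then show ?thesis unfolding W_rep_def by (rule someI_ex)
qed

lemma W_limitD:
  assumes "W_limit w u"
  shows "w \<in> W_space" "u \<in> L2 lborel" "(\<lambda>k. l2_dist lborel (fm_emb (W_rep w k)) u) \<longlonglongrightarrow> 0"
  using assms W_rep_in[of w] by (auto simp: W_limit_def)

lemma W_inner_eq:
  fixes w v :: "'a::euclidean_space W"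
  assumes "W_limit w u" "W_limit v u'"
  shows "W_inner w v = cor (magnitude_const TYPE('a)) * l2_inner lborel u u'"
  unfolding W_inner_def fm_inner_eq
  by (rule limI, rule tendsto_mult_left, rule l2_inner_tendsto)
    (use W_limitD[OF assms(1)] W_limitD[OF assms(2)] fm_emb_L2 in auto)

lemma W_norm_eq:
  fixes w :: "'a::euclidean_space W"
  assumes "W_limit w u"
  shows "W_norm w = sqrt (magnitude_const TYPE('a)) * l2_norm lborel u"
  by (simp add: W_norm_def W_inner_eq[OF assms assms] l2_inner_self real_sqrt_mult)

lemma W_limit_embed: "W_limit (W_embed \<mu>) (fm_emb \<mu>)"
  unfolding W_embed_def by (rule W_limit_class[OF fm_emb_L2]) (simp add: l2_norm_def)

lemma W_limit_diff:
  assumes "W_limit w u" "W_limit v u'"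
  shows "W_limit (W_diff w v) (\<lambda>\<xi>. u \<xi> - u' \<xi>)"
  unfolding W_diff_def
proof (rule W_limit_class)
  show "(\<lambda>\<xi>. u \<xi> - u' \<xi>) \<in> L2 lborel" by (intro L2_diff W_limitD(2)[OF assms(1)] W_limitD(2)[OF assms(2)])
  show "(\<lambda>k. l2_norm lborel (\<lambda>\<xi>. fm_emb (W_rep w k - W_rep v k) \<xi> - (u \<xi> - u' \<xi>))) \<longlonglongrightarrow> 0"
  proof (rule Lim_null_comparison)
    show "\<forall>\<^sub>F k in sequentially. norm (l2_norm lborel (\<lambda>\<xi>. fm_emb (W_rep w k - W_rep v k) \<xi> - (u \<xi> - u' \<xi>))) \<le>
        l2_dist lborel (fm_emb (W_rep w k)) u + l2_dist lborel (fm_emb (W_rep v k)) u'"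
    proof (intro always_eventually allI)
      fix k
      have "(\<lambda>\<xi>. fm_emb (W_rep w k - W_rep v k) \<xi> - (u \<xi> - u' \<xi>)) =
          (\<lambda>\<xi>. (fm_emb (W_rep w k) \<xi> - u \<xi>) + (u' \<xi> - fm_emb (W_rep v k) \<xi>))"
        by (simp add: fm_emb_diff fun_eq_iff)
      moreover have "l2_norm lborel (\<lambda>\<xi>. (fm_emb (W_rep w k) \<xi> - u \<xi>) + (u' \<xi> - fm_emb (W_rep v k) \<xi>)) \<le>
          l2_dist lborel (fm_emb (W_rep w k)) u + l2_dist lborel u' (fm_emb (W_rep v k))"
        by (intro l2_norm_triangle L2_diff fm_emb_L2 W_limitD(2)[OF assms(1)] W_limitD(2)[OF assms(2)])
      ultimately show "norm (l2_norm lborel (\<lambda>\<xi>. fm_emb (W_rep w k - W_rep v k) \<xi> - (u \<xi> - u' \<xi>))) \<le>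
        l2_dist lborel (fm_emb (W_rep w k)) u + l2_dist lborel (fm_emb (W_rep v k)) u'"
        by (simp only: l2_norm_minus_commute[of lborel u'] real_norm_def abs_of_nonneg[OF l2_norm_nonneg])
    qed
  qed (use tendsto_add[OF W_limitD(3)[OF assms(1)] W_limitD(3)[OF assms(2)]] in simp)
qed

text \<open>A point of the completion is determined by its representing function up to null sets.\<close>

lemma W_eqI:
  assumes "W_limit w u" "W_limit v u'" "l2_dist lborel u u' = 0"
  shows "w = v"
proof -
  have rep: "fm_equiv `` {W_rep w} = w" if "w \<in> W_space" for w :: "'a W"
    using that W_rep_in[OF that] equiv_fm_equiv
    by (metis Image_singleton_iff W_space_def equiv_class_eq quotientE)
  note L = W_limitD[OF assms(1)] W_limitD[OF assms(2)]
  have "(\<lambda>k. l2_dist lborel (fm_emb (W_rep v k)) u) \<longlonglongrightarrow> 0"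
  proof (rule Lim_null_comparison)
    show "\<forall>\<^sub>F k in sequentially. norm (l2_dist lborel (fm_emb (W_rep v k)) u) \<le> l2_dist lborel (fm_emb (W_rep v k)) u'"
    proof (intro always_eventually allI)
      fix k
      show "norm (l2_dist lborel (fm_emb (W_rep v k)) u) \<le> l2_dist lborel (fm_emb (W_rep v k)) u'"
        using l2_norm_triangle3[OF fm_emb_L2 L(5) L(2), of "W_rep v k"] assms(3) l2_norm_minus_commute[of lborel u u'] by simp
    qed
  qed (rule L(6))
  then have v: "W_limit (fm_equiv `` {W_rep v}) u" by (rule W_limit_class[OF L(2)])
  have "(\<lambda>k. l2_dist lborel (fm_emb (W_rep w k)) (fm_emb (W_rep v k))) \<longlonglongrightarrow> 0"
  proof (rule Lim_null_comparison)
    show "\<forall>\<^sub>F k in sequentially. norm (l2_dist lborel (fm_emb (W_rep w k)) (fm_emb (W_rep v k))) \<le>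
        l2_dist lborel (fm_emb (W_rep w k)) u + l2_dist lborel (fm_emb (W_rep v k)) u"
    proof (intro always_eventually allI)
      fix k
      show "norm (l2_dist lborel (fm_emb (W_rep w k)) (fm_emb (W_rep v k))) \<le>
        l2_dist lborel (fm_emb (W_rep w k)) u + l2_dist lborel (fm_emb (W_rep v k)) u"
        using l2_norm_triangle3[OF fm_emb_L2 L(2) fm_emb_L2, of "W_rep w k" "W_rep v k"]
        by (simp only: l2_norm_minus_commute[of lborel u] real_norm_def abs_of_nonneg[OF l2_norm_nonneg])
    qed
  qed (use tendsto_add[OF L(3) \<open>(\<lambda>k. l2_dist lborel (fm_emb (W_rep v k)) u) \<longlonglongrightarrow> 0\<close>] in simp)
  then have "(W_rep w, W_rep v) \<in> fm_equiv"
    using convergent_imp_fm_Cauchy[OF L(2,3)] convergent_imp_fm_Cauchy[OF L(5,6)]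
    by (simp add: fm_equiv_def fm_norm_tendsto_0_iff)
  then have "fm_equiv `` {W_rep w} = fm_equiv `` {W_rep v}" by (rule equiv_class_eq[OF equiv_fm_equiv])
  then show ?thesis by (simp only: rep[OF L(1)] rep[OF L(4)])
qed

lemma W_on_iff:
  assumes "W_limit w u"
  shows "w \<in> W_on A \<longleftrightarrow> (\<forall>e>0. \<exists>\<mu>. support \<mu> \<subseteq> A \<and> l2_dist lborel u (fm_emb \<mu>) < e)"
    (is "_ \<longleftrightarrow> (\<forall>e>0. ?Q e)")
proof -
  let ?c = "sqrt (magnitude_const TYPE('a))"
  have c: "?c > 0" by (rule sqrt_magnitude_const_pos)
  have ce: "e * ?c / ?c = e" for e
    using less_imp_neq[OF c, symmetric] by (rule nonzero_mult_div_cancel_right)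
  have *: "W_norm (W_diff w (W_embed \<mu>)) < e \<longleftrightarrow> l2_dist lborel u (fm_emb \<mu>) < e / ?c" for e \<mu>
    unfolding W_norm_eq[OF W_limit_diff[OF assms W_limit_embed]] using c by (simp only: pos_less_divide_eq mult.commute)
  show ?thesis
  proof
    assume w: "w \<in> W_on A"
    show "\<forall>e>0. ?Q e"
    proof (intro allI impI)
      fix e :: real assume "e > 0"
      then have "e * ?c > 0" using c by (rule mult_pos_pos)
      with w have "\<exists>\<mu>. support \<mu> \<subseteq> A \<and> W_norm (W_diff w (W_embed \<mu>)) < e * ?c" unfolding W_on_def by blast
      then show "?Q e" unfolding * ce .
    qed
  next
    assume Q: "\<forall>e>0. ?Q e"
    have Qc: "?Q (e / ?c)" if "e > 0" for e using Q divide_pos_pos[OF that c] by blast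
    show "w \<in> W_on A" unfolding W_on_def mem_Collect_eq *
      by (intro conjI W_limitD(1)[OF assms] allI impI, rule Qc)
  qed
qed

lemma potential_eq:
  fixes w :: "'a::euclidean_space W"
  assumes "W_limit w u"
  shows "potential w x = cor (magnitude_const TYPE('a)) * l2_inner lborel u (fm_emb (point_mass x))"
  unfolding potential_def by (rule W_inner_eq[OF assms W_limit_embed])

section \<open>Weightings\<close>

lemma l2_inner_fm_emb_const:
  assumes u: "u \<in> L2 lborel" and c: "\<And>a. a \<in> A \<Longrightarrow> l2_inner lborel u (fm_emb (point_mass a)) = c"
    and \<mu>: "support \<mu> \<subseteq> A"
  shows "l2_inner lborel u (fm_emb \<mu>) = c * (\<Sum>a\<in>support \<mu>. cnj (mass \<mu> a))"
proof -
  have "l2_inner lborel u (fm_emb \<mu>) = (\<Sum>a\<in>support \<mu>. cnj (mass \<mu> a) * c)"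
  proof (subst l2_inner_fm_emb[OF u], rule sum.cong[OF refl])
    fix a assume "a \<in> support \<mu>"
    then have "a \<in> A" using \<mu> by blast
    then show "cnj (mass \<mu> a) * l2_inner lborel u (fm_emb (point_mass a)) = cnj (mass \<mu> a) * c"
      by (simp only: c)
  qed
  then show ?thesis by (simp add: sum_distrib_left mult.commute)
qed

text \<open>The representing function is a limit of images of measures supported in \<open>A\<close>, and the inner product is
  continuous.\<close>

lemma orthogonal_to_W_on:
  assumes w: "W_limit w u" "w \<in> W_on A" and d: "d \<in> L2 lborel"
    and orth: "\<And>\<mu>. support \<mu> \<subseteq> A \<Longrightarrow> l2_inner lborel d (fm_emb \<mu>) = 0"
  shows "l2_inner lborel d u = 0"
proof -
  have u: "u \<in> L2 lborel" by (rule W_limitD(2)[OF w(1)])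
  have le: "cmod (l2_inner lborel d u) \<le> l2_norm lborel d * e" if e: "e > 0" for e
  proof -
    obtain \<mu> where \<mu>: "support \<mu> \<subseteq> A" "l2_dist lborel u (fm_emb \<mu>) < e"
      using w e unfolding W_on_iff[OF w(1)] by blast
    have "l2_inner lborel d u = l2_inner lborel d (\<lambda>\<xi>. u \<xi> - fm_emb \<mu> \<xi>)"
      by (simp add: l2_inner_diff_right[OF d u fm_emb_L2] orth[OF \<mu>(1)])
    also have "cmod \<dots> \<le> l2_norm lborel d * l2_dist lborel u (fm_emb \<mu>)"
      by (intro l2_inner_bound d L2_diff u fm_emb_L2)
    also have "\<dots> \<le> l2_norm lborel d * e" using \<mu>(2) by (intro mult_left_mono) auto
    finally show ?thesis .
  qed
  have "((\<lambda>e. l2_norm lborel d * e) \<longlongrightarrow> l2_norm lborel d * 0) (at_right 0)" by (intro tendsto_intros)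
  then have "cmod (l2_inner lborel d u) \<le> l2_norm lborel d * 0"
    by (rule tendsto_lowerbound) (use le in \<open>auto simp: eventually_at_right_field intro!: exI[of _ 1]\<close>)
  then show ?thesis by simp
qed

text \<open>The weighted Fourier transform of a Schwartz function that is 1 on a ball containing \<open>A\<close>.\<close>

lemma exists_synthesis_1:
  fixes A :: "'a::euclidean_space set"
  assumes "bounded A"
  shows "\<exists>u\<in>L2 lborel. \<forall>a\<in>A. l2_inner lborel u (fm_emb (point_mass a)) = 1"
proof -
  obtain r where r: "\<And>x. x \<in> A \<Longrightarrow> norm x \<le> r" using assms by (auto simp: bounded_iff)
  obtain h :: "'a \<Rightarrow> complex" where h: "h \<in> schwartz" "\<And>x. (norm x)\<^sup>2 \<le> r\<^sup>2 \<Longrightarrow> h x = 1"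
    using schwartz_cutoff[of "r\<^sup>2"] by blast
  let ?u = "\<lambda>\<xi>. cor (bracket (crit TYPE('a)) \<xi>) * fourier h \<xi>"
  have F: "fourier h \<in> schwartz" by (rule fourier_schwartz[OF h(1)])
  have "?u \<in> L2 lborel" by (rule rapid_bracket_L2[OF schwartz_rapid[OF F] schwartz_measurable[OF F]])
  moreover have "l2_inner lborel ?u (fm_emb (point_mass a)) = 1" if "a \<in> A" for a
    unfolding l2_inner_point_mass synthesis_def fourier_inversion[OF h(1)]
    by (rule h(2)) (use r[OF that] in \<open>auto intro: power_mono\<close>)
  ultimately show ?thesis by blast
qed

text \<open>Project a function that pairs to \<open>1 / K\<close> with the point masses in \<open>A\<close> to their span: its pairings with them do
  not change. The approximating measures delivered by the projection define the point of the completion.\<close>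

lemma weighting_exists:
  fixes A :: "'a::euclidean_space set"
  assumes "bounded A"
  shows "\<exists>w. is_weighting A w"
proof -
  let ?K = "cor (magnitude_const TYPE('a))"
  let ?S = "fm_emb ` {\<mu>. support \<mu> \<subseteq> A}"
  obtain u1 where u1: "u1 \<in> L2 lborel" "\<And>a. a \<in> A \<Longrightarrow> l2_inner lborel u1 (fm_emb (point_mass a)) = 1"
    using exists_synthesis_1[OF assms] by blast
  define u0 where "u0 \<xi> = (1 / ?K) * u1 \<xi>" for \<xi>
  have u0: "u0 \<in> L2 lborel" unfolding u0_def[abs_def] by (rule L2_scale[OF u1(1)])
  have "\<exists>s u. (\<forall>k::nat. s k \<in> ?S) \<and> u \<in> L2 lborel \<and> (\<lambda>k. l2_dist lborel (s k) u) \<longlonglongrightarrow> 0 \<and>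
      (\<forall>f\<in>?S. l2_inner lborel (\<lambda>x. u0 x - u x) f = 0)"
  proof (rule L2_projection[OF _ _ _ _ u0])
    show "?S \<subseteq> L2 lborel" using fm_emb_L2 by auto
    have "(0 :: 'a fm) \<in> {\<mu>. support \<mu> \<subseteq> A}" by simp
    then show "?S \<noteq> {}" by blast
    show "(\<lambda>x. f x + g x) \<in> ?S" if fS: "f \<in> ?S" "g \<in> ?S" for f g
    proof -
      obtain \<mu> where \<mu>: "f = fm_emb \<mu>" "\<mu> \<in> {\<mu>. support \<mu> \<subseteq> A}" using fS(1) by (rule imageE)
      obtain \<nu> where \<nu>: "g = fm_emb \<nu>" "\<nu> \<in> {\<mu>. support \<mu> \<subseteq> A}" using fS(2) by (rule imageE)
      have "\<mu> + \<nu> \<in> {\<mu>. support \<mu> \<subseteq> A}" using Poly_Mapping.keys_add[of \<mu> \<nu>] \<mu>(2) \<nu>(2) by auto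
      then show ?thesis unfolding \<mu>(1) \<nu>(1) fm_emb_add[symmetric] by (rule imageI)
    qed
    show "(\<lambda>x. c * f x) \<in> ?S" if fS: "f \<in> ?S" for c f
    proof -
      obtain \<mu> where \<mu>: "f = fm_emb \<mu>" "\<mu> \<in> {\<mu>. support \<mu> \<subseteq> A}" using fS by (rule imageE)
      have "Poly_Mapping.map ((*) c) \<mu> \<in> {\<mu>. support \<mu> \<subseteq> A}" using keys_map_scale[of c \<mu>] \<mu>(2) by auto
      then show ?thesis unfolding \<mu>(1) fm_emb_scale[symmetric] by (rule imageI)
    qed
  qed
  then obtain s u where s: "\<And>k::nat. s k \<in> ?S" and u: "u \<in> L2 lborel"
    and lim: "(\<lambda>k. l2_dist lborel (s k) u) \<longlonglongrightarrow> 0"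
    and orth: "\<And>f. f \<in> ?S \<Longrightarrow> l2_inner lborel (\<lambda>x. u0 x - u x) f = 0"
    by blast
  have "\<forall>k. \<exists>\<mu>. support \<mu> \<subseteq> A \<and> s k = fm_emb \<mu>" using s by auto
  then obtain m where m: "\<And>k. support (m k) \<subseteq> A" "\<And>k. s k = fm_emb (m k)" by metis
  define w where "w = fm_equiv `` {m}"
  have w: "W_limit w u" unfolding w_def by (rule W_limit_class[OF u]) (use lim m(2) in simp)
  have "w \<in> W_on A"
    unfolding W_on_iff[OF w]
  proof (intro allI impI)
    fix e :: real assume "e > 0"
    then obtain k where "l2_dist lborel (s k) u < e"
      using LIMSEQ_D[OF lim] by fastforce
    then show "\<exists>\<mu>. support \<mu> \<subseteq> A \<and> l2_dist lborel u (fm_emb \<mu>) < e"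
      using m by (intro exI[of _ "m k"]) (simp add: l2_norm_minus_commute)
  qed
  moreover have "potential w a = 1" if a: "a \<in> A" for a
  proof -
    have "l2_inner lborel (\<lambda>x. u0 x - u x) (fm_emb (point_mass a)) = 0"
      by (rule orth) (use a in auto)
    then have "l2_inner lborel u (fm_emb (point_mass a)) = l2_inner lborel u0 (fm_emb (point_mass a))"
      by (simp add: l2_inner_diff_left[OF u0 u fm_emb_L2])
    also have "\<dots> = 1 / ?K" unfolding u0_def[abs_def] l2_inner_scale_left by (simp add: u1(2)[OF a])
    finally show ?thesis
      using magnitude_const_pos[where 'a='a] by (simp add: potential_eq[OF w])
  qed
  ultimately show ?thesis unfolding is_weighting_def by blast
qed

lemma weighting_inner:
  fixes A :: "'a::euclidean_space set"
  assumes w: "is_weighting A w" "W_limit w u" and a: "a \<in> A"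
  shows "l2_inner lborel u (fm_emb (point_mass a)) = cor (1 / magnitude_const TYPE('a))"
proof -
  have "cor (magnitude_const TYPE('a)) * l2_inner lborel u (fm_emb (point_mass a)) = 1"
    using w(1) a unfolding is_weighting_def potential_eq[OF w(2)] by blast
  then show ?thesis using magnitude_const_pos[where 'a='a]
    by (simp add: field_simps)
qed

text \<open>The difference of two weightings is orthogonal to the point masses in \<open>A\<close> and lies in their closed span.\<close>

lemma weighting_unique:
  fixes A :: "'a::euclidean_space set"
  assumes "is_weighting A w" "is_weighting A w'"
  shows "w = w'"
proof -
  have on: "w \<in> W_on A" "w' \<in> W_on A" using assms by (auto simp: is_weighting_def)
  then have "w \<in> W_space" "w' \<in> W_space" by (auto simp: W_on_def)
  then obtain u u' where u: "W_limit w u" and u': "W_limit w' u'"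
    using W_limit_exists by metis
  note L = W_limitD(2)[OF u] W_limitD(2)[OF u']
  let ?d = "\<lambda>\<xi>. u \<xi> - u' \<xi>"
  have d: "?d \<in> L2 lborel" by (rule L2_diff[OF L])
  have "l2_inner lborel ?d (fm_emb (point_mass a)) = 0" if "a \<in> A" for a
    unfolding l2_inner_diff_left[OF L fm_emb_L2]
    by (simp only: weighting_inner[OF assms(1) u that] weighting_inner[OF assms(2) u' that] diff_self)
  then have orth: "l2_inner lborel ?d (fm_emb \<mu>) = 0" if "support \<mu> \<subseteq> A" for \<mu>
    using l2_inner_fm_emb_const[OF d _ that, of 0] by simp
  have "l2_inner lborel ?d ?d = 0"
    unfolding l2_inner_diff_right[OF d L]
    by (simp add: orthogonal_to_W_on[OF u on(1) d orth] orthogonal_to_W_on[OF u' on(2) d orth])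
  then have "l2_norm lborel ?d = 0" by (simp add: l2_inner_self)
  then show ?thesis by (rule W_eqI[OF u u'])
qed

text \<open>Undoing the weight of \<open>fm_emb\<close> gives the Fourier transform of the distribution, and distances in the Bessel norm
  are L2 distances of images.\<close>

lemma W_limit_identified:
  fixes w :: "'a::euclidean_space W"
  assumes w: "W_limit w u"
  defines "g \<equiv> \<lambda>\<xi>. cor (bracket (crit TYPE('a)) \<xi>) * u \<xi>"
  shows "dist_of g \<in> bessel_space (- crit TYPE('a))" and "W_identified w (dist_of g)"
proof -
  let ?c = "crit TYPE('a)"
  have u: "u \<in> L2 lborel" by (rule W_limitD(2)[OF w])
  have [measurable]: "u \<in> borel_measurable borel" using L2_measurable[OF u] by simp
  have gm: "g \<in> borel_measurable borel" unfolding g_def by measurable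
  have gu: "cor (bracket (- ?c) \<xi>) * g \<xi> = u \<xi>" for \<xi>
  proof -
    have "cor (bracket (- ?c) \<xi>) * g \<xi> = cor (bracket (- ?c) \<xi> * bracket ?c \<xi>) * u \<xi>"
      unfolding g_def of_real_mult by (simp only: mult.assoc)
    then show ?thesis by (simp only: bracket_minus of_real_1 mult_1)
  qed
  have gL: "(weighted (- ?c) g) \<in> L2 lborel" unfolding gu using u by simp
  show B: "dist_of g \<in> bessel_space (- ?c)" by (rule dist_of_bessel_space[OF gm gL])
  have norm: "bessel_norm (- ?c) (\<lambda>\<phi>. fm_dist \<mu> \<phi> - dist_of g \<phi>) = l2_dist lborel (fm_emb \<mu>) u" for \<mu> :: "'a fm"
  proof -
    let ?h = "\<lambda>\<xi>. fm_hat \<mu> \<xi> - g \<xi>"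
    have hm: "?h \<in> borel_measurable borel" by (intro borel_measurable_diff fm_hat_measurable gm)
    have hu: "cor (bracket (- ?c) \<xi>) * ?h \<xi> = fm_emb \<mu> \<xi> - u \<xi>" for \<xi>
      unfolding right_diff_distrib gu fm_emb_def ..
    have hL: "(weighted (- ?c) ?h) \<in> L2 lborel"
      unfolding hu by (rule L2_diff[OF fm_emb_L2 u])
    have mL: "(weighted (- ?c) (fm_hat \<mu>)) \<in> L2 lborel"
      using fm_emb_L2[of \<mu>] unfolding fm_emb_def[abs_def] .
    have "fm_dist \<mu> \<phi> - dist_of g \<phi> = dist_of ?h \<phi>" for \<phi>
    proof (cases "\<phi> \<in> schwartz")
      case True
      have F: "fourier \<phi> \<in> schwartz" by (rule fourier_schwartz[OF True])
      have "(\<lambda>\<xi>. cor (bracket (- (- ?c)) \<xi>) * fourier \<phi> (- \<xi>)) \<in> L2 lborel"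
        by (rule rapid_bracket_L2[OF rapid_reflect[OF schwartz_rapid[OF F]] measurable_reflect[OF schwartz_measurable[OF F]]])
      from weighted_L2_pairing(1)[OF fm_hat_measurable mL this] weighted_L2_pairing(1)[OF gm gL this]
      show ?thesis using True by (simp add: fm_dist_eq dist_of_def left_diff_distrib)
    qed (simp add: fm_dist_eq dist_of_def)
    then have "(\<lambda>\<phi>. fm_dist \<mu> \<phi> - dist_of g \<phi>) = dist_of ?h" by (rule ext)
    then show ?thesis using bessel_norm_dist_of[OF hm hL] by (simp only: hu)
  qed
  show "W_identified w (dist_of g)"
    unfolding W_identified_def using w B norm unfolding crit_def W_limit_def by simp
qed

section \<open>The magnitude as an extremal norm\<close>

text \<open>As \<open>v - K u\<close> is orthogonal to \<open>u\<close>, the inner product of \<open>v\<close> and \<open>u\<close> is \<open>K\<close> times the squared norm of \<open>u\<close>; apply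
  the Cauchy-Schwarz inequality.\<close>

lemma weighting_norm_le:
  fixes A :: "'a::euclidean_space set" and v :: "'a \<Rightarrow> complex"
  assumes w: "is_weighting A w" "W_limit w u" and v: "v \<in> L2 lborel"
    and one: "\<And>a. a \<in> A \<Longrightarrow> l2_inner lborel v (fm_emb (point_mass a)) = 1"
  shows "magnitude_const TYPE('a) * l2_norm lborel u \<le> l2_norm lborel v"
proof -
  let ?K = "magnitude_const TYPE('a)"
  have u: "u \<in> L2 lborel" by (rule W_limitD(2)[OF w(2)])
  have on: "w \<in> W_on A" using w(1) by (simp add: is_weighting_def)
  let ?d = "\<lambda>\<xi>. v \<xi> - cor ?K * u \<xi>"
  have d: "?d \<in> L2 lborel" by (intro L2_diff L2_scale u v)
  have "l2_inner lborel ?d (fm_emb (point_mass a)) = 0" if "a \<in> A" for a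
    unfolding l2_inner_diff_left[OF v L2_scale[OF u] fm_emb_L2] l2_inner_scale_left
    using magnitude_const_pos[where 'a='a] by (simp add: weighting_inner[OF w that] one[OF that])
  then have orth: "l2_inner lborel ?d (fm_emb \<mu>) = 0" if "support \<mu> \<subseteq> A" for \<mu>
    using l2_inner_fm_emb_const[OF d _ that, of 0] by simp
  have "l2_inner lborel ?d u = 0" by (rule orthogonal_to_W_on[OF w(2) on d orth])
  then have "l2_inner lborel v u = cor (?K * (l2_norm lborel u)\<^sup>2)"
    unfolding l2_inner_diff_left[OF v L2_scale[OF u] u] l2_inner_scale_left l2_inner_self by simp
  then have "?K * (l2_norm lborel u)\<^sup>2 = cmod (l2_inner lborel v u)"
    using magnitude_const_pos[where 'a='a] by (simp add: norm_mult norm_power)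
  also have "\<dots> \<le> l2_norm lborel v * l2_norm lborel u" by (rule l2_inner_bound[OF v u])
  finally have le: "(?K * l2_norm lborel u) * l2_norm lborel u \<le> l2_norm lborel v * l2_norm lborel u"
    by (simp add: power2_eq_square mult.assoc)
  show ?thesis
  proof (cases "l2_norm lborel u = 0")
    case False
    then have "l2_norm lborel u > 0" using l2_norm_nonneg[of lborel u] by linarith
    with le show ?thesis by (rule mult_right_le_imp_le)
  qed simp
qed

text \<open>The infimum is attained by the potential of the weighting, whose image in L2 is \<open>K u\<close>. For the lower
  bound, continuity is what gives meaning to the condition on \<open>A\<close>, which may be a null set: the given continuous representative
  must be the inverse Fourier transform of \<open>g\<close> everywhere.\<close>

theorem magnitude_eq_Inf:
  fixes A :: "'a::euclidean_space set"
  assumes A: "bounded A"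
  shows "(\<exists>T \<in> bessel_space (- crit TYPE('a)). is_weighting_dist A T) \<and>
    magnitude A = ereal (1 / magnitude_const TYPE('a)) *
      Inf {ereal ((bessel_norm (crit TYPE('a)) T)\<^sup>2) | T h.
        T \<in> bessel_space (crit TYPE('a)) \<and> continuous_representative h T \<and> (\<forall>a\<in>A. h a = 1)}"
    (is "_ \<and> _ = _ * Inf ?X")
proof
  let ?c = "crit TYPE('a)" and ?K = "magnitude_const TYPE('a)"
  have K: "?K > 0" by (rule magnitude_const_pos)
  obtain w where w: "is_weighting A w" using weighting_exists[OF A] by blast
  then have "w \<in> W_space" by (simp add: is_weighting_def W_on_def)
  then obtain u where u: "W_limit w u" using W_limit_exists by blast
  have uL: "u \<in> L2 lborel" by (rule W_limitD(2)[OF u])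
  have [measurable]: "u \<in> borel_measurable borel" using L2_measurable[OF uL] by simp
  show "\<exists>T \<in> bessel_space (- ?c). is_weighting_dist A T"
    using W_limit_identified[OF u] w unfolding is_weighting_dist_def by blast
  have the: "(THE w. is_weighting A w) = w"
    by (rule the_equality[of "is_weighting A", OF w]) (rule weighting_unique[OF _ w])
  have "\<exists>w. is_weighting A w" using w by (rule exI)
  then have "magnitude A = ereal ((W_norm w)\<^sup>2)" by (simp only: magnitude_def the if_True)
  also have "(W_norm w)\<^sup>2 = ?K * (l2_norm lborel u)\<^sup>2"
    unfolding W_norm_eq[OF u] using K by (simp add: power_mult_distrib)
  finally have mag: "magnitude A = ereal (?K * (l2_norm lborel u)\<^sup>2)" .
  have "Inf ?X = ereal ((?K * l2_norm lborel u)\<^sup>2)"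
  proof (rule Inf_eqI)
    fix y assume "y \<in> ?X"
    then obtain T h where y: "y = ereal ((bessel_norm ?c T)\<^sup>2)" and T: "T \<in> bessel_space ?c"
      and h: "continuous_on UNIV h" "represents h T" "\<And>a. a \<in> A \<Longrightarrow> h a = 1"
      unfolding continuous_representative_def by blast
    obtain g where g: "g \<in> borel_measurable borel" "(weighted ?c g) \<in> L2 lborel"
      and Tg: "T = dist_of g" using T by (rule bessel_spaceE)
    have gi: "integrable lborel g" by (rule critical_integrable[OF g])
    have hs: "h = synthesis g"
      by (rule continuous_AE_eq_imp_eq[OF h(1) synthesis_continuous[OF gi]])
        (rule represents_unique[OF h(2)], unfold Tg, rule synthesis_represents[OF gi])
    have "l2_inner lborel (weighted ?c g) (fm_emb (point_mass a)) = 1" if "a \<in> A" for a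
      unfolding l2_inner_point_mass hs[symmetric] by (rule h(3)[OF that])
    then have "?K * l2_norm lborel u \<le> l2_norm lborel (weighted ?c g)"
      by (rule weighting_norm_le[OF w u g(2)])
    then have "(?K * l2_norm lborel u)\<^sup>2 \<le> (bessel_norm ?c T)\<^sup>2"
      unfolding Tg bessel_norm_dist_of[OF g] using K by (intro power_mono) auto
    then show "ereal ((?K * l2_norm lborel u)\<^sup>2) \<le> y" unfolding y by simp
  next
    fix y assume y: "\<And>z. z \<in> ?X \<Longrightarrow> y \<le> z"
    \<comment> \<open>The Fourier transform of the potential of the weighting.\<close>
    define g where "g \<xi> = cor ?K * (cor (bracket (- ?c) \<xi>) * u \<xi>)" for \<xi>
    have gm: "g \<in> borel_measurable borel" unfolding g_def[abs_def] by measurable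
    have gu: "cor (bracket ?c \<xi>) * g \<xi> = cor ?K * u \<xi>" for \<xi>
    proof -
      have "cor (bracket ?c \<xi>) * g \<xi> = cor (bracket ?c \<xi> * bracket (- ?c) \<xi>) * (cor ?K * u \<xi>)"
        unfolding g_def of_real_mult by (simp only: mult_ac)
      then show ?thesis by (simp only: bracket_minus of_real_1 mult_1)
    qed
    have gL: "(weighted ?c g) \<in> L2 lborel" unfolding gu by (rule L2_scale[OF uL])
    have gi: "integrable lborel g" by (rule critical_integrable[OF gm gL])
    have "synthesis g a = 1" if "a \<in> A" for a
      unfolding l2_inner_point_mass[symmetric] gu l2_inner_scale_left weighting_inner[OF w u that]
      using K by simp
    then have "ereal ((bessel_norm ?c (dist_of g))\<^sup>2) \<in> ?X"
      using dist_of_bessel_space[OF gm gL] synthesis_continuous[OF gi] synthesis_represents[OF gi]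
      unfolding continuous_representative_def by blast
    then have "y \<le> ereal ((bessel_norm ?c (dist_of g))\<^sup>2)" by (rule y)
    also have "bessel_norm ?c (dist_of g) = ?K * l2_norm lborel u"
      unfolding bessel_norm_dist_of[OF gm gL] gu l2_norm_scale using K by simp
    finally show "y \<le> ereal ((?K * l2_norm lborel u)\<^sup>2)" .
  qed
  then show "magnitude A = ereal (1 / ?K) * Inf ?X"
    unfolding mag using K by (simp add: power2_eq_square)
qed

theorem corollary5p3:
  fixes A :: "(real ^ 'n) set"
  assumes "compact A"
  shows "(\<exists>T \<in> bessel_space (- ((real CARD('n) + 1) / 2)). is_weighting_dist A T) \<and>
    magnitude A = ereal (1 / (fact CARD('n) * unit_ball_vol (real CARD('n)))) *
      Inf {ereal ((bessel_norm ((real CARD('n) + 1) / 2) T)\<^sup>2) | T h.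
        T \<in> bessel_space ((real CARD('n) + 1) / 2) \<and>
        continuous_representative h T \<and> (\<forall>a\<in>A. h a = 1)}"
  using magnitude_eq_Inf[OF compact_imp_bounded[OF assms]]
  by (simp only: crit_def magnitude_const_def DIM_cart DIM_real mult_1_right)

end
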